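(* Let $k$ be a natural number and let $T$ be a theory in-between $\mathsf{HA}+\neg\neg\mathrm{LEM}(\Pi_{k-2})$ ($\mathsf{HA}$ if $k<2$) and $\mathsf{PA}$. The following are pairwise equivalent: (1) $\mathrm{PNFT}_T\big((\neg\mathrm{E}_{k'})^{\lor\text{-free}},\neg\neg\Pi_{k'}\big)$ for all $k'\le k$; (2) $\mathrm{PNFT}_T\big((\neg\neg\mathrm{U}_{k'})^{\lor\text{-free}},\neg\neg\Pi_{k'}\big)$ for all $k'\le k$; (3) $T\vdash\neg\neg\mathrm{DNE}(\Sigma_{k-1})$.
   Context: $\mathsf{HA}$ is intuitionistic (Heyting) arithmetic in the language with function symbols for all primitive recursive functions and logical constants $\forall,\exists,\to,\land,\lor,\perp$; $\neg\varphi$ abbreviates $\varphi\to\perp$. $\mathsf{PA}$ is $\mathsf{HA}$ plus the law of excluded middle for all formulas. $S+\mathrm{P}$ adds all instances of schema $\mathrm{P}$ to $S$. A theory $T$ is in-between $S$ and $S'$ if it is a theory in the language of $\mathsf{HA}$ whose theorems include those of $S$ and are included in those of $S'$. $T\vdash\mathrm{P}$ means every instance of $\mathrm{P}$ is provable in $T$; a principle indexed by a negative number is vacuous. $\mathrm{FV}(\varphi)$ is the set of free variables. $\Sigma_0=\Pi_0$ are the quantifier-free formulas; $\Pi_{k+1}$: formulas $Q_1\bar x_1\cdots Q_{k+1}\bar x_{k+1}\varphi_{qf}$ ($Q_i=\forall$ for odd $i$, $\exists$ for even $i$); $\Sigma_{k+1}$ likewise starting with $\exists$ (blocks may be empty by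 the paper's convention). $\Gamma(x)$: formulas in $\Gamma$ with free variables among $x$. $\mathrm{LEM}(\Gamma)$: $\forall x(\varphi(x)\lor\neg\varphi(x))$, $\varphi(x)\in\Gamma(x)$; $\mathrm{DNE}(\Gamma)$: $\forall x(\neg\neg\varphi(x)\to\varphi(x))$, $\varphi(x)\in\Gamma(x)$. For a principle $\mathrm{P}$ of these forms, $\neg\neg\mathrm{P}$ is the schema $\neg\neg\xi$ for $\xi$ an instance (a sentence) of $\mathrm{P}$. For a class $\Gamma$: $\neg\Gamma=\{\neg\varphi:\varphi\in\Gamma\}$, $\neg\neg\Gamma=\{\neg\neg\varphi:\varphi\in\Gamma\}$, and $\Gamma^{\lor\text{-free}}$ is the class of formulas in $\Gamma$ not containing $\lor$. $\mathrm{PNFT}_T(\Gamma,\Gamma')$: for every $\varphi\in\Gamma$ there is $\varphi'\in\Gamma'$ with $\mathrm{FV}(\varphi)=\mathrm{FV}(\varphi')$ and $T\vdash\varphi\leftrightarrow\varphi'$. Alternation paths: finite alternating sequences of $+,-$; $i(s)$ first symbol ($\times$ if empty), $s^\perp$ swaps signs, $l(s)$ length. $\mathrm{Alt}(\varphi)=\{\langle\rangle\}$ for quantifier-free $\varphi$; otherwise $\mathrm{Alt}(\neg\varphi_1)=\{s^\perp:s\in\mathrm{Alt}(\varphi_1)\}$, $\mathrm{Alt}(\varphi_1\land\varphi_2)=\mathrm{Alt}(\varphi_1\lor\varphi_2)=\mathrm{Alt}(\varphi_1)\cup\mathrm{Alt}(\varphi_2)$, $\mathrm{Alt}(\varphi_1\to\varphi_2)=\{s^\perp:s\in\mathrm{Alt}(\varphi_1)\}\cup\mathrm{Alt}(\varphi_2)$,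 $\mathrm{Alt}(\forall x\varphi_1)=\{s\in\mathrm{Alt}(\varphi_1):i(s)=-\}\cup\{-s:s\in\mathrm{Alt}(\varphi_1),i(s)\ne-\}$, $\mathrm{Alt}(\exists x\varphi_1)=\{s\in\mathrm{Alt}(\varphi_1):i(s)=+\}\cup\{+s:s\in\mathrm{Alt}(\varphi_1),i(s)\ne+\}$. $\deg\varphi=\max\{l(s):s\in\mathrm{Alt}(\varphi)\}$, $\mathrm{F}_k=\{\varphi:\deg\varphi=k\}$, $\mathrm{U}_0=\mathrm{E}_0=\mathrm{F}_0$, $\mathrm{U}_{k+1}=\{\varphi\in\mathrm{F}_{k+1}:i(s)=-$ for all $s\in\mathrm{Alt}(\varphi)$ with $l(s)=k+1\}$, $\mathrm{E}_{k+1}$ likewise with $+$. *)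

theory Defs
  imports Main
begin

subsection \<open>The language of arithmetic\<close>

text \<open>
  A function symbol is a pair of a primitive recursive code and an arity; the arity is the length
  of the argument list to which the code is applied in a term, so that every term is well formed.
  A code is meaningful at every arity (missing arguments count as 0, surplus ones are ignored),
  and every primitive recursive function of arity n is named by some code at arity n.
\<close>

datatype pr = Zr | Sc | Pj nat | Cn pr "pr list" | Rc pr pr

datatype trm = Var nat | Fn pr "trm list"

abbreviation zero :: trm where "zero \<equiv> Fn Zr []"
abbreviation suc :: "trm \<Rightarrow> trm" where "suc t \<equiv> Fn Sc [t]"

text \<open>Formulas use de Bruijn indices; \<open>FAll\<close> and \<open>FEx\<close> bind index 0 of their argument.\<close>

datatype fm =
    FEq trm trm
  | FBot
  | FImp fm fm
  | FAnd fm fm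
  | FOr fm fm
  | FAll fm
  | FEx fm

abbreviation FNeg :: "fm \<Rightarrow> fm" where "FNeg \<phi> \<equiv> FImp \<phi> FBot"
abbreviation FIff :: "fm \<Rightarrow> fm \<Rightarrow> fm" where "FIff \<phi> \<psi> \<equiv> FAnd (FImp \<phi> \<psi>) (FImp \<psi> \<phi>)"

primrec fv_trm :: "trm \<Rightarrow> nat set" where
  "fv_trm (Var n) = {n}"
| "fv_trm (Fn f ts) = \<Union> (set (map fv_trm ts))"

primrec FV :: "fm \<Rightarrow> nat set" where
  "FV (FEq s t) = fv_trm s \<union> fv_trm t"
| "FV FBot = {}"
| "FV (FImp \<phi> \<psi>) = FV \<phi> \<union> FV \<psi>"
| "FV (FAnd \<phi> \<psi>) = FV \<phi> \<union> FV \<psi>"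
| "FV (FOr \<phi> \<psi>) = FV \<phi> \<union> FV \<psi>"
| "FV (FAll \<phi>) = {n. Suc n \<in> FV \<phi>}"
| "FV (FEx \<phi>) = {n. Suc n \<in> FV \<phi>}"

primrec sub_trm :: "(nat \<Rightarrow> trm) \<Rightarrow> trm \<Rightarrow> trm" where
  "sub_trm \<sigma> (Var n) = \<sigma> n"
| "sub_trm \<sigma> (Fn f ts) = Fn f (map (sub_trm \<sigma>) ts)"

definition up :: "(nat \<Rightarrow> trm) \<Rightarrow> nat \<Rightarrow> trm" where
  "up \<sigma> = case_nat (Var 0) (\<lambda>n. sub_trm (\<lambda>m. Var (Suc m)) (\<sigma> n))"

primrec sub :: "(nat \<Rightarrow> trm) \<Rightarrow> fm \<Rightarrow> fm" where
  "sub \<sigma> (FEq s t) = FEq (sub_trm \<sigma> s) (sub_trm \<sigma> t)"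
| "sub \<sigma> FBot = FBot"
| "sub \<sigma> (FImp \<phi> \<psi>) = FImp (sub \<sigma> \<phi>) (sub \<sigma> \<psi>)"
| "sub \<sigma> (FAnd \<phi> \<psi>) = FAnd (sub \<sigma> \<phi>) (sub \<sigma> \<psi>)"
| "sub \<sigma> (FOr \<phi> \<psi>) = FOr (sub \<sigma> \<phi>) (sub \<sigma> \<psi>)"
| "sub \<sigma> (FAll \<phi>) = FAll (sub (up \<sigma>) \<phi>)"
| "sub \<sigma> (FEx \<phi>) = FEx (sub (up \<sigma>) \<phi>)"

definition lift :: "fm \<Rightarrow> fm" where
  "lift = sub (\<lambda>n. Var (Suc n))"

definition inst :: "fm \<Rightarrow> trm \<Rightarrow> fm" where
  "inst \<phi> t = sub (case_nat t Var) \<phi>"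

subsection \<open>Intuitionistic predicate logic with equality\<close>

text \<open>
  \<open>T\<close> is a set of axioms and \<open>\<Gamma>\<close> a set of local assumptions. Since \<open>T\<close> is not lifted in
  \<open>AllI\<close> and \<open>ExE\<close>, free variables of axioms are implicitly universally quantified.
\<close>

inductive prv :: "fm set \<Rightarrow> fm set \<Rightarrow> fm \<Rightarrow> bool" for T where
  Ax: "\<phi> \<in> T \<Longrightarrow> prv T \<Gamma> \<phi>"
| Hyp: "\<phi> \<in> \<Gamma> \<Longrightarrow> prv T \<Gamma> \<phi>"
| BotE: "prv T \<Gamma> FBot \<Longrightarrow> prv T \<Gamma> \<phi>"
| ImpI: "prv T (insert \<phi> \<Gamma>) \<psi> \<Longrightarrow> prv T \<Gamma> (FImp \<phi> \<psi>)"
| ImpE: "prv T \<Gamma> (FImp \<phi> \<psi>) \<Longrightarrow> prv T \<Gamma> \<phi> \<Longrightarrow> prv T \<Gamma> \<psi>"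
| AndI: "prv T \<Gamma> \<phi> \<Longrightarrow> prv T \<Gamma> \<psi> \<Longrightarrow> prv T \<Gamma> (FAnd \<phi> \<psi>)"
| AndE1: "prv T \<Gamma> (FAnd \<phi> \<psi>) \<Longrightarrow> prv T \<Gamma> \<phi>"
| AndE2: "prv T \<Gamma> (FAnd \<phi> \<psi>) \<Longrightarrow> prv T \<Gamma> \<psi>"
| OrI1: "prv T \<Gamma> \<phi> \<Longrightarrow> prv T \<Gamma> (FOr \<phi> \<psi>)"
| OrI2: "prv T \<Gamma> \<psi> \<Longrightarrow> prv T \<Gamma> (FOr \<phi> \<psi>)"
| OrE: "prv T \<Gamma> (FOr \<phi> \<psi>) \<Longrightarrow> prv T (insert \<phi> \<Gamma>) \<chi> \<Longrightarrow> prv T (insert \<psi> \<Gamma>) \<chi> \<Longrightarrow> prv T \<Gamma> \<chi>"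
| AllI: "prv T (lift ` \<Gamma>) \<phi> \<Longrightarrow> prv T \<Gamma> (FAll \<phi>)"
| AllE: "prv T \<Gamma> (FAll \<phi>) \<Longrightarrow> prv T \<Gamma> (inst \<phi> t)"
| ExI: "prv T \<Gamma> (inst \<phi> t) \<Longrightarrow> prv T \<Gamma> (FEx \<phi>)"
| ExE: "prv T \<Gamma> (FEx \<phi>) \<Longrightarrow> prv T (insert \<phi> (lift ` \<Gamma>)) (lift \<psi>) \<Longrightarrow> prv T \<Gamma> \<psi>"
| EqRefl: "prv T \<Gamma> (FEq t t)"
| EqSubst: "prv T \<Gamma> (FEq s t) \<Longrightarrow> prv T \<Gamma> (inst \<phi> s) \<Longrightarrow> prv T \<Gamma> (inst \<phi> t)"

definition theorems :: "fm set \<Rightarrow> fm set" where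
  "theorems T = {\<phi>. prv T {} \<phi>}"

definition in_between :: "fm set \<Rightarrow> fm set \<Rightarrow> fm set \<Rightarrow> bool" where
  "in_between S S' T \<longleftrightarrow> theorems S \<subseteq> theorems T \<and> theorems T \<subseteq> theorems S'"

text \<open>A principle is the set of its instances.\<close>

definition proves :: "fm set \<Rightarrow> fm set \<Rightarrow> bool" where
  "proves T P \<longleftrightarrow> P \<subseteq> theorems T"

subsection \<open>Heyting and Peano arithmetic\<close>

inductive_set HA :: "fm set" where
  Suc_neq_zero: "FNeg (FEq (suc t) zero) \<in> HA"
| Suc_inj: "FImp (FEq (suc s) (suc t)) (FEq s t) \<in> HA"
| Zr: "FEq (Fn Zr ts) zero \<in> HA"
| Sc_Nil: "FEq (Fn Sc []) (suc zero) \<in> HA"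
| Sc_Cons: "FEq (Fn Sc (t # ts)) (suc t) \<in> HA"
| Pj: "FEq (Fn (Pj i) ts) (if i < length ts then ts ! i else zero) \<in> HA"
| Cn: "FEq (Fn (Cn f gs) ts) (Fn f (map (\<lambda>g. Fn g ts) gs)) \<in> HA"
| Rc_Nil: "FEq (Fn (Rc f g) []) (Fn f []) \<in> HA"
| Rc_zero: "FEq (Fn (Rc f g) (zero # ts)) (Fn f ts) \<in> HA"
| Rc_suc: "FEq (Fn (Rc f g) (suc t # ts)) (Fn g (Fn (Rc f g) (t # ts) # t # ts)) \<in> HA"
| Induct: "FImp (inst \<phi> zero)
     (FImp (FAll (FImp \<phi> (sub (case_nat (suc (Var 0)) (\<lambda>n. Var (Suc n))) \<phi>))) (FAll \<phi>)) \<in> HA"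

definition PA :: "fm set" where
  "PA = HA \<union> {FOr \<phi> (FNeg \<phi>) | \<phi>. True}"

subsection \<open>Prenex classes and principles\<close>

primrec qf :: "fm \<Rightarrow> bool" where
  "qf (FEq s t) = True"
| "qf FBot = True"
| "qf (FImp \<phi> \<psi>) = (qf \<phi> \<and> qf \<psi>)"
| "qf (FAnd \<phi> \<psi>) = (qf \<phi> \<and> qf \<psi>)"
| "qf (FOr \<phi> \<psi>) = (qf \<phi> \<and> qf \<psi>)"
| "qf (FAll \<phi>) = False"
| "qf (FEx \<phi>) = False"

fun Sigma_cl :: "nat \<Rightarrow> fm set" and Pi_cl :: "nat \<Rightarrow> fm set" where
  "Sigma_cl 0 = {\<phi>. qf \<phi>}"
| "Sigma_cl (Suc k) = {(FEx ^^ n) \<phi> | n \<phi>. \<phi> \<in> Pi_cl k}"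
| "Pi_cl 0 = {\<phi>. qf \<phi>}"
| "Pi_cl (Suc k) = {(FAll ^^ n) \<phi> | n \<phi>. \<phi> \<in> Sigma_cl k}"

text \<open>In the schemas below the single variable x of \<open>\<phi>(x)\<close> is index 0.\<close>

definition LEM :: "fm set \<Rightarrow> fm set" where
  "LEM \<Gamma> = {FAll (FOr \<phi> (FNeg \<phi>)) | \<phi>. \<phi> \<in> \<Gamma> \<and> FV \<phi> \<subseteq> {0}}"

definition DNE :: "fm set \<Rightarrow> fm set" where
  "DNE \<Gamma> = {FAll (FImp (FNeg (FNeg \<phi>)) \<phi>) | \<phi>. \<phi> \<in> \<Gamma> \<and> FV \<phi> \<subseteq> {0}}"

text \<open>Principles with a negative index are vacuous, whence the integer indices.\<close>

definition LEM_Pi :: "int \<Rightarrow> fm set" where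
  "LEM_Pi i = (if i < 0 then {} else LEM (Pi_cl (nat i)))"

definition DNE_Sigma :: "int \<Rightarrow> fm set" where
  "DNE_Sigma i = (if i < 0 then {} else DNE (Sigma_cl (nat i)))"

text \<open>The following two operations apply both to classes of formulas and to principles.\<close>

definition neg :: "fm set \<Rightarrow> fm set" where
  "neg \<Gamma> = {FNeg \<phi> | \<phi>. \<phi> \<in> \<Gamma>}"

definition nneg :: "fm set \<Rightarrow> fm set" where
  "nneg \<Gamma> = {FNeg (FNeg \<phi>) | \<phi>. \<phi> \<in> \<Gamma>}"

primrec or_free :: "fm \<Rightarrow> bool" where
  "or_free (FEq s t) = True"
| "or_free FBot = True"
| "or_free (FImp \<phi> \<psi>) = (or_free \<phi> \<and> or_free \<psi>)"
| "or_free (FAnd \<phi> \<psi>) = (or_free \<phi> \<and> or_free \<psi>)"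
| "or_free (FOr \<phi> \<psi>) = False"
| "or_free (FAll \<phi>) = or_free \<phi>"
| "or_free (FEx \<phi>) = or_free \<phi>"

definition or_free_part :: "fm set \<Rightarrow> fm set" where
  "or_free_part \<Gamma> = {\<phi> \<in> \<Gamma>. or_free \<phi>}"

definition PNFT :: "fm set \<Rightarrow> fm set \<Rightarrow> fm set \<Rightarrow> bool" where
  "PNFT T \<Gamma> \<Gamma>' \<longleftrightarrow>
     (\<forall>\<phi>\<in>\<Gamma>. \<exists>\<phi>'\<in>\<Gamma>'. FV \<phi> = FV \<phi>' \<and> FIff \<phi> \<phi>' \<in> theorems T)"

subsection \<open>Alternation paths\<close>

datatype sign = Plus | Minus

primrec flip :: "sign \<Rightarrow> sign" where
  "flip Plus = Minus"
| "flip Minus = Plus"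

definition perp :: "sign list \<Rightarrow> sign list" where
  "perp s = map flip s"

text \<open>\<open>None\<close> stands for the symbol \<open>\<times>\<close> assigned to the empty path.\<close>

definition init_sign :: "sign list \<Rightarrow> sign option" where
  "init_sign s = (case s of [] \<Rightarrow> None | a # _ \<Rightarrow> Some a)"

text \<open>The clause for negation takes precedence over the one for implication.\<close>

primrec Alt :: "fm \<Rightarrow> sign list set" where
  "Alt (FEq s t) = {[]}"
| "Alt FBot = {[]}"
| "Alt (FImp \<phi> \<psi>) = (if \<psi> = FBot then perp ` Alt \<phi> else perp ` Alt \<phi> \<union> Alt \<psi>)"
| "Alt (FAnd \<phi> \<psi>) = Alt \<phi> \<union> Alt \<psi>"
| "Alt (FOr \<phi> \<psi>) = Alt \<phi> \<union> Alt \<psi>"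
| "Alt (FAll \<phi>) = {s \<in> Alt \<phi>. init_sign s = Some Minus}
     \<union> {Minus # s | s. s \<in> Alt \<phi> \<and> init_sign s \<noteq> Some Minus}"
| "Alt (FEx \<phi>) = {s \<in> Alt \<phi>. init_sign s = Some Plus}
     \<union> {Plus # s | s. s \<in> Alt \<phi> \<and> init_sign s \<noteq> Some Plus}"

lemma Alt_qf: "qf \<phi> \<Longrightarrow> Alt \<phi> = {[]}"
  by (induction \<phi>) (auto simp: perp_def)

definition deg :: "fm \<Rightarrow> nat" where
  "deg \<phi> = Max (length ` Alt \<phi>)"

definition F_cl :: "nat \<Rightarrow> fm set" where
  "F_cl k = {\<phi>. deg \<phi> = k}"

primrec U_cl :: "nat \<Rightarrow> fm set" where
  "U_cl 0 = F_cl 0"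
| "U_cl (Suc k) = {\<phi> \<in> F_cl (Suc k). \<forall>s\<in>Alt \<phi>. length s = Suc k \<longrightarrow> init_sign s = Some Minus}"

primrec E_cl :: "nat \<Rightarrow> fm set" where
  "E_cl 0 = F_cl 0"
| "E_cl (Suc k) = {\<phi> \<in> F_cl (Suc k). \<forall>s\<in>Alt \<phi>. length s = Suc k \<longrightarrow> init_sign s = Some Plus}"

end

theory Submission
  imports Defs "HOL-Library.Reflection"
begin

text \<open>
  Both implications rest on one translation, the negative translation with a formula \<open>A\<close> in place
  of \<open>\<bottom>\<close>, which sends theorems of \<open>PA\<close> to theorems of \<open>HA\<close>.

  Assume \<open>\<not>\<not>DNE(\<Sigma>\<^bsub>k-1\<^esub>)\<close>. Since the equivalence to be proved relates negated formulas, \<open>DNE(\<Sigma>\<^bsub>k-1\<^esub>)\<close>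
  itself may be used. It makes every \<open>\<or>\<close>-free formula of the class \<open>U\<^sub>k\<close>, and every \<open>\<Pi>\<^sub>k\<close> formula,
  equivalent to its translation with \<open>A = \<bottom>\<close>, so the classical prenex normal form is also a normal
  form in the theory.

  Conversely, let \<open>\<sigma>\<close> be \<open>\<Sigma>\<^bsub>m+1\<^esub>\<close>, and \<open>\<or>\<close>-free, which is no restriction because
  quantifier-free formulas are decidable. The formula \<open>\<not>\<not>\<forall>x(\<not>\<not>\<sigma> \<rightarrow> \<sigma>)\<close> belongs to both classes, so
  it is equivalent to some \<open>\<not>\<not>\<pi>\<close> with \<open>\<pi>\<close> in \<open>\<Pi>\<^bsub>m+2\<^esub>\<close>, and \<open>PA\<close> proves \<open>\<pi>\<close>. Over
  \<open>HA + LEM(\<Sigma>\<^sub>m)\<close> the translation of a \<open>\<Sigma>\<^sub>m\<close> or \<open>\<Pi>\<^sub>m\<close> formula \<open>\<phi>\<close> is \<open>\<phi> \<or> A\<close>; taking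
  for \<open>A\<close> the \<open>\<Sigma>\<^bsub>m+1\<^esub>\<close> matrix of \<open>\<pi>\<close>, as in Friedman's argument for \<open>\<Pi>\<^sub>2\<close>
  conservation, shows that this theory proves \<open>\<pi>\<close>. The double negations of \<open>LEM(\<Sigma>\<^sub>m)\<close> follow
  from those of \<open>LEM(\<Pi>\<^sub>m)\<close> and of \<open>DNE(\<Sigma>\<^sub>m)\<close>, by induction on \<open>m\<close>.
\<close>

subsection \<open>Substitution\<close>

abbreviation lift_trm :: "trm \<Rightarrow> trm" where "lift_trm \<equiv> sub_trm (\<lambda>n. Var (Suc n))"

lemma sub_trm_cong: "(\<And>n. n \<in> fv_trm t \<Longrightarrow> \<sigma> n = \<tau> n) \<Longrightarrow> sub_trm \<sigma> t = sub_trm \<tau> t"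
  by (induction t) auto

lemma sub_trm_Var [simp]: "sub_trm Var t = t"
  by (induction t) (auto intro: map_idI)

lemma sub_trm_sub_trm [simp]: "sub_trm \<sigma> (sub_trm \<tau> t) = sub_trm (\<lambda>n. sub_trm \<sigma> (\<tau> n)) t"
  by (induction t) auto

lemma up_simps [simp]: "up \<sigma> 0 = Var 0" "up \<sigma> (Suc n) = lift_trm (\<sigma> n)"
  by (simp_all add: up_def)

lemma up_Var [simp]: "up Var = Var"
  by (rule ext) (simp add: up_def split: nat.split)

lemma up_comp [simp]: "(\<lambda>n. sub_trm (up \<sigma>) (up \<tau> n)) = up (\<lambda>n. sub_trm \<sigma> (\<tau> n))"
  by (rule ext) (simp add: up_def split: nat.split)

lemma up_cong: "(\<And>n. Suc n \<in> A \<Longrightarrow> \<sigma> n = \<tau> n) \<Longrightarrow> m \<in> A \<Longrightarrow> up \<sigma> m = up \<tau> m"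
  by (cases m) auto

lemma sub_cong: "(\<And>n. n \<in> FV \<phi> \<Longrightarrow> \<sigma> n = \<tau> n) \<Longrightarrow> sub \<sigma> \<phi> = sub \<tau> \<phi>"
proof (induction \<phi> arbitrary: \<sigma> \<tau>)
  case (FEq s t)
  then show ?case using sub_trm_cong[of s \<sigma> \<tau>] sub_trm_cong[of t \<sigma> \<tau>] by simp
next
  case (FAll \<phi>)
  show ?case using FAll.IH[of "up \<sigma>" "up \<tau>"] up_cong[of "FV \<phi>" \<sigma> \<tau>] FAll.prems by simp
next
  case (FEx \<phi>)
  show ?case using FEx.IH[of "up \<sigma>" "up \<tau>"] up_cong[of "FV \<phi>" \<sigma> \<tau>] FEx.prems by simp
next
  case (FImp \<phi> \<psi>)
  show ?case using FImp.IH[of \<sigma> \<tau>] FImp.prems by simp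
next
  case (FAnd \<phi> \<psi>)
  show ?case using FAnd.IH[of \<sigma> \<tau>] FAnd.prems by simp
next
  case (FOr \<phi> \<psi>)
  show ?case using FOr.IH[of \<sigma> \<tau>] FOr.prems by simp
qed simp

lemma sub_Var [simp]: "sub Var \<phi> = \<phi>"
  by (induction \<phi>) auto

lemma sub_sub [simp]: "sub \<sigma> (sub \<tau> \<phi>) = sub (\<lambda>n. sub_trm \<sigma> (\<tau> n)) \<phi>"
  by (induction \<phi> arbitrary: \<sigma> \<tau>) auto

lemma sub_closed: "FV \<phi> = {} \<Longrightarrow> sub \<sigma> \<phi> = \<phi>"
  using sub_cong[of \<phi> \<sigma> Var] by simp

lemma fv_sub_trm: "fv_trm (sub_trm \<sigma> t) = (\<Union>n\<in>fv_trm t. fv_trm (\<sigma> n))"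
  by (induction t) auto

lemma fv_up: "{m. \<exists>n\<in>A. Suc m \<in> fv_trm (up \<sigma> n)} = (\<Union>n\<in>{n. Suc n \<in> A}. fv_trm (\<sigma> n))"
proof -
  have "Suc m \<in> fv_trm (up \<sigma> n) \<longleftrightarrow> (\<exists>n'. n = Suc n' \<and> m \<in> fv_trm (\<sigma> n'))" for m n
    by (cases n) (auto simp: fv_sub_trm)
  then show ?thesis by auto
qed

lemma FV_sub: "FV (sub \<sigma> \<phi>) = (\<Union>n\<in>FV \<phi>. fv_trm (\<sigma> n))"
  by (induction \<phi> arbitrary: \<sigma>) (simp_all add: fv_sub_trm fv_up)

lemma FV_lift: "FV (lift \<phi>) = Suc ` FV \<phi>"
  by (auto simp: lift_def FV_sub)

lemma finite_fv_trm: "finite (fv_trm t)"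
  by (induction t) auto

lemma finite_FV: "finite (FV \<phi>)"
proof -
  have "finite {n. Suc n \<in> A}" if "finite A" for A
    using finite_vimageI[OF that inj_Suc] by (simp add: vimage_def)
  then show ?thesis by (induction \<phi>) (simp_all add: finite_fv_trm)
qed

lemma FV_bounded: obtains N where "FV \<phi> \<subseteq> {..<N}"
  using finite_nat_set_iff_bounded[of "FV \<phi>"] finite_FV[of \<phi>] by auto

lemma lift_simps [simp]:
  "lift FBot = FBot"
  "lift (FEq s t) = FEq (lift_trm s) (lift_trm t)"
  "lift (FImp \<phi> \<psi>) = FImp (lift \<phi>) (lift \<psi>)"
  "lift (FAnd \<phi> \<psi>) = FAnd (lift \<phi>) (lift \<psi>)"
  "lift (FOr \<phi> \<psi>) = FOr (lift \<phi>) (lift \<psi>)"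
  by (simp_all add: lift_def)

lemma inst_simps [simp]:
  "inst FBot t = FBot"
  "inst (FEq s u) t = FEq (sub_trm (case_nat t Var) s) (sub_trm (case_nat t Var) u)"
  "inst (FImp \<phi> \<psi>) t = FImp (inst \<phi> t) (inst \<psi> t)"
  "inst (FAnd \<phi> \<psi>) t = FAnd (inst \<phi> t) (inst \<psi> t)"
  "inst (FOr \<phi> \<psi>) t = FOr (inst \<phi> t) (inst \<psi> t)"
  by (simp_all add: inst_def)

lemma sub_lift: "sub (up \<sigma>) (lift \<phi>) = lift (sub \<sigma> \<phi>)"
  by (simp add: lift_def)

lemma inst_lift [simp]: "inst (lift \<phi>) t = \<phi>"
  by (simp add: lift_def inst_def)

lemma inst_sub_up: "inst (sub (up \<sigma>) \<phi>) t = sub (case_nat t \<sigma>) \<phi>"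
proof -
  have "(\<lambda>n. sub_trm (case_nat t Var) (up \<sigma> n)) = case_nat t \<sigma>"
    by (rule ext) (simp add: up_def split: nat.split)
  then show ?thesis by (simp add: inst_def)
qed

lemma case_nat_Var_Suc [simp]: "case_nat (Var 0) (\<lambda>n. Var (Suc n)) = Var"
  by (rule ext) (simp split: nat.split)

lemma lift_sentences: "(\<And>\<chi>. \<chi> \<in> D \<Longrightarrow> FV \<chi> = {}) \<Longrightarrow> lift ` D = D"
  by (simp add: lift_def sub_closed)

subsection \<open>Derivations\<close>

abbreviation FDNeg :: "fm \<Rightarrow> fm" where "FDNeg \<phi> \<equiv> FNeg (FNeg \<phi>)"
abbreviation FDec :: "fm \<Rightarrow> fm" where "FDec \<phi> \<equiv> FOr \<phi> (FNeg \<phi>)"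

lemma prv_mono: "prv T \<Gamma> \<phi> \<Longrightarrow> \<Gamma> \<subseteq> \<Delta> \<Longrightarrow> prv T \<Delta> \<phi>"
proof (induction arbitrary: \<Delta> rule: prv.induct)
  case (ImpI \<phi> \<Gamma> \<psi>)
  then show ?case by (meson insert_mono prv.ImpI)
next
  case (OrE \<Gamma> \<phi> \<psi> \<chi>)
  then show ?case by (meson insert_mono prv.OrE)
next
  case (AllI \<Gamma> \<phi>)
  then show ?case by (meson image_mono prv.AllI)
next
  case (ExE \<Gamma> \<phi> \<psi>)
  then show ?case by (meson image_mono insert_mono prv.ExE)
next
  case (EqSubst \<Gamma> s t \<phi>)
  then show ?case by (metis prv.EqSubst)
qed (auto intro: prv.Ax prv.Hyp prv.BotE prv.ImpE prv.AndI prv.AndE1 prv.AndE2 prv.OrI1 prv.OrI2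
    prv.AllE prv.ExI prv.EqRefl)

lemma prv_theory_mono:
  "prv S \<Gamma> \<phi> \<Longrightarrow> (\<And>\<chi>. \<chi> \<in> S \<Longrightarrow> prv T {} \<chi>) \<Longrightarrow> prv T \<Gamma> \<phi>"
proof (induction rule: prv.induct)
  case (Ax \<phi> \<Gamma>)
  then show ?case using prv_mono by blast
next
  case (EqSubst \<Gamma> s t \<phi>)
  then show ?case by (metis prv.EqSubst)
next
  case (OrE \<Gamma> \<phi> \<psi> \<chi>)
  then show ?case by (metis prv.OrE)
next
  case (ExE \<Gamma> \<phi> \<psi>)
  then show ?case by (metis prv.ExE)
qed (auto intro: prv.Hyp prv.BotE prv.ImpI prv.ImpE prv.AndI prv.AndE1 prv.AndE2 prv.OrI1 prv.OrI2
    prv.AllI prv.AllE prv.ExI prv.EqRefl)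

lemma prv_insert [simp]: "prv T (insert \<phi> \<Gamma>) \<phi>"
  by (simp add: Hyp)

lemma prv_weaken: "prv T \<Gamma> \<psi> \<Longrightarrow> prv T (insert \<phi> \<Gamma>) \<psi>"
  by (rule prv_mono) auto

lemma prv_theorem: "prv T {} \<phi> \<Longrightarrow> prv T \<Gamma> \<phi>"
  by (rule prv_mono) auto

lemma prv_cut: "prv T \<Gamma> \<phi> \<Longrightarrow> prv T (insert \<phi> \<Gamma>) \<psi> \<Longrightarrow> prv T \<Gamma> \<psi>"
  by (rule ImpE[OF ImpI])

lemma prv_And_iff: "prv T \<Gamma> (FAnd \<phi> \<psi>) \<longleftrightarrow> prv T \<Gamma> \<phi> \<and> prv T \<Gamma> \<psi>"
  by (metis AndI AndE1 AndE2)

lemma prv_lift_AllE: "prv T \<Gamma> (lift (FAll \<phi>)) \<Longrightarrow> prv T \<Gamma> \<phi>"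
  using AllE[of T \<Gamma> "sub (up (\<lambda>n. Var (Suc n))) \<phi>" "Var 0"]
  by (simp add: lift_def inst_sub_up)

lemma prv_lift_ExI: "prv T \<Gamma> \<phi> \<Longrightarrow> prv T \<Gamma> (lift (FEx \<phi>))"
  using ExI[of T \<Gamma> "sub (up (\<lambda>n. Var (Suc n))) \<phi>" "Var 0"]
  by (simp add: lift_def inst_sub_up)

text \<open>Free variables of axioms are implicitly quantified, so theorems are closed under
  substitution for every axiom set: quantify all variables and instantiate them again.\<close>

lemma prv_sub:
  assumes "prv T {} \<phi>"
  shows "prv T {} (sub \<sigma> \<phi>)"
proof -
  have "FV \<phi> \<subseteq> {..<N} \<Longrightarrow> prv T {} \<phi> \<Longrightarrow> prv T {} (sub \<sigma> \<phi>)" for N \<phi> \<sigma>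
  proof (induction N arbitrary: \<phi> \<sigma>)
    case 0
    then show ?case by (simp add: sub_closed)
  next
    case (Suc N)
    have "FV (FAll \<phi>) \<subseteq> {..<N}" using Suc.prems(1) by auto
    moreover have "prv T {} (FAll \<phi>)" using Suc.prems(2) by (auto intro: AllI)
    ultimately have "prv T {} (sub (\<lambda>n. \<sigma> (Suc n)) (FAll \<phi>))" by (rule Suc.IH)
    then have "prv T {} (inst (sub (up (\<lambda>n. \<sigma> (Suc n))) \<phi>) (\<sigma> 0))"
      by (simp add: AllE)
    moreover have "case_nat (\<sigma> 0) (\<lambda>n. \<sigma> (Suc n)) = \<sigma>"
      by (rule ext) (simp split: nat.split)
    ultimately show ?case by (simp add: inst_sub_up)
  qed
  moreover obtain N where "FV \<phi> \<subseteq> {..<N}" by (rule FV_bounded)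
  ultimately show ?thesis using assms by blast
qed

lemma prv_FAll_iff: "prv T {} (FAll \<phi>) \<longleftrightarrow> prv T {} \<phi>"
  using prv_sub[of T "FAll \<phi>" "\<lambda>n. Var (Suc n)"] prv_lift_AllE[of T "{}" \<phi>] AllI[of T "{}" \<phi>]
  by (metis image_empty lift_def)

lemma prv_All_mono:
  assumes "prv T (insert \<phi> (lift ` \<Gamma>)) \<psi>"
  shows "prv T (insert (FAll \<phi>) \<Gamma>) (FAll \<psi>)"
proof (rule AllI)
  have "prv T (lift ` insert (FAll \<phi>) \<Gamma>) \<phi>" by (rule prv_lift_AllE) simp
  then show "prv T (lift ` insert (FAll \<phi>) \<Gamma>) \<psi>"
    by (rule prv_cut) (rule prv_mono[OF assms], auto)
qed

lemma prv_Ex_mono: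
  assumes "prv T (insert \<phi> (lift ` \<Gamma>)) \<psi>"
  shows "prv T (insert (FEx \<phi>) \<Gamma>) (FEx \<psi>)"
proof (rule ExE[of _ _ \<phi>])
  show "prv T (insert \<phi> (lift ` insert (FEx \<phi>) \<Gamma>)) (lift (FEx \<psi>))"
    by (rule prv_lift_ExI) (rule prv_mono[OF assms], auto)
qed simp

subsection \<open>Compactness\<close>

definition finitely_prv :: "fm set \<Rightarrow> fm set \<Rightarrow> fm \<Rightarrow> bool" where
  "finitely_prv T \<Gamma> \<phi> \<longleftrightarrow> (\<exists>F\<subseteq>\<Gamma>. finite F \<and> prv T F \<phi>)"

lemma finitely_prvI: "F \<subseteq> \<Gamma> \<Longrightarrow> finite F \<Longrightarrow> prv T F \<phi> \<Longrightarrow> finitely_prv T \<Gamma> \<phi>"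
  by (auto simp: finitely_prv_def)

lemma finitely_prv_rule:
  "finitely_prv T \<Gamma> \<phi> \<Longrightarrow> (\<And>\<Delta>. prv T \<Delta> \<phi> \<Longrightarrow> prv T \<Delta> \<psi>) \<Longrightarrow> finitely_prv T \<Gamma> \<psi>"
  by (auto simp: finitely_prv_def)

lemma finitely_prv_AndI:
  assumes "finitely_prv T \<Gamma> \<phi>" "finitely_prv T \<Gamma> \<psi>"
  shows "finitely_prv T \<Gamma> (FAnd \<phi> \<psi>)"
proof -
  obtain F G where FG: "F \<subseteq> \<Gamma>" "finite F" "prv T F \<phi>" "G \<subseteq> \<Gamma>" "finite G" "prv T G \<psi>"
    using assms by (auto simp: finitely_prv_def)
  show ?thesis
    by (rule finitely_prvI[of "F \<union> G"])
      (use FG prv_mono[of T F \<phi> "F \<union> G"] prv_mono[of T G \<psi> "F \<union> G"] in \<open>auto simp: prv_And_iff\<close>)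
qed

lemma finitely_prv_ImpI:
  assumes "finitely_prv T (insert \<phi> \<Gamma>) \<psi>"
  shows "finitely_prv T \<Gamma> (FImp \<phi> \<psi>)"
proof -
  obtain F where F: "F \<subseteq> insert \<phi> \<Gamma>" "finite F" "prv T F \<psi>"
    using assms by (auto simp: finitely_prv_def)
  have "prv T (F - {\<phi>}) (FImp \<phi> \<psi>)" by (rule ImpI, rule prv_mono[OF F(3)]) auto
  then show ?thesis by (rule finitely_prvI[rotated 2]) (use F(1,2) in auto)
qed

lemma finitely_prv_AllI:
  assumes "finitely_prv T (lift ` \<Gamma>) \<phi>"
  shows "finitely_prv T \<Gamma> (FAll \<phi>)"
proof -
  obtain F where F: "F \<subseteq> lift ` \<Gamma>" "finite F" "prv T F \<phi>"
    using assms by (auto simp: finitely_prv_def)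
  then obtain G where "G \<subseteq> \<Gamma>" "finite G" "F = lift ` G"
    using finite_subset_image by metis
  then show ?thesis using F(3) by (auto intro: finitely_prvI AllI)
qed

lemma finitely_prv_OrE:
  assumes "finitely_prv T \<Gamma> (FOr \<phi> \<psi>)"
    and "finitely_prv T (insert \<phi> \<Gamma>) \<chi>" "finitely_prv T (insert \<psi> \<Gamma>) \<chi>"
  shows "finitely_prv T \<Gamma> \<chi>"
proof (rule finitely_prv_rule)
  show "finitely_prv T \<Gamma> (FAnd (FOr \<phi> \<psi>) (FAnd (FImp \<phi> \<chi>) (FImp \<psi> \<chi>)))"
    by (intro finitely_prv_AndI finitely_prv_ImpI assms)
next
  fix \<Delta> assume "prv T \<Delta> (FAnd (FOr \<phi> \<psi>) (FAnd (FImp \<phi> \<chi>) (FImp \<psi> \<chi>)))"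
  then have or: "prv T \<Delta> (FOr \<phi> \<psi>)" and imp: "prv T \<Delta> (FImp \<phi> \<chi>)" "prv T \<Delta> (FImp \<psi> \<chi>)"
    by (simp_all add: prv_And_iff)
  show "prv T \<Delta> \<chi>" by (rule OrE[OF or]) (use ImpE[OF prv_weaken] imp in auto)
qed

lemma finitely_prv_ExE:
  assumes "finitely_prv T \<Gamma> (FEx \<phi>)" "finitely_prv T (insert \<phi> (lift ` \<Gamma>)) (lift \<psi>)"
  shows "finitely_prv T \<Gamma> \<psi>"
proof (rule finitely_prv_rule)
  show "finitely_prv T \<Gamma> (FAnd (FEx \<phi>) (FAll (FImp \<phi> (lift \<psi>))))"
    by (intro finitely_prv_AndI finitely_prv_AllI finitely_prv_ImpI assms)
next
  let ?A = "FAll (FImp \<phi> (lift \<psi>))"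
  fix \<Delta> assume "prv T \<Delta> (FAnd (FEx \<phi>) ?A)"
  then have ex: "prv T \<Delta> (FEx \<phi>)" and all: "prv T \<Delta> ?A" by (simp_all add: prv_And_iff)
  have "prv T (insert \<phi> (lift ` insert ?A \<Delta>)) (FImp \<phi> (lift \<psi>))"
    by (rule prv_lift_AllE) (simp add: Hyp)
  then have "prv T (insert \<phi> (lift ` insert ?A \<Delta>)) (lift \<psi>)" by (rule ImpE) simp
  with prv_weaken[OF ex] have "prv T (insert ?A \<Delta>) \<psi>" by (rule ExE)
  with all show "prv T \<Delta> \<psi>" by (rule prv_cut)
qed

theorem prv_compact: "prv T \<Gamma> \<phi> \<Longrightarrow> finitely_prv T \<Gamma> \<phi>"
proof (induction rule: prv.induct)
  case (Ax \<phi> \<Gamma>)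
  then show ?case by (intro finitely_prvI[of "{}"]) (auto intro: prv.Ax)
next
  case (Hyp \<phi> \<Gamma>)
  then show ?case by (intro finitely_prvI[of "{\<phi>}"]) auto
next
  case (EqRefl \<Gamma> t)
  show ?case by (intro finitely_prvI[of "{}"]) (auto intro: prv.EqRefl)
next
  case (ImpE \<Gamma> \<phi> \<psi>)
  from finitely_prv_AndI[OF ImpE.IH] show ?case
    by (rule finitely_prv_rule) (auto simp: prv_And_iff intro: prv.ImpE)
next
  case (OrE \<Gamma> \<phi> \<psi> \<chi>)
  from OrE.IH show ?case by (rule finitely_prv_OrE)
next
  case (AllE \<Gamma> \<phi> t)
  from AllE.IH show ?case by (rule finitely_prv_rule) (rule prv.AllE)
next
  case (ExI \<Gamma> \<phi> t)
  from ExI.IH show ?case by (rule finitely_prv_rule) (rule prv.ExI)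
next
  case (ExE \<Gamma> \<phi> \<psi>)
  from ExE.IH show ?case by (rule finitely_prv_ExE)
next
  case (EqSubst \<Gamma> s t \<phi>)
  from finitely_prv_AndI[OF EqSubst.IH] show ?case
    by (rule finitely_prv_rule) (metis prv_And_iff prv.EqSubst)
qed (simp_all add: finitely_prv_AndI finitely_prv_ImpI finitely_prv_AllI,
    (erule finitely_prv_rule, erule prv.BotE prv.AndE1 prv.AndE2 prv.OrI1 prv.OrI2)+)

lemma prv_sentences_as_hyps:
  assumes "prv (T \<union> D) \<Gamma> \<phi>" and closed: "\<And>\<chi>. \<chi> \<in> D \<Longrightarrow> FV \<chi> = {}"
  shows "prv T (\<Gamma> \<union> D) \<phi>"
  using assms(1)
proof (induction rule: prv.induct)
  case (Ax \<phi> \<Gamma>)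
  then show ?case by (auto intro: prv.Ax prv.Hyp)
next
  case (AllI \<Gamma> \<phi>)
  then show ?case using lift_sentences[OF closed] by (simp add: image_Un prv.AllI)
next
  case (ExE \<Gamma> \<phi> \<psi>)
  then show ?case using lift_sentences[OF closed] prv.ExE[of T "\<Gamma> \<union> D" \<phi> \<psi>] by (simp add: image_Un)
next
  case (EqSubst \<Gamma> s t \<phi>)
  then show ?case by (metis prv.EqSubst)
next
  case (OrE \<Gamma> \<phi> \<psi> \<chi>)
  then show ?case using prv.OrE[of T "\<Gamma> \<union> D" \<phi> \<psi> \<chi>] by simp
qed (auto intro: prv.Hyp prv.BotE prv.ImpI prv.ImpE prv.AndI prv.AndE1 prv.AndE2 prv.OrI1 prv.OrI2
    prv.AllE prv.ExI prv.EqRefl)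

subsection \<open>Deciding intuitionistic propositional logic\<close>

datatype prop_fm =
    PAt nat
  | PBot
  | PImp prop_fm prop_fm
  | PAnd prop_fm prop_fm
  | POr prop_fm prop_fm

primrec denote :: "prop_fm \<Rightarrow> fm list \<Rightarrow> fm" where
  "denote (PAt n) vs = vs ! n"
| "denote PBot vs = FBot"
| "denote (PImp p q) vs = FImp (denote p vs) (denote q vs)"
| "denote (PAnd p q) vs = FAnd (denote p vs) (denote q vs)"
| "denote (POr p q) vs = FOr (denote p vs) (denote q vs)"

text \<open>The method \<open>reify\<close> expects the environment as last argument of an interpretation.\<close>

definition prv_denote :: "fm set \<Rightarrow> fm set \<Rightarrow> prop_fm \<Rightarrow> fm list \<Rightarrow> bool" where
  "prv_denote T \<Gamma> p vs = prv T \<Gamma> (denote p vs)"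

definition prv_seq :: "fm set \<Rightarrow> fm list \<Rightarrow> prop_fm list \<Rightarrow> prop_fm \<Rightarrow> bool" where
  "prv_seq T vs ps r \<longleftrightarrow> (\<forall>\<Gamma>. (\<forall>p\<in>set ps. prv T \<Gamma> (denote p vs)) \<longrightarrow> prv T \<Gamma> (denote r vs))"

lemma prv_seqD:
  assumes "prv_seq T vs (qs @ ps) s" "\<forall>p\<in>set ps. prv T \<Gamma> (denote p vs)" "\<Gamma> \<subseteq> \<Delta>"
    and "\<forall>q\<in>set qs. prv T \<Delta> (denote q vs)"
  shows "prv T \<Delta> (denote s vs)"
proof -
  have "\<forall>p\<in>set ps. prv T \<Delta> (denote p vs)" using assms(2) prv_mono[OF _ assms(3)] by blast
  then show ?thesis using assms(1,4) by (auto simp: prv_seq_def)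
qed

lemma prv_Imp_mono: "prv T \<Gamma> (FImp \<phi> \<chi>) \<Longrightarrow> prv T (insert \<psi> \<Gamma>) \<phi> \<Longrightarrow> prv T \<Gamma> (FImp \<psi> \<chi>)"
  by (rule ImpI, rule ImpE[OF prv_weaken])

lemma prv_Imp_AndD: "prv T \<Gamma> (FImp (FAnd \<phi> \<psi>) \<chi>) \<Longrightarrow> prv T \<Gamma> (FImp \<phi> (FImp \<psi> \<chi>))"
  by (rule ImpI, rule ImpI, rule ImpE[OF prv_weaken[OF prv_weaken]])
    (auto simp: prv_And_iff intro: Hyp)

lemma prv_Imp_OrD:
  assumes "prv T \<Gamma> (FImp (FOr \<phi> \<psi>) \<chi>)"
  shows "prv T \<Gamma> (FImp \<phi> \<chi>)" "prv T \<Gamma> (FImp \<psi> \<chi>)"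
  by (rule prv_Imp_mono[OF assms], simp add: OrI1 OrI2)+

lemma prv_Imp_ImpD: "prv T \<Gamma> (FImp (FImp \<phi> \<psi>) \<chi>) \<Longrightarrow> prv T \<Gamma> (FImp \<psi> \<chi>)"
  by (erule prv_Imp_mono) (simp add: ImpI Hyp)

text \<open>The left rules of Dyckhoff's contraction-free calculus: \<open>left_rule ps r p\<close> lists the premises
  of the rule that decomposes the assumption \<open>p\<close> of the sequent \<open>p # ps \<turnstile> r\<close>, where a pair \<open>(qs, s)\<close>
  stands for the premise \<open>qs @ ps \<turnstile> s\<close>.\<close>

fun left_rule :: "prop_fm list \<Rightarrow> prop_fm \<Rightarrow> prop_fm \<Rightarrow> (prop_fm list \<times> prop_fm) list option" where
  "left_rule ps r PBot = Some []"
| "left_rule ps r (PAnd a b) = Some [([a, b], r)]"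
| "left_rule ps r (POr a b) = Some [([a], r), ([b], r)]"
| "left_rule ps r (PImp (PAt i) c) = (if PAt i \<in> set ps then Some [([c], r)] else None)"
| "left_rule ps r (PImp (PAnd a b) c) = Some [([PImp a (PImp b c)], r)]"
| "left_rule ps r (PImp (POr a b) c) = Some [([PImp a c, PImp b c], r)]"
| "left_rule ps r (PImp (PImp a b) c) = Some [([a, PImp b c], b), ([c], r)]"
| "left_rule ps r _ = None"

lemma left_rule_PImp_sound:
  assumes js: "left_rule ps r (PImp a c) = Some js" and ps: "\<forall>q\<in>set ps. prv T \<Gamma> (denote q vs)"
    and imp: "prv T \<Gamma> (FImp (denote a vs) (denote c vs))"
    and premise: "\<And>qs s \<Delta>. (qs, s) \<in> set js \<Longrightarrow> \<Gamma> \<subseteq> \<Delta> \<Longrightarrow> \<forall>q\<in>set qs. prv T \<Delta> (denote q vs) \<Longrightarrow>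
      prv T \<Delta> (denote s vs)"
  shows "prv T \<Gamma> (denote r vs)"
proof (cases a)
  case (PAt i)
  then have "a \<in> set ps" using js by (auto split: if_split_asm)
  then have "prv T \<Gamma> (denote c vs)" using ps ImpE[OF imp] by blast
  then show ?thesis using js PAt by (intro premise[of "[c]"]) (auto split: if_split_asm)
next
  case PBot
  then show ?thesis using js by simp
next
  case (PAnd a' b)
  then have "prv T \<Gamma> (denote (PImp a' (PImp b c)) vs)" using imp prv_Imp_AndD by simp
  then show ?thesis using js PAnd by (intro premise[of "[PImp a' (PImp b c)]"]) auto
next
  case (POr a' b)
  then have "prv T \<Gamma> (denote (PImp a' c) vs)" "prv T \<Gamma> (denote (PImp b c) vs)"
    using imp prv_Imp_OrD[of T \<Gamma> "denote a' vs" "denote b vs" "denote c vs"] by simp_all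
  then show ?thesis using js POr by (intro premise[of "[PImp a' c, PImp b c]"]) auto
next
  case (PImp a' b)
  then have "prv T (insert (denote a' vs) \<Gamma>) (denote (PImp b c) vs)"
    using imp prv_weaken[OF prv_Imp_ImpD] by simp
  then have "prv T (insert (denote a' vs) \<Gamma>) (denote b vs)"
    using js PImp by (intro premise[of "[a', PImp b c]"]) auto
  then have "prv T \<Gamma> (denote a vs)" using PImp by (simp add: ImpI)
  then have "prv T \<Gamma> (denote c vs)" by (rule ImpE[OF imp])
  then show ?thesis using js PImp by (intro premise[of "[c]"]) auto
qed

lemma left_rule_sound:
  assumes js: "left_rule ps r p = Some js"
    and prems: "\<forall>(qs, s)\<in>set js. prv_seq T vs (qs @ ps) s"
  shows "prv_seq T vs (p # ps) r"
proof -
  have "prv T \<Gamma> (denote r vs)" if hyps: "\<forall>q\<in>set (p # ps). prv T \<Gamma> (denote q vs)" for \<Gamma>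
  proof -
    have p: "prv T \<Gamma> (denote p vs)" using hyps by simp
    have premise: "prv T \<Delta> (denote s vs)"
      if "(qs, s) \<in> set js" "\<Gamma> \<subseteq> \<Delta>" "\<forall>q\<in>set qs. prv T \<Delta> (denote q vs)" for qs s \<Delta>
      by (rule prv_seqD[of T vs qs ps s \<Gamma>]) (use prems hyps that in auto)
    show ?thesis
    proof (cases p)
      case (PAt i)
      then show ?thesis using js by simp
    next
      case PBot
      then show ?thesis using p BotE by simp
    next
      case (PImp a c)
      show ?thesis
        by (rule left_rule_PImp_sound[OF js[unfolded PImp]]) (use hyps PImp premise in auto)
    next
      case (PAnd a b)
      then show ?thesis
        using js p by (intro premise[of "[a, b]"]) (auto simp: prv_And_iff)
    next
      case (POr a b)
      then have "prv T (insert (denote q vs) \<Gamma>) (denote r vs)" if "q = a \<or> q = b" for q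
        using that js by (intro premise[of "[q]"]) auto
      then show ?thesis using p POr OrE[of T \<Gamma> "denote a vs" "denote b vs"] by simp
    qed
  qed
  then show ?thesis by (simp add: prv_seq_def)
qed

primrec ipc :: "nat \<Rightarrow> prop_fm list \<Rightarrow> prop_fm \<Rightarrow> bool" where
  "ipc 0 ps r = False"
| "ipc (Suc n) ps r =
    (case r of
      PImp a b \<Rightarrow> ipc n (a # ps) b
    | PAnd a b \<Rightarrow> ipc n ps a \<and> ipc n ps b
    | _ \<Rightarrow> r \<in> set ps \<or>
         list_ex (\<lambda>p. case left_rule (remove1 p ps) r p of None \<Rightarrow> False
              | Some js \<Rightarrow> list_all (\<lambda>(qs, s). ipc n (qs @ remove1 p ps) s) js) ps \<or>
         (case r of POr a b \<Rightarrow> ipc n ps a \<or> ipc n ps b | _ \<Rightarrow> False))"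

lemma ipc_sound: "ipc n ps r \<Longrightarrow> prv_seq T vs ps r"
proof (induction n arbitrary: ps r)
  case (Suc n)
  consider (Imp) a b where "r = PImp a b" "ipc n (a # ps) b"
    | (And) a b where "r = PAnd a b" "ipc n ps a" "ipc n ps b"
    | (Or) a b where "r = POr a b" "ipc n ps a \<or> ipc n ps b"
    | (assumption) "r \<in> set ps"
    | (left) p js where "p \<in> set ps" "left_rule (remove1 p ps) r p = Some js"
        "\<forall>(qs, s)\<in>set js. ipc n (qs @ remove1 p ps) s"
    using Suc.prems by (cases r) (auto simp: list_ex_iff list_all_iff split: option.split_asm)
  then show ?case
  proof cases
    case (Imp a b)
    have "prv T \<Gamma> (FImp (denote a vs) (denote b vs))" if "\<forall>p\<in>set ps. prv T \<Gamma> (denote p vs)" for \<Gamma>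
      using Suc.IH[OF Imp(2)] that prv_weaken by (intro ImpI) (simp add: prv_seq_def)
    then show ?thesis using Imp(1) by (simp add: prv_seq_def)
  next
    case (And a b)
    then show ?thesis using Suc.IH by (simp add: prv_seq_def prv_And_iff)
  next
    case (Or a b)
    then show ?thesis using Suc.IH by (auto simp: prv_seq_def intro: OrI1 OrI2)
  next
    case assumption
    then show ?thesis by (simp add: prv_seq_def)
  next
    case (left p js)
    have "set (p # remove1 p ps) = set ps"
      using left(1) set_remove1_subset[of p ps] by auto (metis in_set_remove1)
    moreover have "prv_seq T vs (p # remove1 p ps) r"
      using left_rule_sound[OF left(2)] left(3) Suc.IH by blast
    ultimately show ?thesis unfolding prv_seq_def by metis
  qed
qed simp

text \<open>Depth 30 suffices for every formula to which this lemma is applied.\<close>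

lemma ipc_prv: "ipc 30 [] p \<Longrightarrow> prv_denote T \<Gamma> p vs"
  using ipc_sound[of 30 "[]" p T vs] by (simp add: prv_seq_def prv_denote_def)

lemmas prv_reify = denote.simps prv_denote_def

lemma prv_mp: "prv T \<Gamma> \<phi> \<Longrightarrow> prv T \<Gamma> (FImp \<phi> \<chi>) \<Longrightarrow> prv T \<Gamma> \<chi>"
  by (rule ImpE)

lemma prv_mp2: "prv T \<Gamma> \<phi> \<Longrightarrow> prv T \<Gamma> \<psi> \<Longrightarrow> prv T \<Gamma> (FImp \<phi> (FImp \<psi> \<chi>)) \<Longrightarrow> prv T \<Gamma> \<chi>"
  by (rule ImpE[OF ImpE])

lemma prv_mp3:
  "prv T \<Gamma> \<phi> \<Longrightarrow> prv T \<Gamma> \<psi> \<Longrightarrow> prv T \<Gamma> \<chi> \<Longrightarrow> prv T \<Gamma> (FImp \<phi> (FImp \<psi> (FImp \<chi> \<theta>))) \<Longrightarrow> prv T \<Gamma> \<theta>"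
  by (rule ImpE[OF ImpE[OF ImpE]])

subsection \<open>Provable equivalence\<close>

definition eqv :: "fm set \<Rightarrow> fm \<Rightarrow> fm \<Rightarrow> bool" where
  "eqv T \<phi> \<psi> \<longleftrightarrow> prv T {} (FIff \<phi> \<psi>)"

lemma eqvI: "prv T {\<phi>} \<psi> \<Longrightarrow> prv T {\<psi>} \<phi> \<Longrightarrow> eqv T \<phi> \<psi>"
  by (simp add: eqv_def AndI ImpI)

lemma eqvD1: "eqv T \<phi> \<psi> \<Longrightarrow> prv T \<Gamma> \<phi> \<Longrightarrow> prv T \<Gamma> \<psi>"
  unfolding eqv_def by (meson AndE1 ImpE prv_theorem)

lemma eqvD2: "eqv T \<phi> \<psi> \<Longrightarrow> prv T \<Gamma> \<psi> \<Longrightarrow> prv T \<Gamma> \<phi>"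
  unfolding eqv_def by (meson AndE2 ImpE prv_theorem)

lemma eqv_refl [simp]: "eqv T \<phi> \<phi>"
  by (simp add: eqvI)

lemma eqv_sym: "eqv T \<phi> \<psi> \<Longrightarrow> eqv T \<psi> \<phi>"
  using eqvD1 eqvD2 by (meson eqvI prv_insert)

lemma eqv_trans [trans]: "eqv T \<phi> \<psi> \<Longrightarrow> eqv T \<psi> \<chi> \<Longrightarrow> eqv T \<phi> \<chi>"
  using eqvD1 eqvD2 by (meson eqvI prv_insert)

lemma eqv_theory_mono: "eqv S \<phi> \<psi> \<Longrightarrow> (\<And>\<chi>. \<chi> \<in> S \<Longrightarrow> prv T {} \<chi>) \<Longrightarrow> eqv T \<phi> \<psi>"
  unfolding eqv_def by (rule prv_theory_mono)

lemma eqv_Imp: "eqv T \<phi> \<phi>' \<Longrightarrow> eqv T \<psi> \<psi>' \<Longrightarrow> eqv T (FImp \<phi> \<psi>) (FImp \<phi>' \<psi>')"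
  unfolding eqv_def by (erule (1) prv_mp2) (reify prv_reify, rule ipc_prv, code_simp)

lemma eqv_And: "eqv T \<phi> \<phi>' \<Longrightarrow> eqv T \<psi> \<psi>' \<Longrightarrow> eqv T (FAnd \<phi> \<psi>) (FAnd \<phi>' \<psi>')"
  unfolding eqv_def by (erule (1) prv_mp2) (reify prv_reify, rule ipc_prv, code_simp)

lemma eqv_Or: "eqv T \<phi> \<phi>' \<Longrightarrow> eqv T \<psi> \<psi>' \<Longrightarrow> eqv T (FOr \<phi> \<psi>) (FOr \<phi>' \<psi>')"
  unfolding eqv_def by (erule (1) prv_mp2) (reify prv_reify, rule ipc_prv, code_simp)

lemma eqv_Neg: "eqv T \<phi> \<psi> \<Longrightarrow> eqv T (FNeg \<phi>) (FNeg \<psi>)"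
  by (simp add: eqv_Imp)

lemma eqv_DNeg: "eqv T \<phi> \<psi> \<Longrightarrow> eqv T (FDNeg \<phi>) (FDNeg \<psi>)"
  by (intro eqv_Neg)

lemma eqv_All: "eqv T \<phi> \<psi> \<Longrightarrow> eqv T (FAll \<phi>) (FAll \<psi>)"
  by (rule eqvI; rule prv_All_mono; auto intro: eqvD1 eqvD2)

lemma eqv_Ex: "eqv T \<phi> \<psi> \<Longrightarrow> eqv T (FEx \<phi>) (FEx \<psi>)"
  by (rule eqvI; rule prv_Ex_mono; auto intro: eqvD1 eqvD2)

lemma eqv_And_commute: "eqv T (FAnd \<phi> \<psi>) (FAnd \<psi> \<phi>)"
  unfolding eqv_def by (reify prv_reify) (rule ipc_prv, code_simp)

lemma eqv_DNeg_Neg: "eqv T (FDNeg (FNeg \<phi>)) (FNeg \<phi>)"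
  unfolding eqv_def by (reify prv_reify) (rule ipc_prv, code_simp)

lemma eqv_Or_Bot: "eqv T (FOr \<phi> FBot) \<phi>"
  unfolding eqv_def by (reify prv_reify) (rule ipc_prv, code_simp)

lemma eqv_DNeg_Imp:
  "eqv T (FDNeg (FImp \<phi> \<psi>)) (FImp (FDNeg \<phi>) (FDNeg \<psi>))"
  unfolding eqv_def by (reify prv_reify) (rule ipc_prv, code_simp)

lemma eqv_DNeg_And:
  "eqv T (FDNeg (FAnd \<phi> \<psi>)) (FAnd (FDNeg \<phi>) (FDNeg \<psi>))"
  unfolding eqv_def by (reify prv_reify) (rule ipc_prv, code_simp)

lemma prv_DNegI: "prv T \<Gamma> \<phi> \<Longrightarrow> prv T \<Gamma> (FDNeg \<phi>)"
  by (erule prv_mp) (reify prv_reify, rule ipc_prv, code_simp)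

lemma prv_DNE_if_dec: "prv T \<Gamma> (FDec \<phi>) \<Longrightarrow> prv T \<Gamma> (FImp (FDNeg \<phi>) \<phi>)"
  by (erule prv_mp) (reify prv_reify, rule ipc_prv, code_simp)

lemma eqv_DNeg_if_DNE: "prv T {} (FImp (FDNeg \<phi>) \<phi>) \<Longrightarrow> eqv T (FDNeg \<phi>) \<phi>"
  unfolding eqv_def by (erule prv_mp) (reify prv_reify, rule ipc_prv, code_simp)

lemma eqv_Or_Imp_if_dec:
  "prv T {} (FDec \<phi>) \<Longrightarrow> eqv T (FOr \<phi> \<psi>) (FImp (FNeg \<phi>) \<psi>)"
  unfolding eqv_def by (erule prv_mp) (reify prv_reify, rule ipc_prv, code_simp)

lemma eqv_Neg_Ex: "eqv T (FNeg (FEx \<phi>)) (FAll (FNeg \<phi>))"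
proof (rule eqvI)
  let ?\<Gamma> = "insert \<phi> (lift ` {FNeg (FEx \<phi>)})"
  have "prv T ?\<Gamma> (FNeg (lift (FEx \<phi>)))" by (simp add: Hyp)
  moreover have "prv T ?\<Gamma> (lift (FEx \<phi>))" by (rule prv_lift_ExI) simp
  ultimately show "prv T {FNeg (FEx \<phi>)} (FAll (FNeg \<phi>))" by (intro AllI ImpI) (rule ImpE)
next
  let ?\<Gamma> = "{FEx \<phi>, FAll (FNeg \<phi>)}"
  have "prv T (insert \<phi> (lift ` ?\<Gamma>)) (FNeg \<phi>)" by (rule prv_lift_AllE) (simp add: Hyp)
  moreover have "prv T (insert \<phi> (lift ` ?\<Gamma>)) \<phi>" by simp
  ultimately have "prv T (insert \<phi> (lift ` ?\<Gamma>)) (lift FBot)" using ImpE[of T _ \<phi> FBot] by simp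
  then have "prv T ?\<Gamma> FBot" by (rule ExE[OF Hyp, rotated]) simp
  then show "prv T {FAll (FNeg \<phi>)} (FNeg (FEx \<phi>))" by (rule ImpI)
qed

lemma eqv_DNeg_Ex: "eqv T (FDNeg (FEx \<phi>)) (FDNeg (FEx (FDNeg \<phi>)))"
proof (rule eqv_Neg)
  have "eqv T (FNeg (FEx \<phi>)) (FAll (FNeg \<phi>))" by (rule eqv_Neg_Ex)
  also have "eqv T (FAll (FNeg \<phi>)) (FAll (FDNeg (FNeg \<phi>)))"
    by (rule eqv_All[OF eqv_sym[OF eqv_DNeg_Neg]])
  also have "eqv T (FAll (FDNeg (FNeg \<phi>))) (FNeg (FEx (FDNeg \<phi>)))"
    by (rule eqv_sym[OF eqv_Neg_Ex])
  finally show "eqv T (FNeg (FEx \<phi>)) (FNeg (FEx (FDNeg \<phi>)))" .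
qed

lemma eqv_All_And: "eqv T (FAll (FAnd \<phi> (lift \<psi>))) (FAnd (FAll \<phi>) \<psi>)"
proof (rule eqvI)
  let ?\<Gamma> = "{FAll (FAnd \<phi> (lift \<psi>))}"
  have "prv T ?\<Gamma> (inst (FAnd \<phi> (lift \<psi>)) zero)" by (rule AllE) simp
  then have "prv T ?\<Gamma> \<psi>" by (simp add: prv_And_iff)
  moreover have "prv T ?\<Gamma> (FAll \<phi>)"
    by (rule prv_All_mono, rule AndE1[of _ _ _ "lift \<psi>"]) simp
  ultimately show "prv T ?\<Gamma> (FAnd (FAll \<phi>) \<psi>)" by (simp add: prv_And_iff)
next
  let ?\<Gamma> = "lift ` {FAnd (FAll \<phi>) \<psi>}"
  have "prv T ?\<Gamma> (FAnd (lift (FAll \<phi>)) (lift \<psi>))" by simp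
  then have "prv T ?\<Gamma> (FAnd \<phi> (lift \<psi>))"
    using prv_lift_AllE[of T ?\<Gamma> \<phi>] by (simp add: prv_And_iff)
  then show "prv T {FAnd (FAll \<phi>) \<psi>} (FAll (FAnd \<phi> (lift \<psi>)))" by (rule AllI)
qed

lemma eqv_Ex_And: "eqv T (FEx (FAnd \<phi> (lift \<psi>))) (FAnd (FEx \<phi>) \<psi>)"
proof (rule eqvI)
  let ?\<Gamma> = "insert (FAnd \<phi> (lift \<psi>)) (lift ` {FEx (FAnd \<phi> (lift \<psi>))})"
  have "prv T ?\<Gamma> (FAnd \<phi> (lift \<psi>))" by simp
  then have "prv T ?\<Gamma> (lift (FAnd (FEx \<phi>) \<psi>))"
    using prv_lift_ExI[of T ?\<Gamma> \<phi>] by (simp add: prv_And_iff)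
  then show "prv T {FEx (FAnd \<phi> (lift \<psi>))} (FAnd (FEx \<phi>) \<psi>)"
    by (rule ExE[OF Hyp, rotated]) simp
next
  let ?\<Gamma> = "insert \<phi> (lift ` {FAnd (FEx \<phi>) \<psi>})"
  have "prv T ?\<Gamma> (FAnd (lift (FEx \<phi>)) (lift \<psi>))" by (simp add: Hyp)
  then have "prv T ?\<Gamma> (FAnd \<phi> (lift \<psi>))" by (simp add: prv_And_iff)
  then have "prv T ?\<Gamma> (lift (FEx (FAnd \<phi> (lift \<psi>))))" by (rule prv_lift_ExI)
  moreover have "prv T {FAnd (FEx \<phi>) \<psi>} (FEx \<phi>)" by (rule AndE1[of _ _ _ \<psi>]) simp
  ultimately show "prv T {FAnd (FEx \<phi>) \<psi>} (FEx (FAnd \<phi> (lift \<psi>)))" by (rule ExE[rotated])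
qed

lemma eqv_Ex_Or: "eqv T (FEx (FOr \<phi> (lift \<psi>))) (FOr (FEx \<phi>) \<psi>)"
proof (rule eqvI)
  let ?\<Gamma> = "insert (FOr \<phi> (lift \<psi>)) (lift ` {FEx (FOr \<phi> (lift \<psi>))})"
  have "prv T ?\<Gamma> (lift (FOr (FEx \<phi>) \<psi>))" unfolding lift_simps
  proof (rule OrE)
    show "prv T (insert \<phi> ?\<Gamma>) (FOr (lift (FEx \<phi>)) (lift \<psi>))"
      by (rule OrI1, rule prv_lift_ExI) simp
    show "prv T (insert (lift \<psi>) ?\<Gamma>) (FOr (lift (FEx \<phi>)) (lift \<psi>))"
      by (rule OrI2) simp
  qed simp
  then show "prv T {FEx (FOr \<phi> (lift \<psi>))} (FOr (FEx \<phi>) \<psi>)"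
    by (rule ExE[OF Hyp, rotated]) simp
next
  show "prv T {FOr (FEx \<phi>) \<psi>} (FEx (FOr \<phi> (lift \<psi>)))"
  proof (rule OrE)
    show "prv T {FEx \<phi>, FOr (FEx \<phi>) \<psi>} (FEx (FOr \<phi> (lift \<psi>)))"
      by (rule prv_Ex_mono, rule OrI1) simp
    show "prv T {\<psi>, FOr (FEx \<phi>) \<psi>} (FEx (FOr \<phi> (lift \<psi>)))"
      by (rule ExI[of _ _ _ zero]) (simp add: OrI2)
  qed simp
qed

lemma eqv_All_Or:
  assumes "prv T {} (FOr (FAll \<phi>) (FEx (FNeg \<phi>)))"
  shows "eqv T (FAll (FOr \<phi> (lift \<psi>))) (FOr (FAll \<phi>) \<psi>)"
proof (rule eqvI)
  let ?D = "FAll (FOr \<phi> (lift \<psi>))"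
  show "prv T {?D} (FOr (FAll \<phi>) \<psi>)"
  proof (rule OrE[OF prv_theorem[OF assms]])
    show "prv T {FAll \<phi>, ?D} (FOr (FAll \<phi>) \<psi>)" by (rule OrI1) simp
    let ?\<Gamma> = "insert (FNeg \<phi>) (lift ` {FEx (FNeg \<phi>), ?D})"
    have "prv T ?\<Gamma> (FOr \<phi> (lift \<psi>))" by (rule prv_lift_AllE) (simp add: Hyp)
    moreover have "prv T ?\<Gamma> (FNeg \<phi>)" by simp
    ultimately have "prv T ?\<Gamma> (lift \<psi>)"
      by (rule prv_mp2) (reify prv_reify, rule ipc_prv, code_simp)
    then have "prv T {FEx (FNeg \<phi>), ?D} \<psi>" by (rule ExE[OF Hyp, rotated]) simp
    then show "prv T {FEx (FNeg \<phi>), ?D} (FOr (FAll \<phi>) \<psi>)" by (rule OrI2)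
  qed
next
  show "prv T {FOr (FAll \<phi>) \<psi>} (FAll (FOr \<phi> (lift \<psi>)))"
  proof (rule OrE)
    show "prv T {FAll \<phi>, FOr (FAll \<phi>) \<psi>} (FAll (FOr \<phi> (lift \<psi>)))"
      by (rule prv_All_mono, rule OrI1) simp
    show "prv T {\<psi>, FOr (FAll \<phi>) \<psi>} (FAll (FOr \<phi> (lift \<psi>)))"
      by (rule AllI, rule OrI2) simp
  qed simp
qed

lemma prv_nneg_hyps:
  assumes "finite F" "prv T F (FDNeg \<phi>)" "\<And>\<chi>. \<chi> \<in> F \<Longrightarrow> prv T {} (FDNeg \<chi>)"
  shows "prv T {} (FDNeg \<phi>)"
  using assms
proof (induction F rule: finite_induct)
  case (insert \<chi> F)
  have "prv T F (FDNeg \<chi>)" by (rule prv_theorem[OF insert.prems(2)]) simp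
  moreover have "prv T F (FImp \<chi> (FDNeg \<phi>))" by (rule ImpI) (rule insert.prems(1))
  ultimately have "prv T F (FDNeg \<phi>)"
    by (rule prv_mp2) (reify prv_reify, rule ipc_prv, code_simp)
  then show ?case using insert by blast
qed

theorem prv_nneg_sentences:
  assumes "prv (T \<union> D) {} \<phi>"
    and "\<And>\<chi>. \<chi> \<in> D \<Longrightarrow> FV \<chi> = {}" "\<And>\<chi>. \<chi> \<in> D \<Longrightarrow> prv T {} (FDNeg \<chi>)"
  shows "prv T {} (FDNeg \<phi>)"
proof -
  have "prv T D \<phi>" using prv_sentences_as_hyps[OF assms(1,2)] by simp
  then obtain F where F: "F \<subseteq> D" "finite F" "prv T F \<phi>"
    using prv_compact[of T D \<phi>] by (auto simp: finitely_prv_def)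
  show ?thesis by (rule prv_nneg_hyps[OF F(2) prv_DNegI[OF F(3)]]) (use F(1) assms(3) in blast)
qed

subsection \<open>Negative translation with a parameter\<close>

abbreviation dneg :: "fm \<Rightarrow> fm \<Rightarrow> fm" where "dneg A \<phi> \<equiv> FImp (FImp \<phi> A) A"

text \<open>For \<open>A = \<bottom>\<close> this is the Goedel--Gentzen translation; for other \<open>A\<close> it also performs
  Friedman's A-translation.\<close>

primrec neg_tr :: "fm \<Rightarrow> fm \<Rightarrow> fm" where
  "neg_tr (FEq s t) A = dneg A (FEq s t)"
| "neg_tr FBot A = A"
| "neg_tr (FImp \<phi> \<psi>) A = FImp (neg_tr \<phi> A) (neg_tr \<psi> A)"
| "neg_tr (FAnd \<phi> \<psi>) A = FAnd (neg_tr \<phi> A) (neg_tr \<psi> A)"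
| "neg_tr (FOr \<phi> \<psi>) A = dneg A (FOr (neg_tr \<phi> A) (neg_tr \<psi> A))"
| "neg_tr (FAll \<phi>) A = FAll (neg_tr \<phi> (lift A))"
| "neg_tr (FEx \<phi>) A = dneg A (FEx (neg_tr \<phi> (lift A)))"

lemma sub_neg_tr: "sub \<sigma> (neg_tr \<phi> A) = neg_tr (sub \<sigma> \<phi>) (sub \<sigma> A)"
  by (induction \<phi> arbitrary: \<sigma> A) (simp_all add: sub_lift)

lemma lift_neg_tr: "lift (neg_tr \<phi> A) = neg_tr (lift \<phi>) (lift A)"
  by (simp only: lift_def sub_neg_tr)

lemma neg_tr_inst: "neg_tr (inst \<phi> t) A = inst (neg_tr \<phi> (lift A)) t"
  using inst_lift[of A t] by (simp add: inst_def sub_neg_tr)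

lemma dnegI: "prv T \<Gamma> \<phi> \<Longrightarrow> prv T \<Gamma> (dneg A \<phi>)"
  by (erule prv_mp) (reify prv_reify, rule ipc_prv, code_simp)

lemma dneg_dneg_dneg: "prv T \<Gamma> (FImp (dneg A (dneg A \<phi>)) (dneg A \<phi>))"
  by (reify prv_reify) (rule ipc_prv, code_simp)

lemma eqv_dneg: "eqv T \<phi> \<psi> \<Longrightarrow> eqv T (dneg A \<phi>) (dneg A \<psi>)"
  by (intro eqv_Imp eqv_refl)

lemma neg_tr_stable: "prv T \<Gamma> (FImp (dneg A (neg_tr \<phi> A)) (neg_tr \<phi> A))"
proof (induction \<phi> arbitrary: \<Gamma> A)
  case FBot
  show ?case unfolding neg_tr.simps by (reify prv_reify) (rule ipc_prv, code_simp)
next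
  case (FImp \<phi> \<psi>)
  show ?case unfolding neg_tr.simps
    by (rule prv_mp[OF FImp.IH(2)[of \<Gamma> A]]) (reify prv_reify, rule ipc_prv, code_simp)
next
  case (FAnd \<phi> \<psi>)
  show ?case unfolding neg_tr.simps
    by (rule prv_mp2[OF FAnd.IH(1)[of \<Gamma> A] FAnd.IH(2)[of \<Gamma> A]])
      (reify prv_reify, rule ipc_prv, code_simp)
next
  case (FAll \<phi>)
  let ?\<Gamma> = "lift ` insert (dneg A (neg_tr (FAll \<phi>) A)) \<Gamma>"
  have "prv T ?\<Gamma> (FImp (lift (neg_tr (FAll \<phi>) A)) (neg_tr \<phi> (lift A)))"
    by (rule ImpI, rule prv_lift_AllE) simp
  moreover have "prv T ?\<Gamma> (dneg (lift A) (lift (neg_tr (FAll \<phi>) A)))" by (simp add: Hyp)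
  ultimately have "prv T ?\<Gamma> (neg_tr \<phi> (lift A))"
    by (rule prv_mp3[OF _ _ FAll.IH[of ?\<Gamma> "lift A"]]) (reify prv_reify, rule ipc_prv, code_simp)
  then show ?case unfolding neg_tr.simps by (intro ImpI AllI)
qed (simp_all only: neg_tr.simps dneg_dneg_dneg)

lemma eqv_dneg_Or_if_dec:
  assumes "prv T {} (FDec \<phi>)"
  shows "eqv T (dneg A (FOr \<phi> A)) (FOr \<phi> A)"
  unfolding eqv_def by (rule prv_mp[OF assms], reify prv_reify) (rule ipc_prv, code_simp)

lemma dnegE_neg_tr:
  assumes "prv T \<Gamma> (dneg A \<psi>)" "prv T (insert \<psi> \<Gamma>) (neg_tr \<phi> A)"
  shows "prv T \<Gamma> (neg_tr \<phi> A)"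
  by (rule prv_mp3[OF assms(1) ImpI[OF assms(2)] neg_tr_stable[of T \<Gamma> \<phi> A]])
    (reify prv_reify, rule ipc_prv, code_simp)

lemma neg_tr_BotE: "prv T \<Gamma> A \<Longrightarrow> prv T \<Gamma> (neg_tr \<phi> A)"
  using ImpE[OF neg_tr_stable ImpI[OF prv_weaken]] .

lemma neg_tr_OrE:
  assumes "prv T \<Gamma> (neg_tr (FOr \<phi> \<psi>) A)"
    and "prv T (insert (neg_tr \<phi> A) \<Gamma>) (neg_tr \<chi> A)" "prv T (insert (neg_tr \<psi> A) \<Gamma>) (neg_tr \<chi> A)"
  shows "prv T \<Gamma> (neg_tr \<chi> A)"
proof (rule dnegE_neg_tr)
  show "prv T \<Gamma> (dneg A (FOr (neg_tr \<phi> A) (neg_tr \<psi> A)))" using assms(1) by simp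
  let ?\<Gamma> = "insert (FOr (neg_tr \<phi> A) (neg_tr \<psi> A)) \<Gamma>"
  show "prv T ?\<Gamma> (neg_tr \<chi> A)"
    by (rule OrE[of _ _ "neg_tr \<phi> A" "neg_tr \<psi> A"])
      (auto intro: prv_mono[OF assms(2)] prv_mono[OF assms(3)])
qed

lemma neg_tr_ExI: "prv T \<Gamma> (neg_tr (inst \<phi> t) A) \<Longrightarrow> prv T \<Gamma> (neg_tr (FEx \<phi>) A)"
  using ExI[of T \<Gamma> "neg_tr \<phi> (lift A)" t] by (simp add: neg_tr_inst dnegI)

lemma neg_tr_ExE:
  assumes "prv T \<Gamma> (neg_tr (FEx \<phi>) A)"
    and "prv T (insert (neg_tr \<phi> (lift A)) (lift ` \<Gamma>)) (neg_tr (lift \<psi>) (lift A))"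
  shows "prv T \<Gamma> (neg_tr \<psi> A)"
proof (rule dnegE_neg_tr)
  show "prv T \<Gamma> (dneg A (FEx (neg_tr \<phi> (lift A))))" using assms(1) by simp
  show "prv T (insert (FEx (neg_tr \<phi> (lift A))) \<Gamma>) (neg_tr \<psi> A)"
    by (rule ExE[OF prv_insert]) (auto simp: lift_neg_tr intro: prv_mono[OF assms(2)])
qed

lemma neg_tr_EqSubst:
  assumes "prv T \<Gamma> (neg_tr (FEq s t) A)" "prv T \<Gamma> (neg_tr (inst \<phi> s) A)"
  shows "prv T \<Gamma> (neg_tr (inst \<phi> t) A)"
proof (rule dnegE_neg_tr)
  show "prv T \<Gamma> (dneg A (FEq s t))" using assms(1) by simp
  show "prv T (insert (FEq s t) \<Gamma>) (neg_tr (inst \<phi> t) A)"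
    using EqSubst[OF prv_insert prv_weaken[OF assms(2)[unfolded neg_tr_inst]]]
    by (simp add: neg_tr_inst)
qed

lemma neg_tr_dneg_Ex:
  assumes "prv T {} (FImp (neg_tr \<phi> (lift A)) (dneg (lift A) \<phi>))"
  shows "prv T {} (FImp (neg_tr (FEx \<phi>) A) (dneg A (FEx \<phi>)))"
proof -
  let ?\<psi> = "neg_tr \<phi> (lift A)"
  let ?\<Gamma> = "insert ?\<psi> (lift ` {FEx ?\<psi>, FImp (FEx \<phi>) A})"
  have "prv T ?\<Gamma> (FImp \<phi> (lift A))"
  proof (rule ImpI, rule ImpE)
    show "prv T (insert \<phi> ?\<Gamma>) (FImp (lift (FEx \<phi>)) (lift A))" by (simp add: Hyp)
    show "prv T (insert \<phi> ?\<Gamma>) (lift (FEx \<phi>))" by (rule prv_lift_ExI) simp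
  qed
  with prv_theorem[OF assms] prv_insert have "prv T ?\<Gamma> (lift A)"
    by (rule prv_mp3) (reify prv_reify, rule ipc_prv, code_simp)
  then have "prv T {FEx ?\<psi>, FImp (FEx \<phi>) A} A" by (rule ExE[OF Hyp, rotated]) simp
  then have "prv T {} (FImp (FImp (FEx \<phi>) A) (FImp (FEx ?\<psi>) A))" by (intro ImpI)
  then have "prv T {} (FImp (dneg A (FEx ?\<psi>)) (dneg A (FEx \<phi>)))"
    by (rule prv_mp) (reify prv_reify, rule ipc_prv, code_simp)
  then show ?thesis by simp
qed

lemma neg_tr_HA:
  assumes "\<chi> \<in> HA"
  shows "prv HA {} (neg_tr \<chi> A)"
  using assms
proof cases
  case (Suc_neq_zero t)
  show ?thesis unfolding Suc_neq_zero neg_tr.simps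
    by (rule prv_mp[OF Ax[OF assms[unfolded Suc_neq_zero]]])
      (reify prv_reify, rule ipc_prv, code_simp)
next
  case (Suc_inj s t)
  show ?thesis unfolding Suc_inj neg_tr.simps
    by (rule prv_mp[OF Ax[OF assms[unfolded Suc_inj]]])
      (reify prv_reify, rule ipc_prv, code_simp)
next
  case (Induct \<phi>)
  let ?s = "case_nat (suc (Var 0)) (\<lambda>n. Var (Suc n))"
  have "sub ?s (lift A) = lift A" by (simp add: lift_def)
  then have "neg_tr \<chi> A = FImp (inst (neg_tr \<phi> (lift A)) zero) (FImp
      (FAll (FImp (neg_tr \<phi> (lift A)) (sub ?s (neg_tr \<phi> (lift A))))) (FAll (neg_tr \<phi> (lift A))))"
    unfolding Induct by (simp add: sub_neg_tr neg_tr_inst)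
  then show ?thesis by (simp add: Ax HA.Induct)
qed (use Ax[OF assms] dnegI in simp)+

theorem prv_PA_neg_tr: "prv PA \<Gamma> \<phi> \<Longrightarrow> prv HA ((\<lambda>\<chi>. neg_tr \<chi> A) ` \<Gamma>) (neg_tr \<phi> A)"
proof (induction arbitrary: A rule: prv.induct)
  case (Ax \<phi> \<Gamma>)
  then consider (HA) "\<phi> \<in> HA" | (LEM) \<psi> where "\<phi> = FDec \<psi>" by (auto simp: PA_def)
  then show ?case
  proof cases
    case HA
    then show ?thesis by (rule prv_theorem[OF neg_tr_HA])
  next
    case LEM
    show ?thesis unfolding LEM neg_tr.simps by (reify prv_reify) (rule ipc_prv, code_simp)
  qed
next
  case (BotE \<Gamma> \<phi>)
  then show ?case using neg_tr_BotE by simp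
next
  case (ImpE \<Gamma> \<phi> \<psi>)
  show ?case by (rule prv.ImpE[OF ImpE.IH(1)[unfolded neg_tr.simps] ImpE.IH(2)])
next
  case (OrE \<Gamma> \<phi> \<psi> \<chi>)
  show ?case by (rule neg_tr_OrE[OF OrE.IH(1)]) (use OrE.IH(2,3) in simp_all)
next
  case (ExI \<Gamma> \<phi> t)
  show ?case by (rule neg_tr_ExI[OF ExI.IH])
next
  case (ExE \<Gamma> \<phi> \<psi>)
  show ?case
    by (rule neg_tr_ExE[OF ExE.IH(1)]) (use ExE.IH(2) in \<open>simp add: image_image lift_neg_tr\<close>)
next
  case (EqSubst \<Gamma> s t \<phi>)
  show ?case by (rule neg_tr_EqSubst[OF EqSubst.IH])
qed (simp_all add: prv.Hyp prv.ImpI prv_And_iff prv.OrI1 prv.OrI2 prv.AllI prv.AllE prv.EqRefl dnegI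
    image_image lift_neg_tr neg_tr_inst)

abbreviation gg :: "fm \<Rightarrow> fm" where "gg \<phi> \<equiv> neg_tr \<phi> FBot"

lemma eqv_PA_gg: "eqv PA \<phi> \<psi> \<Longrightarrow> eqv HA (gg \<phi>) (gg \<psi>)"
  unfolding eqv_def using prv_PA_neg_tr[of "{}" "FIff \<phi> \<psi>" FBot] by simp

lemma eqv_gg_stable: "eqv T (FDNeg (gg \<phi>)) (gg \<phi>)"
  by (rule eqv_DNeg_if_DNE[OF neg_tr_stable])

subsection \<open>Equational reasoning\<close>

lemma eq_sym:
  assumes "prv T \<Gamma> (FEq s t)"
  shows "prv T \<Gamma> (FEq t s)"
  using EqSubst[OF assms, of "FEq (Var 0) (lift_trm s)"] by (simp add: EqRefl)

lemma eq_trans [trans]: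
  assumes "prv T \<Gamma> (FEq s t)" "prv T \<Gamma> (FEq t u)"
  shows "prv T \<Gamma> (FEq s u)"
  using EqSubst[OF assms(2), of "FEq (lift_trm s) (Var 0)"] assms(1) by simp

lemma eq_Fn_arg:
  assumes "prv T \<Gamma> (FEq s t)"
  shows "prv T \<Gamma> (FEq (Fn f (us @ s # vs)) (Fn f (us @ t # vs)))"
  using EqSubst[OF assms, of "FEq (lift_trm (Fn f (us @ s # vs)))
      (Fn f (map lift_trm us @ Var 0 # map lift_trm vs))"]
  by (simp add: comp_def EqRefl)

lemma eq_Fn:
  assumes "list_all2 (\<lambda>s t. prv T \<Gamma> (FEq s t)) ss ts"
  shows "prv T \<Gamma> (FEq (Fn f ss) (Fn f ts))"
proof -
  have "prv T \<Gamma> (FEq (Fn f (us @ ss)) (Fn f (us @ ts)))" for us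
    using assms
  proof (induction arbitrary: us rule: list_all2_induct)
    case Nil
    show ?case by (rule EqRefl)
  next
    case (Cons s ss t ts)
    have "prv T \<Gamma> (FEq (Fn f (us @ s # ss)) (Fn f (us @ t # ss)))"
      by (rule eq_Fn_arg[OF Cons.hyps(1)])
    also have "prv T \<Gamma> (FEq (Fn f (us @ t # ss)) (Fn f (us @ t # ts)))"
      using Cons.IH[of "us @ [t]"] by simp
    finally show ?case .
  qed
  from this[of "[]"] show ?thesis by simp
qed

lemma eq_sub_trm:
  "(\<And>n. n \<in> fv_trm t \<Longrightarrow> prv T \<Gamma> (FEq (\<sigma> n) (\<tau> n))) \<Longrightarrow> prv T \<Gamma> (FEq (sub_trm \<sigma> t) (sub_trm \<tau> t))"
proof (induction t)
  case (Fn f ts)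
  then have "list_all2 (\<lambda>s t. prv T \<Gamma> (FEq (sub_trm \<sigma> s) (sub_trm \<tau> t))) ts ts"
    by (intro list.rel_refl_strong) auto
  then show ?case by (simp add: eq_Fn list.rel_map)
qed simp

lemma eq_up:
  "(\<And>n. Suc n \<in> A \<Longrightarrow> prv T {} (FEq (\<sigma> n) (\<tau> n))) \<Longrightarrow> m \<in> A \<Longrightarrow> prv T {} (FEq (up \<sigma> m) (up \<tau> m))"
  using prv_sub[of T "FEq (\<sigma> _) (\<tau> _)"] by (cases m) (simp_all add: EqRefl)

lemma eqv_FEq:
  assumes "prv T {} (FEq s s')" "prv T {} (FEq t t')"
  shows "eqv T (FEq s t) (FEq s' t')"
  by (rule eqvI) (meson assms eq_sym eq_trans prv_insert prv_theorem)+

lemma eqv_sub: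
  "(\<And>n. n \<in> FV \<phi> \<Longrightarrow> prv T {} (FEq (\<sigma> n) (\<tau> n))) \<Longrightarrow> eqv T (sub \<sigma> \<phi>) (sub \<tau> \<phi>)"
proof (induction \<phi> arbitrary: \<sigma> \<tau>)
  case (FEq s t)
  then show ?case by (simp add: eqv_FEq eq_sub_trm)
next
  case (FAll \<phi>)
  have "eqv T (sub (up \<sigma>) \<phi>) (sub (up \<tau>) \<phi>)"
    by (rule FAll.IH, rule eq_up) (use FAll.prems in auto)
  then show ?case by (simp add: eqv_All)
next
  case (FEx \<phi>)
  have "eqv T (sub (up \<sigma>) \<phi>) (sub (up \<tau>) \<phi>)"
    by (rule FEx.IH, rule eq_up) (use FEx.prems in auto)
  then show ?case by (simp add: eqv_Ex)
qed (simp_all add: eqv_Imp eqv_And eqv_Or)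

subsection \<open>Arithmetic in \<open>HA\<close>\<close>

abbreviation HA_eq :: "fm set \<Rightarrow> trm \<Rightarrow> trm \<Rightarrow> bool" ("(_/ \<turnstile> _/ \<approx> _)" [50, 51, 51] 50)
  where "\<Gamma> \<turnstile> s \<approx> t \<equiv> prv HA \<Gamma> (FEq s t)"

text \<open>Index 0 of \<open>\<phi>\<close> is the induction variable; \<open>\<sigma>\<close> supplies the values of the parameters.\<close>

lemma HA_induct:
  assumes "\<And>\<Gamma> \<sigma>. prv HA \<Gamma> (sub (case_nat zero \<sigma>) \<phi>)"
    and "\<And>\<Gamma> t \<sigma>. prv HA \<Gamma> (sub (case_nat t \<sigma>) \<phi>) \<Longrightarrow> prv HA \<Gamma> (sub (case_nat (suc t) \<sigma>) \<phi>)"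
  shows "prv HA \<Gamma> (sub (case_nat t \<sigma>) \<phi>)"
proof -
  let ?\<phi> = "sub (up \<sigma>) \<phi>"
  have "inst ?\<phi> u = sub (case_nat u \<sigma>) \<phi>" for u by (rule inst_sub_up)
  moreover have "(\<lambda>n. sub_trm (case_nat (suc (Var 0)) (\<lambda>n. Var (Suc n))) (up \<sigma> n)) =
      case_nat (suc (Var 0)) (\<lambda>n. lift_trm (\<sigma> n))"
    by (rule ext) (simp add: up_def split: nat.split)
  then have "prv HA \<Delta> (FImp ?\<phi> (sub (case_nat (suc (Var 0)) (\<lambda>n. Var (Suc n))) ?\<phi>))" for \<Delta>
    using assms(2)[of "insert ?\<phi> \<Delta>" "Var 0" "\<lambda>n. lift_trm (\<sigma> n)"]
    by (intro ImpI) (simp add: up_def)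
  ultimately show ?thesis
    using ImpE[OF ImpE[OF Ax[OF HA.Induct[of ?\<phi>]]]] assms(1) AllE AllI by metis
qed

lemma HA_eval_Pj: "i < length ts \<Longrightarrow> \<Gamma> \<turnstile> ts ! i \<approx> t \<Longrightarrow> \<Gamma> \<turnstile> Fn (Pj i) ts \<approx> t"
  using eq_trans[OF Ax[OF HA.Pj, of \<Gamma> i ts]] by simp

lemma HA_eval_Cn: "\<Gamma> \<turnstile> Fn f (map (\<lambda>g. Fn g ts) gs) \<approx> t \<Longrightarrow> \<Gamma> \<turnstile> Fn (Cn f gs) ts \<approx> t"
  by (rule eq_trans[OF Ax[OF HA.Cn]])

lemma HA_eval_Rc_zero: "\<Gamma> \<turnstile> Fn f ts \<approx> t \<Longrightarrow> \<Gamma> \<turnstile> Fn (Rc f g) (zero # ts) \<approx> t"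
  by (rule eq_trans[OF Ax[OF HA.Rc_zero]])

lemma HA_eval_Rc_suc:
  "\<Gamma> \<turnstile> Fn g (Fn (Rc f g) (s # ts) # s # ts) \<approx> t \<Longrightarrow> \<Gamma> \<turnstile> Fn (Rc f g) (suc s # ts) \<approx> t"
  by (rule eq_trans[OF Ax[OF HA.Rc_suc]])

lemma HA_eval_Zr: "\<Gamma> \<turnstile> Fn Zr ts \<approx> zero"
  by (rule Ax[OF HA.Zr])

lemmas HA_evals = HA_eval_Pj HA_eval_Cn HA_eval_Rc_zero HA_eval_Rc_suc HA_eval_Zr eq_Fn EqRefl

definition prd_pr :: pr where "prd_pr = Rc Zr (Pj 1)"
definition cond_pr :: pr where "cond_pr = Rc (Pj 0) (Pj 3)"
definition add_pr :: pr where "add_pr = Rc (Pj 0) (Cn Sc [Pj 0])"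
definition par_pr :: pr where "par_pr = Rc Zr (Cn cond_pr [Pj 0, Cn Sc [Zr], Zr])"
definition half_pr :: pr where
  "half_pr = Rc Zr (Cn cond_pr [Cn par_pr [Pj 1], Pj 0, Cn Sc [Pj 0]])"

abbreviation prd :: "trm \<Rightarrow> trm" where "prd t \<equiv> Fn prd_pr [t]"
abbreviation cond :: "trm \<Rightarrow> trm \<Rightarrow> trm \<Rightarrow> trm" where "cond c s t \<equiv> Fn cond_pr [c, s, t]"
abbreviation add :: "trm \<Rightarrow> trm \<Rightarrow> trm" where "add s t \<equiv> Fn add_pr [s, t]"
abbreviation dbl :: "trm \<Rightarrow> trm" where "dbl t \<equiv> add t t"
abbreviation par :: "trm \<Rightarrow> trm" where "par t \<equiv> Fn par_pr [t]"
abbreviation half :: "trm \<Rightarrow> trm" where "half t \<equiv> Fn half_pr [t]"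

lemma prd_suc: "\<Gamma> \<turnstile> prd (suc t) \<approx> t"
  by (simp add: prd_pr_def HA_evals)

lemma cond_zero: "\<Gamma> \<turnstile> c \<approx> zero \<Longrightarrow> \<Gamma> \<turnstile> cond c s t \<approx> s"
  by (rule eq_trans[of _ _ _ "cond zero s t"])
    (simp add: eq_Fn EqRefl, simp add: cond_pr_def HA_evals)

lemma cond_suc: "\<Gamma> \<turnstile> c \<approx> suc d \<Longrightarrow> \<Gamma> \<turnstile> cond c s t \<approx> t"
  by (rule eq_trans[of _ _ _ "cond (suc d) s t"])
    (simp add: eq_Fn EqRefl, simp add: cond_pr_def HA_evals)

lemma add_zero: "\<Gamma> \<turnstile> add zero t \<approx> t"
  by (simp add: add_pr_def HA_evals)

lemma add_suc_left: "\<Gamma> \<turnstile> add (suc s) t \<approx> suc (add s t)"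
  by (simp add: add_pr_def HA_evals)

lemma par_zero: "\<Gamma> \<turnstile> par zero \<approx> zero"
  by (simp add: par_pr_def HA_evals)

lemma par_suc: "\<Gamma> \<turnstile> par (suc t) \<approx> cond (par t) (suc zero) zero"
  by (simp add: par_pr_def HA_evals)

lemma half_zero: "\<Gamma> \<turnstile> half zero \<approx> zero"
  by (simp add: half_pr_def HA_evals)

lemma half_suc: "\<Gamma> \<turnstile> half (suc t) \<approx> cond (par t) (half t) (suc (half t))"
  by (simp add: half_pr_def HA_evals)

lemma add_suc_right: "\<Gamma> \<turnstile> add s (suc t) \<approx> suc (add s t)"
proof -
  let ?\<phi> = "FEq (add (Var 0) (suc (Var (Suc 0)))) (suc (add (Var 0) (Var (Suc 0))))"
  have "prv HA \<Gamma> (sub (case_nat s (\<lambda>_. t)) ?\<phi>)"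
  proof (rule HA_induct)
    fix \<Gamma> \<sigma> show "prv HA \<Gamma> (sub (case_nat zero \<sigma>) ?\<phi>)"
      by (simp add: eq_trans[OF add_zero eq_sym[OF eq_Fn]] add_zero)
  next
    fix \<Gamma> s \<sigma> assume "prv HA \<Gamma> (sub (case_nat s \<sigma>) ?\<phi>)"
    then have IH: "\<Gamma> \<turnstile> add s (suc (\<sigma> 0)) \<approx> suc (add s (\<sigma> 0))" by simp
    have "\<Gamma> \<turnstile> add (suc s) (suc (\<sigma> 0)) \<approx> suc (add s (suc (\<sigma> 0)))" by (rule add_suc_left)
    also have "\<Gamma> \<turnstile> suc (add s (suc (\<sigma> 0))) \<approx> suc (suc (add s (\<sigma> 0)))" by (simp add: eq_Fn IH)
    also have "\<Gamma> \<turnstile> suc (suc (add s (\<sigma> 0))) \<approx> suc (add (suc s) (\<sigma> 0))"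
      by (simp add: eq_Fn eq_sym[OF add_suc_left])
    finally show "prv HA \<Gamma> (sub (case_nat (suc s) \<sigma>) ?\<phi>)" by simp
  qed
  then show ?thesis by simp
qed

lemma dbl_suc: "\<Gamma> \<turnstile> dbl (suc t) \<approx> suc (suc (dbl t))"
proof -
  have "\<Gamma> \<turnstile> dbl (suc t) \<approx> suc (add t (suc t))" by (rule add_suc_left)
  also have "\<Gamma> \<turnstile> suc (add t (suc t)) \<approx> suc (suc (dbl t))" by (simp add: eq_Fn add_suc_right)
  finally show ?thesis .
qed

lemma par_suc_even: "\<Gamma> \<turnstile> par t \<approx> zero \<Longrightarrow> \<Gamma> \<turnstile> par (suc t) \<approx> suc zero"
  by (rule eq_trans[OF par_suc cond_zero])

lemma par_suc_odd: "\<Gamma> \<turnstile> par t \<approx> suc zero \<Longrightarrow> \<Gamma> \<turnstile> par (suc t) \<approx> zero"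
  by (rule eq_trans[OF par_suc cond_suc])

lemma half_suc_even: "\<Gamma> \<turnstile> par t \<approx> zero \<Longrightarrow> \<Gamma> \<turnstile> half (suc t) \<approx> half t"
  by (rule eq_trans[OF half_suc cond_zero])

lemma half_suc_odd: "\<Gamma> \<turnstile> par t \<approx> suc zero \<Longrightarrow> \<Gamma> \<turnstile> half (suc t) \<approx> suc (half t)"
  by (rule eq_trans[OF half_suc cond_suc])

lemma par_dbl: "\<Gamma> \<turnstile> par (dbl t) \<approx> zero"
proof -
  let ?\<phi> = "FEq (par (dbl (Var 0))) zero"
  have "prv HA \<Gamma> (sub (case_nat t Var) ?\<phi>)"
  proof (rule HA_induct)
    fix \<Gamma> \<sigma> show "prv HA \<Gamma> (sub (case_nat zero \<sigma>) ?\<phi>)"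
      by (simp add: eq_trans[OF eq_Fn par_zero] add_zero)
  next
    fix \<Gamma> t \<sigma> assume "prv HA \<Gamma> (sub (case_nat t \<sigma>) ?\<phi>)"
    then have IH: "\<Gamma> \<turnstile> par (dbl t) \<approx> zero" by simp
    have "\<Gamma> \<turnstile> par (dbl (suc t)) \<approx> par (suc (suc (dbl t)))" by (simp add: eq_Fn dbl_suc)
    also have "\<Gamma> \<turnstile> par (suc (suc (dbl t))) \<approx> zero" by (intro par_suc_odd par_suc_even IH)
    finally show "prv HA \<Gamma> (sub (case_nat (suc t) \<sigma>) ?\<phi>)" by simp
  qed
  then show ?thesis by simp
qed

lemma par_suc_dbl: "\<Gamma> \<turnstile> par (suc (dbl t)) \<approx> suc zero"
  by (rule par_suc_even[OF par_dbl])

lemma half_dbl: "\<Gamma> \<turnstile> half (dbl t) \<approx> t"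
proof -
  let ?\<phi> = "FEq (half (dbl (Var 0))) (Var 0)"
  have "prv HA \<Gamma> (sub (case_nat t Var) ?\<phi>)"
  proof (rule HA_induct)
    fix \<Gamma> \<sigma> show "prv HA \<Gamma> (sub (case_nat zero \<sigma>) ?\<phi>)"
      by (simp add: eq_trans[OF eq_Fn half_zero] add_zero)
  next
    fix \<Gamma> t \<sigma> assume "prv HA \<Gamma> (sub (case_nat t \<sigma>) ?\<phi>)"
    then have IH: "\<Gamma> \<turnstile> half (dbl t) \<approx> t" by simp
    have "\<Gamma> \<turnstile> half (dbl (suc t)) \<approx> half (suc (suc (dbl t)))" by (simp add: eq_Fn dbl_suc)
    also have "\<Gamma> \<turnstile> half (suc (suc (dbl t))) \<approx> suc (half (suc (dbl t)))"
      by (rule half_suc_odd[OF par_suc_dbl])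
    also have "\<Gamma> \<turnstile> suc (half (suc (dbl t))) \<approx> suc t"
      by (simp add: eq_Fn eq_trans[OF half_suc_even[OF par_dbl] IH])
    finally show "prv HA \<Gamma> (sub (case_nat (suc t) \<sigma>) ?\<phi>)" by simp
  qed
  then show ?thesis by simp
qed

lemma half_suc_dbl: "\<Gamma> \<turnstile> half (suc (dbl t)) \<approx> t"
  by (rule eq_trans[OF half_suc_even[OF par_dbl] half_dbl])

subsection \<open>Pairing in \<open>HA\<close>\<close>

text \<open>The pair of \<open>s\<close> and \<open>t\<close> is \<open>2\<^sup>s (2t + 1)\<close>. Halving a number as long as it is even leads to
  its odd part; \<open>halves n w\<close> performs \<open>n\<close> steps of this iteration and \<open>twos n w\<close> counts those that
  did halve. The pair itself bounds the number of steps.\<close>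

definition pair_pr :: pr where
  "pair_pr = Rc (Cn Sc [Cn add_pr [Pj 0, Pj 0]]) (Cn add_pr [Pj 0, Pj 0])"
definition halve_pr :: pr where "halve_pr = Cn cond_pr [par_pr, half_pr, Pj 0]"
definition halves_pr :: pr where "halves_pr = Rc (Pj 0) (Cn halve_pr [Pj 0])"
definition twos_pr :: pr where
  "twos_pr = Rc Zr (Cn add_pr [Cn par_pr [Cn Sc [Cn halves_pr [Pj 1, Pj 2]]], Pj 0])"
definition fst_pr :: pr where "fst_pr = Cn twos_pr [Pj 0, Pj 0]"
definition snd_pr :: pr where "snd_pr = Cn half_pr [Cn halves_pr [Pj 0, Pj 0]]"

abbreviation pair :: "trm \<Rightarrow> trm \<Rightarrow> trm" where "pair s t \<equiv> Fn pair_pr [s, t]"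
abbreviation halve :: "trm \<Rightarrow> trm" where "halve w \<equiv> Fn halve_pr [w]"
abbreviation halves :: "trm \<Rightarrow> trm \<Rightarrow> trm" where "halves n w \<equiv> Fn halves_pr [n, w]"
abbreviation twos :: "trm \<Rightarrow> trm \<Rightarrow> trm" where "twos n w \<equiv> Fn twos_pr [n, w]"
abbreviation pfst :: "trm \<Rightarrow> trm" where "pfst w \<equiv> Fn fst_pr [w]"
abbreviation psnd :: "trm \<Rightarrow> trm" where "psnd w \<equiv> Fn snd_pr [w]"

lemma pair_zero: "\<Gamma> \<turnstile> pair zero t \<approx> suc (dbl t)"
  by (simp add: pair_pr_def HA_evals)

lemma pair_suc: "\<Gamma> \<turnstile> pair (suc s) t \<approx> dbl (pair s t)"
  by (simp add: pair_pr_def HA_evals)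

lemma halve_eq: "\<Gamma> \<turnstile> halve w \<approx> cond (par w) (half w) w"
  by (simp add: halve_pr_def HA_evals)

lemma halve_even: "\<Gamma> \<turnstile> par w \<approx> zero \<Longrightarrow> \<Gamma> \<turnstile> halve w \<approx> half w"
  by (rule eq_trans[OF halve_eq cond_zero])

lemma halve_odd: "\<Gamma> \<turnstile> par w \<approx> suc zero \<Longrightarrow> \<Gamma> \<turnstile> halve w \<approx> w"
  by (rule eq_trans[OF halve_eq cond_suc])

lemma halves_zero: "\<Gamma> \<turnstile> halves zero w \<approx> w"
  by (simp add: halves_pr_def HA_evals)

lemma halves_suc: "\<Gamma> \<turnstile> halves (suc n) w \<approx> halve (halves n w)"
  by (simp add: halves_pr_def HA_evals)

lemma twos_zero: "\<Gamma> \<turnstile> twos zero w \<approx> zero"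
  by (simp add: twos_pr_def HA_evals)

lemma twos_suc: "\<Gamma> \<turnstile> twos (suc n) w \<approx> add (par (suc (halves n w))) (twos n w)"
  by (simp add: twos_pr_def HA_evals)

lemma halves_odd: "\<Gamma> \<turnstile> halves n (suc (dbl t)) \<approx> suc (dbl t)"
proof -
  let ?t = "Var (Suc 0)"
  let ?\<phi> = "FEq (halves (Var 0) (suc (dbl ?t))) (suc (dbl ?t))"
  have "prv HA \<Gamma> (sub (case_nat n (\<lambda>_. t)) ?\<phi>)"
  proof (rule HA_induct)
    fix \<Gamma> \<sigma> show "prv HA \<Gamma> (sub (case_nat zero \<sigma>) ?\<phi>)" by (simp add: halves_zero)
  next
    fix \<Gamma> n and \<sigma> :: "nat \<Rightarrow> trm"
    let ?w = "suc (dbl (\<sigma> 0))"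
    assume "prv HA \<Gamma> (sub (case_nat n \<sigma>) ?\<phi>)"
    then have IH: "\<Gamma> \<turnstile> halves n ?w \<approx> ?w" by simp
    have "\<Gamma> \<turnstile> halves (suc n) ?w \<approx> halve (halves n ?w)" by (rule halves_suc)
    also have "\<Gamma> \<turnstile> halve (halves n ?w) \<approx> halve ?w" by (simp add: eq_Fn IH)
    also have "\<Gamma> \<turnstile> halve ?w \<approx> ?w" by (rule halve_odd[OF par_suc_dbl])
    finally show "prv HA \<Gamma> (sub (case_nat (suc n) \<sigma>) ?\<phi>)" by simp
  qed
  then show ?thesis by simp
qed

lemma twos_odd: "\<Gamma> \<turnstile> twos n (suc (dbl t)) \<approx> zero"
proof -
  let ?\<phi> = "FEq (twos (Var 0) (suc (dbl (Var (Suc 0))))) zero"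
  have "prv HA \<Gamma> (sub (case_nat n (\<lambda>_. t)) ?\<phi>)"
  proof (rule HA_induct)
    fix \<Gamma> \<sigma> show "prv HA \<Gamma> (sub (case_nat zero \<sigma>) ?\<phi>)" by (simp add: twos_zero)
  next
    fix \<Gamma> n and \<sigma> :: "nat \<Rightarrow> trm"
    let ?w = "suc (dbl (\<sigma> 0))"
    assume "prv HA \<Gamma> (sub (case_nat n \<sigma>) ?\<phi>)"
    then have IH: "\<Gamma> \<turnstile> twos n ?w \<approx> zero" by simp
    have odd: "\<Gamma> \<turnstile> par (halves n ?w) \<approx> suc zero"
      by (rule eq_trans[OF eq_Fn par_suc_dbl[of \<Gamma> "\<sigma> 0"]]) (simp add: halves_odd)
    have "\<Gamma> \<turnstile> twos (suc n) ?w \<approx> add (par (suc (halves n ?w))) (twos n ?w)" by (rule twos_suc)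
    also have "\<Gamma> \<turnstile> add (par (suc (halves n ?w))) (twos n ?w) \<approx> add zero zero"
      by (simp add: eq_Fn IH par_suc_odd[OF odd])
    also have "\<Gamma> \<turnstile> add zero zero \<approx> zero" by (rule add_zero)
    finally show "prv HA \<Gamma> (sub (case_nat (suc n) \<sigma>) ?\<phi>)" by simp
  qed
  then show ?thesis by simp
qed

lemma halves_dbl: "\<Gamma> \<turnstile> halves (suc n) (dbl w) \<approx> halves n w"
proof -
  let ?w = "Var (Suc 0)"
  let ?\<phi> = "FEq (halves (suc (Var 0)) (dbl ?w)) (halves (Var 0) ?w)"
  have "prv HA \<Gamma> (sub (case_nat n (\<lambda>_. w)) ?\<phi>)"
  proof (rule HA_induct)
    fix \<Gamma> and \<sigma> :: "nat \<Rightarrow> trm"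
    let ?w = "\<sigma> 0"
    have "\<Gamma> \<turnstile> halves (suc zero) (dbl ?w) \<approx> halve (halves zero (dbl ?w))" by (rule halves_suc)
    also have "\<Gamma> \<turnstile> halve (halves zero (dbl ?w)) \<approx> halve (dbl ?w)"
      by (simp add: eq_Fn halves_zero)
    also have "\<Gamma> \<turnstile> halve (dbl ?w) \<approx> half (dbl ?w)" by (rule halve_even[OF par_dbl])
    also have "\<Gamma> \<turnstile> half (dbl ?w) \<approx> ?w" by (rule half_dbl)
    also have "\<Gamma> \<turnstile> ?w \<approx> halves zero ?w" by (rule eq_sym[OF halves_zero])
    finally show "prv HA \<Gamma> (sub (case_nat zero \<sigma>) ?\<phi>)" by simp
  next
    fix \<Gamma> n and \<sigma> :: "nat \<Rightarrow> trm"
    let ?w = "\<sigma> 0"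
    assume "prv HA \<Gamma> (sub (case_nat n \<sigma>) ?\<phi>)"
    then have IH: "\<Gamma> \<turnstile> halves (suc n) (dbl ?w) \<approx> halves n ?w" by simp
    have "\<Gamma> \<turnstile> halves (suc (suc n)) (dbl ?w) \<approx> halve (halves (suc n) (dbl ?w))"
      by (rule halves_suc)
    also have "\<Gamma> \<turnstile> halve (halves (suc n) (dbl ?w)) \<approx> halve (halves n ?w)" by (simp add: eq_Fn IH)
    also have "\<Gamma> \<turnstile> halve (halves n ?w) \<approx> halves (suc n) ?w" by (rule eq_sym[OF halves_suc])
    finally show "prv HA \<Gamma> (sub (case_nat (suc n) \<sigma>) ?\<phi>)" by simp
  qed
  then show ?thesis by simp
qed

lemma twos_dbl: "\<Gamma> \<turnstile> twos (suc n) (dbl w) \<approx> suc (twos n w)"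
proof -
  let ?w = "Var (Suc 0)"
  let ?\<phi> = "FEq (twos (suc (Var 0)) (dbl ?w)) (suc (twos (Var 0) ?w))"
  have "prv HA \<Gamma> (sub (case_nat n (\<lambda>_. w)) ?\<phi>)"
  proof (rule HA_induct)
    fix \<Gamma> and \<sigma> :: "nat \<Rightarrow> trm"
    let ?w = "\<sigma> 0"
    have even: "\<Gamma> \<turnstile> par (halves zero (dbl ?w)) \<approx> zero"
      by (rule eq_trans[OF eq_Fn par_dbl[of \<Gamma> ?w]]) (simp add: halves_zero)
    have "\<Gamma> \<turnstile> twos (suc zero) (dbl ?w)
        \<approx> add (par (suc (halves zero (dbl ?w)))) (twos zero (dbl ?w))"
      by (rule twos_suc)
    also have "\<Gamma> \<turnstile> add (par (suc (halves zero (dbl ?w)))) (twos zero (dbl ?w))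
        \<approx> add (suc zero) (twos zero ?w)"
      by (simp add: eq_Fn par_suc_even[OF even] eq_trans[OF twos_zero eq_sym[OF twos_zero]])
    also have "\<Gamma> \<turnstile> add (suc zero) (twos zero ?w) \<approx> suc (twos zero ?w)"
      by (rule eq_trans[OF add_suc_left]) (simp add: eq_Fn add_zero)
    finally show "prv HA \<Gamma> (sub (case_nat zero \<sigma>) ?\<phi>)" by simp
  next
    fix \<Gamma> n and \<sigma> :: "nat \<Rightarrow> trm"
    let ?w = "\<sigma> 0"
    assume "prv HA \<Gamma> (sub (case_nat n \<sigma>) ?\<phi>)"
    then have IH: "\<Gamma> \<turnstile> twos (suc n) (dbl ?w) \<approx> suc (twos n ?w)" by simp
    have "\<Gamma> \<turnstile> twos (suc (suc n)) (dbl ?w)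
        \<approx> add (par (suc (halves (suc n) (dbl ?w)))) (twos (suc n) (dbl ?w))"
      by (rule twos_suc)
    also have "\<Gamma> \<turnstile> add (par (suc (halves (suc n) (dbl ?w)))) (twos (suc n) (dbl ?w))
        \<approx> add (par (suc (halves n ?w))) (suc (twos n ?w))"
      by (simp add: eq_Fn halves_dbl IH)
    also have "\<Gamma> \<turnstile> add (par (suc (halves n ?w))) (suc (twos n ?w))
        \<approx> suc (add (par (suc (halves n ?w))) (twos n ?w))"
      by (rule add_suc_right)
    also have "\<Gamma> \<turnstile> suc (add (par (suc (halves n ?w))) (twos n ?w)) \<approx> suc (twos (suc n) ?w)"
      by (simp add: eq_Fn eq_sym[OF twos_suc])
    finally show "prv HA \<Gamma> (sub (case_nat (suc n) \<sigma>) ?\<phi>)" by simp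
  qed
  then show ?thesis by simp
qed

lemma halves_add: "\<Gamma> \<turnstile> halves (add m n) w \<approx> halves m (halves n w)"
proof -
  let ?n = "Var (Suc 0)" and ?w = "Var (Suc (Suc 0))"
  let ?\<phi> = "FEq (halves (add (Var 0) ?n) ?w) (halves (Var 0) (halves ?n ?w))"
  have "prv HA \<Gamma> (sub (case_nat m (case_nat n (\<lambda>_. w))) ?\<phi>)"
  proof (rule HA_induct)
    fix \<Gamma> \<sigma> show "prv HA \<Gamma> (sub (case_nat zero \<sigma>) ?\<phi>)"
      by (simp add: eq_trans[OF eq_Fn eq_sym[OF halves_zero]] add_zero EqRefl)
  next
    fix \<Gamma> m and \<sigma> :: "nat \<Rightarrow> trm"
    let ?n = "\<sigma> 0" and ?w = "\<sigma> (Suc 0)"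
    assume "prv HA \<Gamma> (sub (case_nat m \<sigma>) ?\<phi>)"
    then have IH: "\<Gamma> \<turnstile> halves (add m ?n) ?w \<approx> halves m (halves ?n ?w)" by simp
    have "\<Gamma> \<turnstile> halves (add (suc m) ?n) ?w \<approx> halves (suc (add m ?n)) ?w"
      by (simp add: eq_Fn add_suc_left EqRefl)
    also have "\<Gamma> \<turnstile> halves (suc (add m ?n)) ?w \<approx> halve (halves (add m ?n) ?w)" by (rule halves_suc)
    also have "\<Gamma> \<turnstile> halve (halves (add m ?n) ?w) \<approx> halve (halves m (halves ?n ?w))"
      by (simp add: eq_Fn IH)
    also have "\<Gamma> \<turnstile> halve (halves m (halves ?n ?w)) \<approx> halves (suc m) (halves ?n ?w)"
      by (rule eq_sym[OF halves_suc])
    finally show "prv HA \<Gamma> (sub (case_nat (suc m) \<sigma>) ?\<phi>)" by simp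
  qed
  then show ?thesis by simp
qed

lemma suc_prd: "\<Gamma> \<turnstile> t \<approx> suc s \<Longrightarrow> \<Gamma> \<turnstile> t \<approx> suc (prd t)"
  by (rule eq_trans, assumption, rule eq_sym)
    (simp add: eq_Fn eq_trans[OF eq_Fn prd_suc])

lemma dbl_pos:
  assumes "\<Gamma> \<turnstile> t \<approx> suc s"
  shows "\<Gamma> \<turnstile> dbl t \<approx> suc (add s t)"
  by (rule eq_trans[OF eq_Fn add_suc_left]) (simp add: assms EqRefl)

lemma pair_pos: "\<Gamma> \<turnstile> pair s t \<approx> suc (prd (pair s t))"
proof -
  let ?p = "pair (Var 0) (Var (Suc 0))"
  let ?\<phi> = "FEq ?p (suc (prd ?p))"
  have "prv HA \<Gamma> (sub (case_nat s (\<lambda>_. t)) ?\<phi>)"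
  proof (rule HA_induct)
    fix \<Gamma> \<sigma> show "prv HA \<Gamma> (sub (case_nat zero \<sigma>) ?\<phi>)" by (simp add: suc_prd[OF pair_zero])
  next
    fix \<Gamma> s \<sigma> assume "prv HA \<Gamma> (sub (case_nat s \<sigma>) ?\<phi>)"
    then show "prv HA \<Gamma> (sub (case_nat (suc s) \<sigma>) ?\<phi>)"
      by (simp add: suc_prd[OF eq_trans[OF pair_suc dbl_pos]])
  qed
  then show ?thesis by simp
qed

lemma pair_suc_pos: "\<Gamma> \<turnstile> pair (suc s) t \<approx> suc (add (prd (pair s t)) (pair s t))"
  by (rule eq_trans[OF pair_suc dbl_pos[OF pair_pos]])

lemma halves_pair: "\<Gamma> \<turnstile> halves (pair s t) (pair s t) \<approx> suc (dbl t)"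
proof -
  let ?t = "Var (Suc 0)"
  let ?\<phi> = "FEq (halves (pair (Var 0) ?t) (pair (Var 0) ?t)) (suc (dbl ?t))"
  have "prv HA \<Gamma> (sub (case_nat s (\<lambda>_. t)) ?\<phi>)"
  proof (rule HA_induct)
    fix \<Gamma> \<sigma> show "prv HA \<Gamma> (sub (case_nat zero \<sigma>) ?\<phi>)"
      by (simp add: eq_trans[OF eq_Fn halves_odd[of \<Gamma> "pair zero (\<sigma> 0)" "\<sigma> 0"]] pair_zero EqRefl)
  next
    fix \<Gamma> s and \<sigma> :: "nat \<Rightarrow> trm"
    let ?t = "\<sigma> 0" and ?p = "pair s (\<sigma> 0)"
    assume "prv HA \<Gamma> (sub (case_nat s \<sigma>) ?\<phi>)"
    then have IH: "\<Gamma> \<turnstile> halves ?p ?p \<approx> suc (dbl ?t)" by simp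
    have "\<Gamma> \<turnstile> halves (pair (suc s) ?t) (pair (suc s) ?t) \<approx> halves (suc (add (prd ?p) ?p)) (dbl ?p)"
      by (simp add: eq_Fn pair_suc pair_suc_pos)
    also have "\<Gamma> \<turnstile> halves (suc (add (prd ?p) ?p)) (dbl ?p) \<approx> halves (add (prd ?p) ?p) ?p"
      by (rule halves_dbl)
    also have "\<Gamma> \<turnstile> halves (add (prd ?p) ?p) ?p \<approx> halves (prd ?p) (halves ?p ?p)"
      by (rule halves_add)
    also have "\<Gamma> \<turnstile> halves (prd ?p) (halves ?p ?p) \<approx> suc (dbl ?t)"
      by (rule eq_trans[OF eq_Fn halves_odd[of \<Gamma> "prd ?p" ?t]]) (simp add: IH EqRefl)
    finally show "prv HA \<Gamma> (sub (case_nat (suc s) \<sigma>) ?\<phi>)" by simp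
  qed
  then show ?thesis by simp
qed

lemma twos_add_pair: "\<Gamma> \<turnstile> twos (add m (pair s t)) (pair s t) \<approx> twos (pair s t) (pair s t)"
proof -
  let ?p = "pair (Var (Suc 0)) (Var (Suc (Suc 0)))"
  let ?\<phi> = "FEq (twos (add (Var 0) ?p) ?p) (twos ?p ?p)"
  have "prv HA \<Gamma> (sub (case_nat m (case_nat s (\<lambda>_. t))) ?\<phi>)"
  proof (rule HA_induct)
    fix \<Gamma> \<sigma> show "prv HA \<Gamma> (sub (case_nat zero \<sigma>) ?\<phi>)" by (simp add: eq_Fn add_zero EqRefl)
  next
    fix \<Gamma> m and \<sigma> :: "nat \<Rightarrow> trm"
    let ?t = "\<sigma> (Suc 0)" and ?p = "pair (\<sigma> 0) (\<sigma> (Suc 0))"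
    assume "prv HA \<Gamma> (sub (case_nat m \<sigma>) ?\<phi>)"
    then have IH: "\<Gamma> \<turnstile> twos (add m ?p) ?p \<approx> twos ?p ?p" by simp
    have "\<Gamma> \<turnstile> halves (add m ?p) ?p \<approx> halves m (halves ?p ?p)" by (rule halves_add)
    also have "\<Gamma> \<turnstile> halves m (halves ?p ?p) \<approx> suc (dbl ?t)"
      by (rule eq_trans[OF eq_Fn halves_odd[of \<Gamma> m ?t]]) (simp add: halves_pair EqRefl)
    finally have odd: "\<Gamma> \<turnstile> par (halves (add m ?p) ?p) \<approx> suc zero"
      by (intro eq_trans[OF eq_Fn par_suc_dbl]) simp
    have "\<Gamma> \<turnstile> twos (add (suc m) ?p) ?p \<approx> twos (suc (add m ?p)) ?p"
      by (simp add: eq_Fn add_suc_left EqRefl)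
    also have "\<Gamma> \<turnstile> twos (suc (add m ?p)) ?p
        \<approx> add (par (suc (halves (add m ?p) ?p))) (twos (add m ?p) ?p)"
      by (rule twos_suc)
    also have "\<Gamma> \<turnstile> add (par (suc (halves (add m ?p) ?p))) (twos (add m ?p) ?p)
        \<approx> add zero (twos ?p ?p)"
      by (simp add: eq_Fn par_suc_odd[OF odd] IH)
    also have "\<Gamma> \<turnstile> add zero (twos ?p ?p) \<approx> twos ?p ?p" by (rule add_zero)
    finally show "prv HA \<Gamma> (sub (case_nat (suc m) \<sigma>) ?\<phi>)" by simp
  qed
  then show ?thesis by simp
qed

lemma twos_pair: "\<Gamma> \<turnstile> twos (pair s t) (pair s t) \<approx> s"
proof -
  let ?p = "pair (Var 0) (Var (Suc 0))"
  let ?\<phi> = "FEq (twos ?p ?p) (Var 0)"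
  have "prv HA \<Gamma> (sub (case_nat s (\<lambda>_. t)) ?\<phi>)"
  proof (rule HA_induct)
    fix \<Gamma> \<sigma> show "prv HA \<Gamma> (sub (case_nat zero \<sigma>) ?\<phi>)"
      by (simp add: eq_trans[OF eq_Fn twos_odd[of \<Gamma> "pair zero (\<sigma> 0)" "\<sigma> 0"]] pair_zero EqRefl)
  next
    fix \<Gamma> s and \<sigma> :: "nat \<Rightarrow> trm"
    let ?t = "\<sigma> 0" and ?p = "pair s (\<sigma> 0)"
    assume "prv HA \<Gamma> (sub (case_nat s \<sigma>) ?\<phi>)"
    then have IH: "\<Gamma> \<turnstile> twos ?p ?p \<approx> s" by simp
    have "\<Gamma> \<turnstile> twos (pair (suc s) ?t) (pair (suc s) ?t) \<approx> twos (suc (add (prd ?p) ?p)) (dbl ?p)"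
      by (simp add: eq_Fn pair_suc pair_suc_pos)
    also have "\<Gamma> \<turnstile> twos (suc (add (prd ?p) ?p)) (dbl ?p) \<approx> suc (twos (add (prd ?p) ?p) ?p)"
      by (rule twos_dbl)
    also have "\<Gamma> \<turnstile> suc (twos (add (prd ?p) ?p) ?p) \<approx> suc s"
      by (simp add: eq_Fn eq_trans[OF twos_add_pair IH])
    finally show "prv HA \<Gamma> (sub (case_nat (suc s) \<sigma>) ?\<phi>)" by simp
  qed
  then show ?thesis by simp
qed

lemma pfst_pair: "\<Gamma> \<turnstile> pfst (pair s t) \<approx> s"
  by (rule eq_trans[OF _ twos_pair[of _ s t]]) (simp add: fst_pr_def HA_evals)

lemma psnd_pair: "\<Gamma> \<turnstile> psnd (pair s t) \<approx> t"
proof -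
  have "\<Gamma> \<turnstile> psnd (pair s t) \<approx> half (halves (pair s t) (pair s t))"
    by (simp add: snd_pr_def HA_evals)
  also have "\<Gamma> \<turnstile> half (halves (pair s t) (pair s t)) \<approx> t"
    by (rule eq_trans[OF eq_Fn half_suc_dbl]) (simp add: halves_pair)
  finally show ?thesis .
qed

primrec tuple :: "trm list \<Rightarrow> trm" where
  "tuple [] = zero"
| "tuple (t # ts) = pair t (tuple ts)"

primrec proj :: "nat \<Rightarrow> trm \<Rightarrow> trm" where
  "proj 0 w = pfst w"
| "proj (Suc i) w = proj i (psnd w)"

lemma proj_cong: "\<Gamma> \<turnstile> v \<approx> w \<Longrightarrow> \<Gamma> \<turnstile> proj i v \<approx> proj i w"
  by (induction i arbitrary: v w) (simp_all add: eq_Fn)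

lemma proj_tuple: "i < length ts \<Longrightarrow> \<Gamma> \<turnstile> proj i (tuple ts) \<approx> ts ! i"
proof (induction ts arbitrary: i)
  case (Cons t ts)
  show ?case
  proof (cases i)
    case 0
    then show ?thesis by (simp add: pfst_pair)
  next
    case (Suc j)
    then show ?thesis using Cons eq_trans[OF proj_cong[OF psnd_pair]] by simp
  qed
qed simp

lemma sub_trm_proj: "sub_trm \<sigma> (proj i w) = proj i (sub_trm \<sigma> w)"
  by (induction i arbitrary: w) simp_all

lemma fv_trm_proj: "fv_trm (proj i w) = fv_trm w"
  by (induction i arbitrary: w) simp_all

lemma eqv_one_parameter:
  obtains \<rho> t where "FV (sub \<rho> \<phi>) \<subseteq> {0}" "eqv HA (sub (\<lambda>_. t) (sub \<rho> \<phi>)) \<phi>"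
proof -
  obtain N where N: "FV \<phi> \<subseteq> {..<N}" by (rule FV_bounded)
  let ?\<rho> = "\<lambda>i. proj i (Var 0)" and ?t = "tuple (map Var [0..<N])"
  have "FV (sub ?\<rho> \<phi>) \<subseteq> {0}" by (auto simp: FV_sub fv_trm_proj)
  moreover have "{} \<turnstile> proj i ?t \<approx> Var i" if "i < N" for i
    using proj_tuple[of i "map Var [0..<N]" "{}"] that by simp
  then have "eqv HA (sub (\<lambda>i. proj i ?t) \<phi>) (sub Var \<phi>)" by (rule eqv_sub) (use N in auto)
  then have "eqv HA (sub (\<lambda>_. ?t) (sub ?\<rho> \<phi>)) \<phi>" by (simp add: sub_trm_proj)
  ultimately show ?thesis by (rule that)
qed

subsection \<open>Decidability of quantifier-free formulas\<close>

lemma zero_neq_suc: "\<Gamma> \<turnstile> zero \<approx> suc t \<Longrightarrow> prv HA \<Gamma> \<phi>"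
  by (rule BotE, rule ImpE[OF Ax[OF HA.Suc_neq_zero] eq_sym])

lemma nat_cases:
  assumes "prv HA (insert (FEq t zero) \<Gamma>) \<chi>" "prv HA (insert (FEq t (suc (prd t))) \<Gamma>) \<chi>"
  shows "prv HA \<Gamma> \<chi>"
proof -
  let ?\<phi> = "FOr (FEq (Var 0) zero) (FEq (Var 0) (suc (prd (Var 0))))"
  have "prv HA \<Gamma> (sub (case_nat t Var) ?\<phi>)"
    by (rule HA_induct) (simp_all add: OrI1 OrI2 EqRefl eq_sym[OF eq_Fn] prd_suc)
  then show ?thesis using OrE assms by simp
qed

lemma zero_eq_decidable: "prv HA \<Gamma> (FDec (FEq zero t))"
proof (rule nat_cases[of t])
  show "prv HA (insert (FEq t zero) \<Gamma>) (FDec (FEq zero t))"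
    by (rule OrI1, rule eq_sym) simp
  show "prv HA (insert (FEq t (suc (prd t))) \<Gamma>) (FDec (FEq zero t))"
    by (rule OrI2, rule ImpI, rule zero_neq_suc[of _ "prd t"], rule eq_trans[of _ _ _ t])
      (simp_all add: Hyp)
qed

lemma suc_eq_decidable:
  assumes "prv HA \<Gamma> (FDec (FEq s (prd t)))"
  shows "prv HA \<Gamma> (FDec (FEq (suc s) t))"
proof (rule nat_cases[of t])
  show "prv HA (insert (FEq t zero) \<Gamma>) (FDec (FEq (suc s) t))"
    by (rule OrI2, rule ImpI, rule zero_neq_suc[of _ s], rule eq_trans[OF eq_sym eq_sym, of _ _ t])
      (simp_all add: Hyp)
next
  let ?\<Gamma> = "insert (FEq t (suc (prd t))) \<Gamma>"
  show "prv HA ?\<Gamma> (FDec (FEq (suc s) t))"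
  proof (rule OrE[OF prv_weaken[OF assms]])
    let ?\<Delta> = "insert (FEq s (prd t)) ?\<Gamma>"
    have "?\<Delta> \<turnstile> suc s \<approx> suc (prd t)" by (simp add: eq_Fn)
    also have "?\<Delta> \<turnstile> suc (prd t) \<approx> t" by (rule eq_sym) (simp add: Hyp)
    finally show "prv HA ?\<Delta> (FDec (FEq (suc s) t))" by (rule OrI1)
  next
    let ?\<Delta> = "insert (FEq (suc s) t) (insert (FNeg (FEq s (prd t))) ?\<Gamma>)"
    have "?\<Delta> \<turnstile> suc s \<approx> t" by simp
    also have "?\<Delta> \<turnstile> t \<approx> suc (prd t)" by (simp add: Hyp)
    finally have "?\<Delta> \<turnstile> s \<approx> prd t" by (rule ImpE[OF Ax[OF HA.Suc_inj]])
    moreover have "prv HA ?\<Delta> (FNeg (FEq s (prd t)))" by (simp add: Hyp)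
    ultimately have "prv HA ?\<Delta> FBot" by (rule ImpE[rotated])
    then show "prv HA (insert (FNeg (FEq s (prd t))) ?\<Gamma>)
        (FDec (FEq (suc s) t))"
      by (intro OrI2 ImpI)
  qed
qed

lemma eq_decidable: "prv HA \<Gamma> (FDec (FEq s t))"
proof -
  let ?dec = "\<lambda>s t. FDec (FEq s t)"
  let ?\<phi> = "FAll (?dec (Var (Suc 0)) (Var 0))"
  have "prv HA \<Gamma> (sub (case_nat s Var) ?\<phi>)"
  proof (rule HA_induct)
    fix \<Gamma> \<sigma> show "prv HA \<Gamma> (sub (case_nat zero \<sigma>) ?\<phi>)"
      by (simp add: AllI zero_eq_decidable)
  next
    fix \<Gamma> s \<sigma> assume IH: "prv HA \<Gamma> (sub (case_nat s \<sigma>) ?\<phi>)"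
    let ?\<Gamma> = "lift ` insert (FAll (?dec (lift_trm s) (Var 0))) \<Gamma>"
    have "prv HA ?\<Gamma> (lift (FAll (?dec (lift_trm s) (Var 0))))" by simp
    then have "prv HA ?\<Gamma> (inst (?dec (lift_trm (lift_trm s)) (Var 0)) (prd (Var 0)))"
      by (intro AllE) (simp add: lift_def)
    then have "prv HA ?\<Gamma> (?dec (suc (lift_trm s)) (Var 0))" by (intro suc_eq_decidable) simp
    then have "prv HA (insert (FAll (?dec (lift_trm s) (Var 0))) \<Gamma>)
        (FAll (?dec (suc (lift_trm s)) (Var 0)))" by (rule AllI)
    with IH show "prv HA \<Gamma> (sub (case_nat (suc s) \<sigma>) ?\<phi>)" by (auto intro: prv_cut)
  qed
  then have "prv HA \<Gamma> (FAll (?dec (lift_trm s) (Var 0)))" by simp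
  from AllE[OF this, of t] show ?thesis by simp
qed

lemma qf_decidable: "qf \<phi> \<Longrightarrow> prv HA \<Gamma> (FDec \<phi>)"
proof (induction \<phi>)
  case (FEq s t)
  show ?case by (rule eq_decidable)
next
  case FBot
  show ?case by (reify prv_reify) (rule ipc_prv, code_simp)
next
  case (FImp \<phi> \<psi>)
  then have "prv HA \<Gamma> (FDec \<phi>)" "prv HA \<Gamma> (FDec \<psi>)" by simp_all
  then show ?case by (rule prv_mp2) (reify prv_reify, rule ipc_prv, code_simp)
next
  case (FAnd \<phi> \<psi>)
  then have "prv HA \<Gamma> (FDec \<phi>)" "prv HA \<Gamma> (FDec \<psi>)" by simp_all
  then show ?case by (rule prv_mp2) (reify prv_reify, rule ipc_prv, code_simp)
next
  case (FOr \<phi> \<psi>)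
  then have "prv HA \<Gamma> (FDec \<phi>)" "prv HA \<Gamma> (FDec \<psi>)" by simp_all
  then show ?case by (rule prv_mp2) (reify prv_reify, rule ipc_prv, code_simp)
qed simp_all

subsection \<open>Prenex classes\<close>

primrec quant :: "sign \<Rightarrow> fm \<Rightarrow> fm" where
  "quant Plus \<phi> = FEx \<phi>"
| "quant Minus \<phi> = FAll \<phi>"

inductive prenex :: "sign \<Rightarrow> nat \<Rightarrow> fm \<Rightarrow> bool" where
  qf: "qf \<phi> \<Longrightarrow> prenex s 0 \<phi>"
| flip: "prenex (flip s) k \<phi> \<Longrightarrow> prenex s (Suc k) \<phi>"
| quant: "prenex s (Suc k) \<phi> \<Longrightarrow> prenex s (Suc k) (quant s \<phi>)"

lemma flip_flip [simp]: "flip (flip s) = s"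
  by (cases s) simp_all

lemma prenex_Suc_induct [consumes 1, case_names flip quant]:
  assumes "prenex s (Suc k) \<phi>" "\<And>\<phi>. prenex (flip s) k \<phi> \<Longrightarrow> P \<phi>"
    and "\<And>\<phi>. prenex s (Suc k) \<phi> \<Longrightarrow> P \<phi> \<Longrightarrow> P (quant s \<phi>)"
  shows "P \<phi>"
  using assms by (induction s "Suc k" \<phi> rule: prenex.induct) auto

lemma prenex_funpow_quant: "prenex (flip s) k \<phi> \<Longrightarrow> prenex s (Suc k) ((quant s ^^ n) \<phi>)"
  by (induction n) (simp_all add: prenex.flip prenex.quant)

lemma quant_eq_FEx_FAll: "quant Plus = FEx" "quant Minus = FAll"
  by (rule ext, simp)+

lemma Sigma_cl_Pi_cl_prenex:
  "(\<phi> \<in> Sigma_cl k \<longrightarrow> prenex Plus k \<phi>) \<and> (\<phi> \<in> Pi_cl k \<longrightarrow> prenex Minus k \<phi>)"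
proof (induction k arbitrary: \<phi>)
  case 0
  then show ?case by (simp add: prenex.qf)
next
  case (Suc k)
  then show ?case
    using prenex_funpow_quant[of Plus k] prenex_funpow_quant[of Minus k]
    by (auto simp: quant_eq_FEx_FAll)
qed

lemma prenex_Sigma_cl_Pi_cl:
  "prenex s k \<phi> \<Longrightarrow> \<phi> \<in> (case s of Plus \<Rightarrow> Sigma_cl k | Minus \<Rightarrow> Pi_cl k)"
proof (induction rule: prenex.induct)
  case (flip s k \<phi>)
  then show ?case by (cases s) (auto intro!: exI[of _ 0])
next
  case (quant s k \<phi>)
  have "\<exists>m. quant s ((quant s ^^ n) \<psi>) = (quant s ^^ m) \<psi>" for n \<psi>
    by (rule exI[of _ "Suc n"]) simp
  then show ?case using quant.IH by (cases s) (fastforce simp: quant_eq_FEx_FAll)+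
qed (simp split: sign.split)

lemma Sigma_cl_iff: "\<phi> \<in> Sigma_cl k \<longleftrightarrow> prenex Plus k \<phi>"
  and Pi_cl_iff: "\<phi> \<in> Pi_cl k \<longleftrightarrow> prenex Minus k \<phi>"
  using Sigma_cl_Pi_cl_prenex prenex_Sigma_cl_Pi_cl[of Plus k \<phi>] prenex_Sigma_cl_Pi_cl[of Minus k \<phi>]
  by auto

declare Sigma_cl.simps(2) [simp del] Pi_cl.simps(2) [simp del]

lemma prenex_Suc: "prenex s k \<phi> \<Longrightarrow> prenex s (Suc k) \<phi>"
  by (induction rule: prenex.induct) (auto intro: prenex.intros)

lemma prenex_le: "prenex s j \<phi> \<Longrightarrow> j \<le> k \<Longrightarrow> prenex s k \<phi>"
  by (rule dec_induct[of j k "\<lambda>k. prenex s k \<phi>"]) (auto intro: prenex_Suc)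

lemma qf_prenex: "qf \<phi> \<Longrightarrow> prenex s k \<phi>"
  using prenex_le[OF prenex.qf] by simp

lemma qf_sub: "qf (sub \<sigma> \<phi>) = qf \<phi>"
  by (induction \<phi> arbitrary: \<sigma>) auto

lemma sub_quant: "sub \<sigma> (quant s \<phi>) = quant s (sub (up \<sigma>) \<phi>)"
  by (cases s) simp_all

lemma FV_quant: "FV (quant s \<phi>) = {n. Suc n \<in> FV \<phi>}"
  by (cases s) simp_all

lemma eqv_quant: "eqv T \<phi> \<psi> \<Longrightarrow> eqv T (quant s \<phi>) (quant s \<psi>)"
  by (cases s) (simp_all add: eqv_All eqv_Ex)

lemma eqv_quant_And: "eqv T (quant s (FAnd \<phi> (lift \<psi>))) (FAnd (quant s \<phi>) \<psi>)"
  by (cases s) (simp_all add: eqv_All_And eqv_Ex_And)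

lemma prenex_sub: "prenex s k \<phi> \<Longrightarrow> prenex s k (sub \<sigma> \<phi>)"
proof (induction arbitrary: \<sigma> rule: prenex.induct)
  case (quant s k \<phi>)
  show ?case unfolding sub_quant by (rule prenex.quant[OF quant.IH])
qed (simp_all add: qf_sub prenex.qf prenex.flip)

subsection \<open>Prenex normal forms\<close>

definition prenex_form :: "fm set \<Rightarrow> sign \<Rightarrow> nat \<Rightarrow> fm \<Rightarrow> bool" where
  "prenex_form T s k \<phi> \<longleftrightarrow> (\<exists>\<psi>. prenex s k \<psi> \<and> FV \<psi> = FV \<phi> \<and> eqv T \<phi> \<psi>)"

lemma prenex_prenex_form: "prenex s k \<phi> \<Longrightarrow> prenex_form T s k \<phi>"
  by (auto simp: prenex_form_def)

lemma prenex_form_eqv: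
  "prenex_form T s k \<phi> \<Longrightarrow> eqv T \<psi> \<phi> \<Longrightarrow> FV \<psi> = FV \<phi> \<Longrightarrow> prenex_form T s k \<psi>"
  by (auto simp: prenex_form_def intro: eqv_trans)

lemma prenex_form_flip: "prenex_form T (flip s) k \<phi> \<Longrightarrow> prenex_form T s (Suc k) \<phi>"
  by (auto simp: prenex_form_def intro: prenex.flip)

lemma prenex_form_quant:
  "prenex_form T s (Suc k) \<phi> \<Longrightarrow> prenex_form T s (Suc k) (quant s \<phi>)"
  unfolding prenex_form_def by (metis prenex.quant FV_quant eqv_quant)

lemma prenex_form_And_commute:
  "prenex_form T s k (FAnd \<phi> \<psi>) \<Longrightarrow> prenex_form T s k (FAnd \<psi> \<phi>)"
  by (erule prenex_form_eqv[OF _ eqv_And_commute]) auto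

lemma prenex_form_quant_And:
  assumes "prenex_form T s (Suc k) (FAnd \<phi> (lift \<psi>))"
  shows "prenex_form T s (Suc k) (FAnd (quant s \<phi>) \<psi>)"
  by (rule prenex_form_eqv[OF prenex_form_quant[OF assms] eqv_sym[OF eqv_quant_And]])
    (auto simp: FV_quant FV_lift)

lemma prenex_form_And_sub:
  "prenex s k \<phi> \<Longrightarrow> prenex s k \<psi> \<Longrightarrow> prenex_form T s k (FAnd (sub \<sigma> \<phi>) \<psi>)"
proof (induction arbitrary: \<psi> \<sigma> rule: prenex.induct)
  case (qf \<phi> s)
  then have "qf (FAnd (sub \<sigma> \<phi>) \<psi>)" by (auto simp: qf_sub elim: prenex.cases)
  then show ?case by (intro prenex_prenex_form prenex.qf)
next
  case (flip s k \<phi>)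
  note IH = flip.IH
  from flip.prems show ?case
  proof (induction arbitrary: \<sigma> rule: prenex_Suc_induct)
    case (flip \<psi>)
    show ?case by (rule prenex_form_flip[OF IH[OF flip]])
  next
    case (quant \<psi>)
    have "prenex_form T s (Suc k) (FAnd (lift (sub \<sigma> \<phi>)) \<psi>)" using quant.IH by (simp add: lift_def)
    from prenex_form_And_commute[OF prenex_form_quant_And[OF prenex_form_And_commute[OF this]]]
    show ?case .
  qed
next
  case (quant s k \<phi>)
  show ?case unfolding sub_quant
    by (rule prenex_form_quant_And[OF quant.IH]) (simp add: lift_def prenex_sub quant.prems)
qed

lemma prenex_form_And:
  assumes "prenex_form T s k \<phi>" "prenex_form T s k \<psi>"
  shows "prenex_form T s k (FAnd \<phi> \<psi>)"
proof -
  obtain \<phi>' \<psi>' where "prenex s k \<phi>'" "FV \<phi>' = FV \<phi>" "eqv T \<phi> \<phi>'"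
    and "prenex s k \<psi>'" "FV \<psi>' = FV \<psi>" "eqv T \<psi> \<psi>'"
    using assms by (auto simp: prenex_form_def)
  then show ?thesis
    using prenex_form_eqv[OF prenex_form_And_sub[of s k \<phi>' \<psi>' T Var] eqv_And] by simp
qed

lemma or_free_quant: "or_free (quant s \<phi>) \<longleftrightarrow> or_free \<phi>"
  by (cases s) simp_all

lemma qf_or_free: "qf \<phi> \<Longrightarrow> \<exists>\<psi>. qf \<psi> \<and> or_free \<psi> \<and> eqv HA \<phi> \<psi>"
proof (induction \<phi>)
  case (FEq s t)
  show ?case by (rule exI[of _ "FEq s t"]) simp
next
  case FBot
  show ?case by (rule exI[of _ FBot]) simp
next
  case (FImp \<phi> \<psi>)
  then obtain \<phi>' \<psi>' where "qf \<phi>'" "or_free \<phi>'" "eqv HA \<phi> \<phi>'" "qf \<psi>'" "or_free \<psi>'" "eqv HA \<psi> \<psi>'"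
    by auto
  then show ?case by (intro exI[of _ "FImp \<phi>' \<psi>'"]) (simp add: eqv_Imp)
next
  case (FAnd \<phi> \<psi>)
  then obtain \<phi>' \<psi>' where "qf \<phi>'" "or_free \<phi>'" "eqv HA \<phi> \<phi>'" "qf \<psi>'" "or_free \<psi>'" "eqv HA \<psi> \<psi>'"
    by auto
  then show ?case by (intro exI[of _ "FAnd \<phi>' \<psi>'"]) (simp add: eqv_And)
next
  case (FOr \<phi> \<psi>)
  then obtain \<phi>' \<psi>' where IH: "qf \<phi>'" "or_free \<phi>'" "eqv HA \<phi> \<phi>'" "qf \<psi>'" "or_free \<psi>'" "eqv HA \<psi> \<psi>'"
    by auto
  have "eqv HA (FOr \<phi> \<psi>) (FImp (FNeg \<phi>) \<psi>)"
    using FOr.prems by (simp add: eqv_Or_Imp_if_dec qf_decidable)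
  also have "eqv HA (FImp (FNeg \<phi>) \<psi>) (FImp (FNeg \<phi>') \<psi>')"
    using IH by (intro eqv_Imp eqv_Neg)
  finally show ?case using IH by (intro exI[of _ "FImp (FNeg \<phi>') \<psi>'"]) simp
qed simp_all

lemma prenex_or_free:
  "prenex s k \<phi> \<Longrightarrow> \<exists>\<psi>. prenex s k \<psi> \<and> or_free \<psi> \<and> eqv HA \<phi> \<psi>"
proof (induction rule: prenex.induct)
  case (qf \<phi> s)
  then show ?case using qf_or_free prenex.qf by blast
next
  case (flip s k \<phi>)
  then show ?case using prenex.flip by blast
next
  case (quant s k \<phi>)
  then show ?case using prenex.quant eqv_quant or_free_quant by metis
qed

subsection \<open>Classical prenex normal forms\<close>

lemma PA_LEM: "prv PA \<Gamma> (FDec \<phi>)"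
  by (auto simp: PA_def intro: Ax)

lemma PA_DNE: "prv PA \<Gamma> (FImp (FDNeg \<phi>) \<phi>)"
  by (rule prv_DNE_if_dec[OF PA_LEM])

lemma PA_DNeg: "eqv PA (FDNeg \<phi>) \<phi>"
  by (rule eqv_DNeg_if_DNE[OF PA_DNE])

lemma PA_Imp: "eqv PA (FImp \<phi> \<psi>) (FNeg (FAnd \<phi> (FNeg \<psi>)))"
  unfolding eqv_def
  by (rule prv_mp[OF PA_LEM[of _ \<psi>]], reify prv_reify) (rule ipc_prv, code_simp)

lemma PA_Or: "eqv PA (FOr \<phi> \<psi>) (FImp (FNeg \<phi>) \<psi>)"
  by (rule eqv_Or_Imp_if_dec[OF PA_LEM])

lemma PA_Neg_All: "eqv PA (FNeg (FAll \<phi>)) (FEx (FNeg \<phi>))"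
proof -
  have "eqv PA (FNeg (FEx (FNeg \<phi>))) (FAll (FDNeg \<phi>))" by (rule eqv_Neg_Ex)
  also have "eqv PA (FAll (FDNeg \<phi>)) (FAll \<phi>)" by (rule eqv_All[OF PA_DNeg])
  finally have "eqv PA (FDNeg (FEx (FNeg \<phi>))) (FNeg (FAll \<phi>))" by (rule eqv_Neg)
  then show ?thesis by (rule eqv_trans[OF eqv_sym PA_DNeg])
qed

lemma PA_Neg_quant: "eqv PA (FNeg (quant s \<phi>)) (quant (flip s) (FNeg \<phi>))"
  by (cases s) (simp_all add: eqv_Neg_Ex PA_Neg_All)

lemma prenex_form_PA_Neg:
  assumes "prenex_form PA s k \<phi>"
  shows "prenex_form PA (flip s) k (FNeg \<phi>)"
proof -
  have "prenex_form PA (flip s) k (FNeg \<phi>)" if "prenex s k \<phi>" for \<phi>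
    using that
  proof (induction rule: prenex.induct)
    case (qf \<phi> s)
    then show ?case by (intro prenex_prenex_form prenex.qf) simp
  next
    case (flip s k \<phi>)
    then show ?case by (simp add: prenex_form_flip)
  next
    case (quant s k \<phi>)
    show ?case
      by (rule prenex_form_eqv[OF prenex_form_quant[OF quant.IH] PA_Neg_quant])
        (simp add: FV_quant)
  qed
  then show ?thesis
    using assms prenex_form_eqv[OF _ eqv_Neg] by (fastforce simp: prenex_form_def[of _ s])
qed

lemma prenex_form_PA_Imp:
  assumes "prenex_form PA (flip s) k \<phi>" "prenex_form PA s k \<psi>"
  shows "prenex_form PA s k (FImp \<phi> \<psi>)"
proof -
  have "prenex_form PA (flip s) k (FAnd \<phi> (FNeg \<psi>))"
    by (rule prenex_form_And[OF assms(1) prenex_form_PA_Neg[OF assms(2)]])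
  from prenex_form_eqv[OF prenex_form_PA_Neg[OF this] PA_Imp] show ?thesis by simp
qed

lemma prenex_form_PA_Or:
  assumes "prenex_form PA s k \<phi>" "prenex_form PA s k \<psi>"
  shows "prenex_form PA s k (FOr \<phi> \<psi>)"
  using prenex_form_eqv[OF prenex_form_PA_Imp[OF prenex_form_PA_Neg[OF assms(1)] assms(2)] PA_Or]
  by simp

subsection \<open>Alternation paths\<close>

text \<open>\<open>alt_bounded Minus k\<close> and \<open>alt_bounded Plus k\<close> are the classes \<open>U_cl k\<close> and \<open>E_cl k\<close> together
  with all formulas of degree below \<open>k\<close>; unlike the exact classes they are inherited by
  subformulas.\<close>

definition alt_bounded :: "sign \<Rightarrow> nat \<Rightarrow> fm \<Rightarrow> bool" where
  "alt_bounded s k \<phi> \<longleftrightarrow> (\<forall>p\<in>Alt \<phi>. length p < k \<or> length p = k \<and> init_sign p \<noteq> Some (flip s))"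

lemma length_perp [simp]: "length (perp p) = length p"
  by (simp add: perp_def)

lemma init_sign_simps [simp]: "init_sign [] = None" "init_sign (a # p) = Some a"
  by (simp_all add: init_sign_def)

lemma init_sign_perp [simp]: "init_sign (perp p) = map_option flip (init_sign p)"
  by (cases p) (simp_all add: perp_def)

lemma flip_eq_iff [simp]: "flip a = flip b \<longleftrightarrow> a = b"
  by (cases a; cases b; simp)

lemma flip_neq [simp]: "flip s \<noteq> s" "s \<noteq> flip s"
  by (cases s; simp)+

lemma neq_flip_iff: "a \<noteq> s \<longleftrightarrow> a = flip s"
  by (cases a; cases s; simp)

lemma finite_Alt: "finite (Alt \<phi>)"
  by (induction \<phi>) (simp_all add: setcompr_eq_image)

lemma Alt_quant: "Alt (quant s \<phi>) = {p \<in> Alt \<phi>. init_sign p = Some s}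
    \<union> {s # p | p. p \<in> Alt \<phi> \<and> init_sign p \<noteq> Some s}"
  by (cases s) simp_all

lemma init_sign_Alt_quant: "p \<in> Alt (quant s \<phi>) \<Longrightarrow> init_sign p = Some s"
  by (auto simp: Alt_quant)

lemma Alt_nonempty: "Alt \<phi> \<noteq> {}"
proof (induction \<phi>)
  case (FAll \<phi>)
  then show ?case using Alt_quant[of Minus \<phi>] by auto
next
  case (FEx \<phi>)
  then show ?case using Alt_quant[of Plus \<phi>] by auto
qed simp_all

lemma alt_bounded_mono: "alt_bounded s j \<phi> \<Longrightarrow> j \<le> k \<Longrightarrow> alt_bounded s k \<phi>"
  by (fastforce simp: alt_bounded_def)

lemma alt_bounded_flip: "alt_bounded (flip s) k \<phi> \<Longrightarrow> alt_bounded s (Suc k) \<phi>"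
  by (fastforce simp: alt_bounded_def)

lemma alt_bounded_Neg [simp]: "alt_bounded s k (FNeg \<phi>) \<longleftrightarrow> alt_bounded (flip s) k \<phi>"
  by (fastforce simp: alt_bounded_def)

lemma alt_bounded_Imp:
  "alt_bounded s k (FImp \<phi> \<psi>) \<longleftrightarrow> alt_bounded (flip s) k \<phi> \<and> alt_bounded s k \<psi>"
proof (cases "\<psi> = FBot")
  case True
  then show ?thesis by (auto simp: alt_bounded_def[of _ _ FBot])
next
  case False
  then show ?thesis by (simp add: alt_bounded_def ball_Un)
qed

lemma alt_bounded_And: "alt_bounded s k (FAnd \<phi> \<psi>) \<longleftrightarrow> alt_bounded s k \<phi> \<and> alt_bounded s k \<psi>"
  by (auto simp: alt_bounded_def)

lemma alt_bounded_Or: "alt_bounded s k (FOr \<phi> \<psi>) \<longleftrightarrow> alt_bounded s k \<phi> \<and> alt_bounded s k \<psi>"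
  by (auto simp: alt_bounded_def)

lemma alt_bounded_quant: "alt_bounded s k (quant s \<phi>) \<longleftrightarrow> k \<noteq> 0 \<and> alt_bounded s k \<phi>"
proof
  assume bounded: "alt_bounded s k (quant s \<phi>)"
  have "length p < k \<or> length p = k \<and> init_sign p = Some s" if "p \<in> Alt \<phi>" for p
  proof (cases "init_sign p = Some s")
    case True
    then show ?thesis using bounded that by (auto simp: alt_bounded_def Alt_quant)
  next
    case False
    then have "s # p \<in> Alt (quant s \<phi>)" using that by (simp add: Alt_quant)
    then show ?thesis using bounded by (fastforce simp: alt_bounded_def)
  qed
  moreover obtain p where "p \<in> Alt \<phi>" using Alt_nonempty by blast
  ultimately show "k \<noteq> 0 \<and> alt_bounded s k \<phi>" by (fastforce simp: alt_bounded_def)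
next
  assume "k \<noteq> 0 \<and> alt_bounded s k \<phi>"
  moreover have "p = []" if "init_sign p \<noteq> Some s" "init_sign p \<noteq> Some (flip s)" for p
    using that by (cases p) (auto simp: neq_flip_iff)
  ultimately show "alt_bounded s k (quant s \<phi>)"
    by (fastforce simp: alt_bounded_def Alt_quant)
qed

lemma alt_bounded_quant_flip:
  "alt_bounded s k (quant (flip s) \<phi>) \<longleftrightarrow> (\<exists>j. k = Suc j \<and> alt_bounded (flip s) j (quant (flip s) \<phi>))"
proof -
  have "alt_bounded s k (quant (flip s) \<phi>) \<longleftrightarrow> (\<forall>p\<in>Alt (quant (flip s) \<phi>). length p < k)"
    by (auto simp: alt_bounded_def init_sign_Alt_quant)
  moreover have "alt_bounded (flip s) j (quant (flip s) \<phi>) \<longleftrightarrow>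
      (\<forall>p\<in>Alt (quant (flip s) \<phi>). length p \<le> j)" for j
    by (auto simp: alt_bounded_def init_sign_Alt_quant le_less)
  moreover obtain p where "p \<in> Alt (quant (flip s) \<phi>)" using Alt_nonempty by blast
  ultimately show ?thesis by (cases k) (auto simp: less_Suc_eq_le)
qed

lemma prenex_alt_bounded: "prenex s k \<phi> \<Longrightarrow> alt_bounded s k \<phi>"
proof (induction rule: prenex.induct)
  case (qf \<phi> s)
  then show ?case by (simp add: Alt_qf alt_bounded_def)
next
  case (flip s k \<phi>)
  then show ?case by (simp add: alt_bounded_flip)
next
  case (quant s k \<phi>)
  then show ?case by (simp add: alt_bounded_quant)
qed

lemma length_le_deg: "p \<in> Alt \<phi> \<Longrightarrow> length p \<le> deg \<phi>"
  by (simp add: deg_def finite_Alt)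

lemma U_cl_alt_bounded: "\<phi> \<in> U_cl k \<Longrightarrow> alt_bounded Minus k \<phi>"
  using length_le_deg[of _ \<phi>] by (cases k) (fastforce simp: F_cl_def alt_bounded_def)+

lemma E_cl_alt_bounded: "\<phi> \<in> E_cl k \<Longrightarrow> alt_bounded Plus k \<phi>"
  using length_le_deg[of _ \<phi>] by (cases k) (fastforce simp: F_cl_def alt_bounded_def)+

lemma prenex_form_PA_quant:
  assumes "\<And>s k. alt_bounded s k \<phi> \<Longrightarrow> prenex_form PA s k \<phi>" "alt_bounded s k (quant t \<phi>)"
  shows "prenex_form PA s k (quant t \<phi>)"
proof -
  have same: "prenex_form PA t k (quant t \<phi>)" if "alt_bounded t k (quant t \<phi>)" for k
    using that assms(1) prenex_form_quant by (cases k) (auto simp: alt_bounded_quant)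
  show ?thesis
  proof (cases "t = s")
    case True
    then show ?thesis using same assms(2) by simp
  next
    case False
    then have t: "t = flip s" by (simp add: neq_flip_iff)
    then obtain j where "k = Suc j" "alt_bounded t j (quant t \<phi>)"
      using assms(2) by (auto simp: alt_bounded_quant_flip)
    then show ?thesis using same t by (simp add: prenex_form_flip)
  qed
qed

theorem prenex_form_PA: "alt_bounded s k \<phi> \<Longrightarrow> prenex_form PA s k \<phi>"
proof (induction \<phi> arbitrary: s k)
  case (FAll \<phi>)
  show ?case using prenex_form_PA_quant[OF FAll.IH, of s k Minus] FAll.prems by simp
next
  case (FEx \<phi>)
  show ?case using prenex_form_PA_quant[OF FEx.IH, of s k Plus] FEx.prems by simp
qed (simp_all add: prenex_prenex_form qf_prenex alt_bounded_Imp alt_bounded_And alt_bounded_Or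
    prenex_form_PA_Imp prenex_form_And prenex_form_PA_Or)

subsection \<open>Formulas invariant under the negative translation\<close>

definition gg_invariant :: "fm set \<Rightarrow> fm \<Rightarrow> bool" where
  "gg_invariant T \<phi> \<longleftrightarrow> eqv T (gg \<phi>) \<phi>"

definition glivenko :: "fm set \<Rightarrow> fm \<Rightarrow> bool" where
  "glivenko T \<phi> \<longleftrightarrow> eqv T (gg \<phi>) (FDNeg \<phi>)"

lemma gg_invariant_glivenko: "gg_invariant T \<phi> \<Longrightarrow> glivenko T \<phi>"
  unfolding gg_invariant_def glivenko_def
  by (rule eqv_trans[OF eqv_sym[OF eqv_gg_stable] eqv_DNeg])

lemma gg_invariantI: "glivenko T \<phi> \<Longrightarrow> eqv T (FDNeg \<phi>) \<phi> \<Longrightarrow> gg_invariant T \<phi>"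
  unfolding gg_invariant_def glivenko_def by (rule eqv_trans)

lemma gg_invariant_stable: "gg_invariant T \<phi> \<Longrightarrow> eqv T (FDNeg \<phi>) \<phi>"
  using gg_invariant_glivenko[of T \<phi>] eqv_trans[OF eqv_sym]
  unfolding gg_invariant_def glivenko_def by blast

lemma gg_invariant_And: "gg_invariant T \<phi> \<Longrightarrow> gg_invariant T \<psi> \<Longrightarrow> gg_invariant T (FAnd \<phi> \<psi>)"
  by (simp add: gg_invariant_def eqv_And)

lemma gg_invariant_All: "gg_invariant T \<phi> \<Longrightarrow> gg_invariant T (FAll \<phi>)"
  by (simp add: gg_invariant_def eqv_All)

lemma gg_invariant_Neg: "gg_invariant T \<phi> \<Longrightarrow> gg_invariant T (FNeg \<phi>)"
  by (simp add: gg_invariant_def eqv_Neg)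

lemma gg_invariant_Imp:
  assumes "glivenko T \<phi>" "gg_invariant T \<psi>"
  shows "gg_invariant T (FImp \<phi> \<psi>)"
proof -
  have "eqv T (gg (FImp \<phi> \<psi>)) (FImp (FDNeg \<phi>) \<psi>)"
    using assms by (simp add: gg_invariant_def glivenko_def eqv_Imp)
  also have "eqv T (FImp (FDNeg \<phi>) \<psi>) (FImp \<phi> \<psi>)"
    using gg_invariant_stable[OF assms(2)] unfolding eqv_def
    by (rule prv_mp) (reify prv_reify, rule ipc_prv, code_simp)
  finally show ?thesis by (simp only: gg_invariant_def)
qed

lemma glivenko_And: "glivenko T \<phi> \<Longrightarrow> glivenko T \<psi> \<Longrightarrow> glivenko T (FAnd \<phi> \<psi>)"
  using eqv_trans[OF eqv_And eqv_sym[OF eqv_DNeg_And]] by (simp add: glivenko_def)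

lemma glivenko_Imp: "glivenko T \<phi> \<Longrightarrow> glivenko T \<psi> \<Longrightarrow> glivenko T (FImp \<phi> \<psi>)"
  using eqv_trans[OF eqv_Imp eqv_sym[OF eqv_DNeg_Imp]] by (simp add: glivenko_def)

lemma glivenko_Ex: "glivenko T \<phi> \<Longrightarrow> glivenko T (FEx \<phi>)"
  using eqv_trans[OF eqv_DNeg[OF eqv_Ex] eqv_sym[OF eqv_DNeg_Ex]]
  by (simp add: glivenko_def)

lemma eqv_qf_neg_tr: "qf \<phi> \<Longrightarrow> eqv HA (neg_tr \<phi> A) (FOr \<phi> A)"
proof (induction \<phi>)
  case (FEq s t)
  show ?case unfolding eqv_def neg_tr.simps
    by (rule prv_mp[OF qf_decidable[OF FEq]], reify prv_reify) (rule ipc_prv, code_simp)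
next
  case FBot
  show ?case unfolding eqv_def neg_tr.simps by (reify prv_reify) (rule ipc_prv, code_simp)
next
  case (FImp \<phi> \<psi>)
  then have "eqv HA (neg_tr (FImp \<phi> \<psi>) A) (FImp (FOr \<phi> A) (FOr \<psi> A))" by (simp add: eqv_Imp)
  moreover have "prv HA {} (FDec \<phi>)" using FImp.prems by (simp add: qf_decidable)
  then have "eqv HA (FImp (FOr \<phi> A) (FOr \<psi> A)) (FOr (FImp \<phi> \<psi>) A)"
    unfolding eqv_def by (rule prv_mp) (reify prv_reify, rule ipc_prv, code_simp)
  ultimately show ?case by (rule eqv_trans)
next
  case (FAnd \<phi> \<psi>)
  then have "eqv HA (neg_tr (FAnd \<phi> \<psi>) A) (FAnd (FOr \<phi> A) (FOr \<psi> A))" by (simp add: eqv_And)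
  moreover have "eqv HA (FAnd (FOr \<phi> A) (FOr \<psi> A)) (FOr (FAnd \<phi> \<psi>) A)"
    unfolding eqv_def by (reify prv_reify) (rule ipc_prv, code_simp)
  ultimately show ?case by (rule eqv_trans)
next
  case (FOr \<phi> \<psi>)
  then have "eqv HA (neg_tr (FOr \<phi> \<psi>) A) (dneg A (FOr (FOr \<phi> A) (FOr \<psi> A)))"
    by (simp add: eqv_Or eqv_dneg)
  also have "eqv HA (FOr (FOr \<phi> A) (FOr \<psi> A)) (FOr (FOr \<phi> \<psi>) A)"
    unfolding eqv_def by (reify prv_reify) (rule ipc_prv, code_simp)
  then have "eqv HA (dneg A (FOr (FOr \<phi> A) (FOr \<psi> A))) (dneg A (FOr (FOr \<phi> \<psi>) A))"
    by (rule eqv_dneg)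
  also have "eqv HA (dneg A (FOr (FOr \<phi> \<psi>) A)) (FOr (FOr \<phi> \<psi>) A)"
    by (rule eqv_dneg_Or_if_dec[OF qf_decidable[OF FOr.prems]])
  finally show ?case .
qed simp_all

subsection \<open>Theories with double negation elimination for \<open>\<Sigma>\<^sub>n\<close>\<close>

lemma proves_nneg_iff: "proves T (nneg P) \<longleftrightarrow> (\<forall>\<chi>\<in>P. prv T {} (FDNeg \<chi>))"
  by (auto simp: proves_def nneg_def theorems_def)

lemma proves_axioms: "P \<subseteq> T \<Longrightarrow> proves T P"
  by (auto simp: proves_def theorems_def intro: Ax)

locale HA_extension =
  fixes S :: "fm set"
  assumes HA: "\<chi> \<in> HA \<Longrightarrow> prv S {} \<chi>"
begin

lemma HA_prv: "prv HA \<Gamma> \<phi> \<Longrightarrow> prv S \<Gamma> \<phi>"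
  by (erule prv_theory_mono) (rule HA)

lemma HA_eqv: "eqv HA \<phi> \<psi> \<Longrightarrow> eqv S \<phi> \<psi>"
  by (erule eqv_theory_mono) (rule HA)

lemma extension: "HA_extension (S \<union> D)"
  by unfold_locales (rule prv_theory_mono[OF HA], assumption, simp add: Ax)

lemma qf_gg_invariant: "qf \<phi> \<Longrightarrow> gg_invariant S \<phi>"
  unfolding gg_invariant_def by (rule eqv_trans[OF HA_eqv[OF eqv_qf_neg_tr] eqv_Or_Bot])

lemma eqv_if_eqv_PA:
  assumes "gg_invariant S \<phi>" "gg_invariant S \<psi>" "eqv PA \<phi> \<psi>"
  shows "eqv S \<phi> \<psi>"
  using assms(1,2) HA_eqv[OF eqv_PA_gg[OF assms(3)]] unfolding gg_invariant_def
  by (blast intro: eqv_sym eqv_trans)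

lemma prv_one_parameter:
  assumes "\<And>\<rho>. FV (sub \<rho> \<phi>) \<subseteq> {0} \<Longrightarrow> prv S {} (sub \<rho> \<phi>)"
  shows "prv S {} \<phi>"
proof -
  obtain \<rho> t where \<rho>: "FV (sub \<rho> \<phi>) \<subseteq> {0}" "eqv HA (sub (\<lambda>_. t) (sub \<rho> \<phi>)) \<phi>"
    by (rule eqv_one_parameter)
  show ?thesis by (rule eqvD1[OF HA_eqv[OF \<rho>(2)] prv_sub[OF assms[OF \<rho>(1)]]])
qed

lemma prv_DNE:
  assumes "proves S (DNE \<Gamma>)" "\<And>\<rho>. sub \<rho> \<phi> \<in> \<Gamma>"
  shows "prv S {} (FImp (FDNeg \<phi>) \<phi>)"
proof (rule prv_one_parameter)
  fix \<rho> assume "FV (sub \<rho> (FImp (FDNeg \<phi>) \<phi>)) \<subseteq> {0}"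
  then have "FAll (sub \<rho> (FImp (FDNeg \<phi>) \<phi>)) \<in> DNE \<Gamma>" using assms(2) by (auto simp: DNE_def)
  then show "prv S {} (sub \<rho> (FImp (FDNeg \<phi>) \<phi>))"
    using assms(1) by (auto simp: proves_def theorems_def prv_FAll_iff)
qed

lemma prv_LEM:
  assumes "proves S (LEM \<Gamma>)" "\<And>\<rho>. sub \<rho> \<phi> \<in> \<Gamma>"
  shows "prv S {} (FDec \<phi>)"
proof (rule prv_one_parameter)
  fix \<rho> assume "FV (sub \<rho> (FDec \<phi>)) \<subseteq> {0}"
  then have "FAll (sub \<rho> (FDec \<phi>)) \<in> LEM \<Gamma>" using assms(2) by (auto simp: LEM_def)
  then show "prv S {} (sub \<rho> (FDec \<phi>))"
    using assms(1) by (auto simp: proves_def theorems_def prv_FAll_iff)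
qed

end

locale DNE_theory = HA_extension +
  fixes n :: nat
  assumes DNE: "prenex Plus n \<sigma> \<Longrightarrow> prv S {} (FImp (FDNeg \<sigma>) \<sigma>)"
begin

lemma prenex_gg_invariant:
  "prenex s k \<phi> \<Longrightarrow> k \<le> n \<or> k = Suc n \<and> s = Minus \<Longrightarrow> gg_invariant S \<phi>"
proof (induction rule: prenex.induct)
  case (qf \<phi> s)
  show ?case by (rule qf_gg_invariant[OF qf.hyps])
next
  case (flip s k \<phi>)
  then show ?case by auto
next
  case (quant s k \<phi>)
  then have \<phi>: "gg_invariant S \<phi>" by blast
  show ?case
  proof (cases s)
    case Plus
    then have "prenex Plus n (FEx \<phi>)"
      using prenex_le[OF prenex.quant[OF quant.hyps]] quant.prems by simp
    then have "eqv S (FDNeg (FEx \<phi>)) (FEx \<phi>)" by (rule eqv_DNeg_if_DNE[OF DNE])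
    then show ?thesis
      using gg_invariantI[OF glivenko_Ex[OF gg_invariant_glivenko[OF \<phi>]]] Plus by simp
  next
    case Minus
    then show ?thesis using gg_invariant_All[OF \<phi>] by simp
  qed
qed

lemma Sigma_gg_invariant: "prenex Plus n \<phi> \<Longrightarrow> gg_invariant S \<phi>"
  and Pi_gg_invariant: "prenex Minus (Suc n) \<phi> \<Longrightarrow> gg_invariant S \<phi>"
  using prenex_gg_invariant by auto

lemma gg_invariant_Ex:
  assumes "gg_invariant S \<phi>" "alt_bounded Plus n (FEx \<phi>)"
  shows "gg_invariant S (FEx \<phi>)"
proof (rule gg_invariantI)
  show "glivenko S (FEx \<phi>)" by (rule glivenko_Ex[OF gg_invariant_glivenko[OF assms(1)]])
  have "n \<noteq> 0" "alt_bounded Plus n \<phi>" using alt_bounded_quant[of Plus n \<phi>] assms(2) by simp_all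
  then obtain m where m: "n = Suc m" using not0_implies_Suc by blast
  obtain \<sigma> where \<sigma>: "prenex Plus n \<sigma>" "eqv PA \<phi> \<sigma>"
    using prenex_form_PA[OF \<open>alt_bounded Plus n \<phi>\<close>] by (auto simp: prenex_form_def)
  have "eqv S \<phi> \<sigma>" by (rule eqv_if_eqv_PA[OF assms(1) Sigma_gg_invariant[OF \<sigma>(1)] \<sigma>(2)])
  then have ex: "eqv S (FEx \<phi>) (FEx \<sigma>)" by (rule eqv_Ex)
  have "prenex Plus n (FEx \<sigma>)" using prenex.quant[of Plus m \<sigma>] \<sigma>(1) m by simp
  then have "eqv S (FDNeg (FEx \<sigma>)) (FEx \<sigma>)" by (rule eqv_DNeg_if_DNE[OF DNE])
  then show "eqv S (FDNeg (FEx \<phi>)) (FEx \<phi>)"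
    using eqv_trans[OF eqv_DNeg[OF ex]] eqv_sym[OF ex] eqv_trans by blast
qed

text \<open>The translation commutes with double negation except at \<open>\<forall>\<close>. A universal formula of the class
  \<open>E\<^sub>k\<close>, and an existential one of the class \<open>U\<^sub>k\<close>, has degree below \<open>k\<close>: the former avoids the case
  of \<open>\<forall>\<close>, the latter lets \<open>DNE(\<Sigma>\<^sub>n)\<close> apply to the prenex form of an existential formula.\<close>

theorem gg_invariant_U_glivenko_E:
  assumes "or_free \<phi>"
  shows "(alt_bounded Minus (Suc n) \<phi> \<longrightarrow> gg_invariant S \<phi>) \<and>
    (alt_bounded Plus (Suc n) \<phi> \<longrightarrow> glivenko S \<phi>)"
  using assms
proof (induction \<phi>)
  case (FEq s t)
  have "gg_invariant S (FEq s t)" by (rule qf_gg_invariant) simp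
  then show ?case by (simp add: gg_invariant_glivenko)
next
  case FBot
  have "gg_invariant S FBot" by (rule qf_gg_invariant) simp
  then show ?case by (simp add: gg_invariant_glivenko)
next
  case (FImp \<phi> \<psi>)
  then show ?case
    by (auto simp: alt_bounded_Imp gg_invariant_Imp glivenko_Imp gg_invariant_glivenko)
next
  case (FAnd \<phi> \<psi>)
  then show ?case by (auto simp: alt_bounded_And gg_invariant_And glivenko_And)
next
  case (FAll \<phi>)
  have U: "gg_invariant S (FAll \<phi>)" if "alt_bounded Minus (Suc n) (FAll \<phi>)"
    using FAll that alt_bounded_quant[of Minus _ \<phi>] by (simp add: gg_invariant_All)
  moreover have "alt_bounded Minus (Suc n) (FAll \<phi>)" if "alt_bounded Plus (Suc n) (FAll \<phi>)"
    using that alt_bounded_quant_flip[of Plus _ \<phi>] alt_bounded_mono[of Minus n _ "Suc n"] by simp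
  ultimately show ?case using gg_invariant_glivenko by blast
next
  case (FEx \<phi>)
  have "gg_invariant S (FEx \<phi>)" if "alt_bounded Minus (Suc n) (FEx \<phi>)"
  proof -
    have E: "alt_bounded Plus n (FEx \<phi>)" using that alt_bounded_quant_flip[of Minus _ \<phi>] by simp
    then have "alt_bounded Minus (Suc n) \<phi>"
      using alt_bounded_quant[of Plus n \<phi>] alt_bounded_flip[of Minus n \<phi>] by simp
    then show ?thesis using FEx gg_invariant_Ex[OF _ E] by simp
  qed
  moreover have "glivenko S (FEx \<phi>)" if "alt_bounded Plus (Suc n) (FEx \<phi>)"
    using FEx that alt_bounded_quant[of Plus _ \<phi>] by (simp add: glivenko_Ex)
  ultimately show ?case by blast
qed simp

corollary prenex_form_U:
  assumes "or_free \<phi>" "alt_bounded Minus k \<phi>" "k \<le> Suc n"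
  shows "prenex_form S Minus k \<phi>"
proof -
  obtain \<pi> where \<pi>: "prenex Minus k \<pi>" "FV \<pi> = FV \<phi>" "eqv PA \<phi> \<pi>"
    using prenex_form_PA[OF assms(2)] by (auto simp: prenex_form_def)
  have "gg_invariant S \<phi>"
    using gg_invariant_U_glivenko_E assms(1) alt_bounded_mono[OF assms(2,3)] by blast
  moreover have "gg_invariant S \<pi>" by (rule Pi_gg_invariant[OF prenex_le[OF \<pi>(1) assms(3)]])
  ultimately have "eqv S \<phi> \<pi>" using \<pi>(3) by (rule eqv_if_eqv_PA)
  then show ?thesis using \<pi>(1,2) by (auto simp: prenex_form_def)
qed

end

subsection \<open>Conservation over theories deciding \<open>\<Sigma>\<^sub>n\<close>\<close>

locale LEM_theory = DNE_theory +
  assumes LEM: "prenex Plus n \<sigma> \<Longrightarrow> prv S {} (FDec \<sigma>)"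
begin

lemma Pi_counterexample:
  assumes "prenex Minus (Suc j) \<phi>" "Suc j \<le> n"
  shows "prv S {} (FOr (FAll \<phi>) (FEx (FNeg \<phi>)))"
proof -
  have \<phi>: "gg_invariant S \<phi>"
    using assms(2) by (intro Pi_gg_invariant prenex_le[OF assms(1)]) simp
  obtain \<sigma> where \<sigma>: "prenex Plus (Suc j) \<sigma>" "eqv PA (FNeg \<phi>) \<sigma>"
    using prenex_form_PA_Neg[OF prenex_prenex_form[OF assms(1)]] by (auto simp: prenex_form_def)
  have "gg_invariant S \<sigma>" by (rule Sigma_gg_invariant[OF prenex_le[OF \<sigma>(1) assms(2)]])
  then have "eqv S (FNeg \<phi>) \<sigma>" by (rule eqv_if_eqv_PA[OF gg_invariant_Neg[OF \<phi>] _ \<sigma>(2)])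
  then have ex: "eqv S (FEx (FNeg \<phi>)) (FEx \<sigma>)" by (rule eqv_Ex)
  have "prenex Plus n (FEx \<sigma>)" using prenex_le[OF prenex.quant[OF \<sigma>(1)] assms(2)] by simp
  then have "prv S {} (FDec (FEx \<sigma>))" by (rule LEM)
  then have "prv S {} (FDec (FEx (FNeg \<phi>)))"
    by (rule eqvD2[OF eqv_Or[OF ex eqv_Neg[OF ex]]])
  moreover have "eqv S (FNeg (FEx (FNeg \<phi>))) (FAll \<phi>)"
    by (rule eqv_trans[OF eqv_Neg_Ex eqv_All[OF gg_invariant_stable[OF \<phi>]]])
  ultimately have "prv S {} (FOr (FEx (FNeg \<phi>)) (FAll \<phi>))"
    using eqvD1[OF eqv_Or[OF eqv_refl]] by blast
  then show ?thesis by (rule prv_mp) (reify prv_reify, rule ipc_prv, code_simp)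
qed

lemma eqv_neg_tr_Or: "prenex s k \<phi> \<Longrightarrow> k \<le> n \<Longrightarrow> eqv S (neg_tr \<phi> A) (FOr \<phi> A)"
proof (induction arbitrary: A rule: prenex.induct)
  case (qf \<phi> s)
  then show ?case by (intro HA_eqv eqv_qf_neg_tr)
next
  case (flip s k \<phi>)
  then show ?case by simp
next
  case (quant s k \<phi>)
  show ?case
  proof (cases s)
    case Plus
    have "eqv S (neg_tr (FEx \<phi>) A) (dneg A (FEx (FOr \<phi> (lift A))))"
      using eqv_dneg[OF eqv_Ex[OF quant.IH[OF quant.prems]]] by simp
    also have "eqv S (dneg A (FEx (FOr \<phi> (lift A)))) (dneg A (FOr (FEx \<phi>) A))"
      by (rule eqv_dneg[OF eqv_Ex_Or])
    also have "prenex Plus n (FEx \<phi>)"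
      using prenex_le[OF prenex.quant[OF quant.hyps] quant.prems] Plus by simp
    then have "eqv S (dneg A (FOr (FEx \<phi>) A)) (FOr (FEx \<phi>) A)"
      by (rule eqv_dneg_Or_if_dec[OF LEM])
    finally show ?thesis using Plus by simp
  next
    case Minus
    have "eqv S (neg_tr (FAll \<phi>) A) (FAll (FOr \<phi> (lift A)))"
      using eqv_All[OF quant.IH[OF quant.prems]] by simp
    also have "eqv S (FAll (FOr \<phi> (lift A))) (FOr (FAll \<phi>) A)"
      using quant.hyps quant.prems Minus by (intro eqv_All_Or Pi_counterexample) simp_all
    finally show ?thesis using Minus by simp
  qed
qed

lemma neg_tr_imp_dneg: "prenex Plus (Suc n) \<phi> \<Longrightarrow> prv S {} (FImp (neg_tr \<phi> A) (dneg A \<phi>))"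
proof (induction arbitrary: A rule: prenex_Suc_induct)
  case (flip \<phi>)
  then have "eqv S (neg_tr \<phi> A) (FOr \<phi> A)" by (rule eqv_neg_tr_Or) simp
  then show ?case
    unfolding eqv_def by (rule prv_mp) (reify prv_reify, rule ipc_prv, code_simp)
next
  case (quant \<phi>)
  then show ?case using neg_tr_dneg_Ex by simp
qed

theorem PA_conservative:
  assumes "prenex Minus (Suc (Suc n)) \<phi>" "prv PA {} \<phi>"
  shows "prv S {} \<phi>"
  using assms
proof (induction rule: prenex_Suc_induct)
  case (flip \<phi>)
  have "prv S {} (neg_tr \<phi> \<phi>)" using HA_prv[OF prv_PA_neg_tr[OF flip.prems]] by simp
  moreover have "prv S {} (FImp (neg_tr \<phi> \<phi>) (dneg \<phi> \<phi>))"
    using neg_tr_imp_dneg flip.hyps by simp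
  ultimately show ?case by (rule prv_mp2) (reify prv_reify, rule ipc_prv, code_simp)
next
  case (quant \<phi>)
  then show ?case by (simp add: prv_FAll_iff)
qed

end

subsection \<open>From doubly negated \<open>DNE\<close> to prenex normal forms\<close>

context DNE_theory
begin

lemma LEM_theory_if_LEM_Pi:
  assumes "proves S (LEM (Pi_cl n))"
  shows "LEM_theory S n"
proof unfold_locales
  fix \<sigma> assume \<sigma>: "prenex Plus n \<sigma>"
  obtain \<pi> where \<pi>: "prenex Minus n \<pi>" "eqv PA (FNeg \<sigma>) \<pi>"
    using prenex_form_PA_Neg[OF prenex_prenex_form[OF \<sigma>]] by (auto simp: prenex_form_def)
  have eqv: "eqv S (FNeg \<sigma>) \<pi>"
    by (intro eqv_if_eqv_PA[OF _ _ \<pi>(2)] gg_invariant_Neg Sigma_gg_invariant[OF \<sigma>]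
        Pi_gg_invariant prenex_Suc \<pi>(1))
  have "prv S {} (FDec \<pi>)" by (rule prv_LEM[OF assms]) (simp add: Pi_cl_iff prenex_sub \<pi>(1))
  then have "prv S {} (FDec (FNeg \<sigma>))"
    by (rule eqvD2[OF eqv_Or[OF eqv eqv_Neg[OF eqv]]])
  with DNE[OF \<sigma>] show "prv S {} (FDec \<sigma>)"
    by (rule prv_mp2) (reify prv_reify, rule ipc_prv, code_simp)
qed

end

lemma FV_DNE: "\<chi> \<in> DNE \<Gamma> \<Longrightarrow> FV \<chi> = {}"
  by (auto simp: DNE_def)

lemma FV_LEM: "\<chi> \<in> LEM \<Gamma> \<Longrightarrow> FV \<chi> = {}"
  by (auto simp: LEM_def)

lemma PNFT_subset: "\<Gamma> \<subseteq> \<Delta> \<Longrightarrow> PNFT T \<Delta> \<Gamma>' \<Longrightarrow> PNFT T \<Gamma> \<Gamma>'"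
  by (auto simp: PNFT_def)

definition or_free_neg_U :: "nat \<Rightarrow> fm set" where
  "or_free_neg_U k = {FNeg \<phi> | \<phi>. or_free \<phi> \<and> alt_bounded Minus k (FNeg \<phi>)}"

lemma or_free_neg_E_cl_subset: "or_free_part (neg (E_cl k)) \<subseteq> or_free_neg_U k"
  using E_cl_alt_bounded by (fastforce simp: or_free_part_def neg_def or_free_neg_U_def)

lemma or_free_nneg_U_cl_subset: "or_free_part (nneg (U_cl k)) \<subseteq> or_free_neg_U k"
  using U_cl_alt_bounded by (fastforce simp: or_free_part_def nneg_def or_free_neg_U_def)

context HA_extension
begin

lemma DNE_theory_if_DNE_Sigma: "proves S (DNE (Sigma_cl n)) \<Longrightarrow> DNE_theory S n"
  by unfold_locales (rule prv_DNE, assumption, simp add: Sigma_cl_iff prenex_sub)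

lemma nneg_DNE_Sigma_0: "proves S (nneg (DNE (Sigma_cl 0)))"
proof -
  have "prv S {} (FAll (FImp (FDNeg \<phi>) \<phi>))" if "qf \<phi>" for \<phi>
    using HA_prv[OF prv_DNE_if_dec[OF qf_decidable[OF that]]] by (simp add: prv_FAll_iff)
  then show ?thesis by (auto simp: proves_nneg_iff DNE_def prv_DNegI)
qed

theorem PNFT_if_nneg_DNE:
  assumes "proves S (nneg (DNE (Sigma_cl n)))" "k \<le> Suc n"
  shows "PNFT S (or_free_neg_U k) (nneg (Pi_cl k))"
  unfolding PNFT_def
proof
  fix \<phi> assume "\<phi> \<in> or_free_neg_U k"
  then obtain \<psi> where \<phi>: "\<phi> = FNeg \<psi>" "or_free \<phi>" "alt_bounded Minus k \<phi>"
    by (auto simp: or_free_neg_U_def)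
  let ?D = "DNE (Sigma_cl n)"
  interpret ext: HA_extension "S \<union> ?D" by (rule extension)
  interpret ext: DNE_theory "S \<union> ?D" n
    by (rule ext.DNE_theory_if_DNE_Sigma[OF proves_axioms]) simp
  obtain \<pi> where \<pi>: "prenex Minus k \<pi>" "FV \<pi> = FV \<phi>" "eqv (S \<union> ?D) \<phi> \<pi>"
    using ext.prenex_form_U[OF \<phi>(2,3) assms(2)] by (auto simp: prenex_form_def)
  then have "prv (S \<union> ?D) {} (FIff \<phi> \<pi>)" by (simp add: eqv_def)
  then have "prv S {} (FDNeg (FIff \<phi> \<pi>))"
    by (rule prv_nneg_sentences[OF _ FV_DNE]) (use assms(1) in \<open>simp_all add: proves_nneg_iff\<close>)
  then have "prv S {} (FIff \<phi> (FDNeg \<pi>))"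
    unfolding \<phi>(1) by (rule prv_mp) (reify prv_reify, rule ipc_prv, code_simp)
  then show "\<exists>\<phi>'\<in>nneg (Pi_cl k). FV \<phi> = FV \<phi>' \<and> FIff \<phi> \<phi>' \<in> theorems S"
    using \<pi>(1,2) by (intro bexI[of _ "FDNeg \<pi>"]) (auto simp: theorems_def nneg_def Pi_cl_iff)
qed

corollary PNFT_if_nneg_DNE_below:
  assumes "\<forall>m<k. proves S (nneg (DNE (Sigma_cl m)))" "k' \<le> k"
  shows "PNFT S (or_free_neg_U k') (nneg (Pi_cl k'))"
proof (rule PNFT_if_nneg_DNE)
  show "proves S (nneg (DNE (Sigma_cl (k - 1))))"
    using assms(1) nneg_DNE_Sigma_0 by (cases k) auto
qed (use assms(2) in simp)

end

subsection \<open>From prenex normal forms to doubly negated \<open>DNE\<close>\<close>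

lemma deg_le_if_alt_bounded: "alt_bounded s k \<phi> \<Longrightarrow> deg \<phi> \<le> k"
  unfolding deg_def
  by (intro Max.boundedI) (fastforce simp: alt_bounded_def finite_Alt Alt_nonempty)+

lemma deg_DNE_instance:
  assumes "prenex s k \<sigma>"
  shows "deg (FAll (FImp (FDNeg \<sigma>) \<sigma>)) \<le> Suc k"
proof -
  have "alt_bounded t (Suc k) \<sigma>" for t
    using prenex_alt_bounded[OF assms] alt_bounded_mono[of s k \<sigma> "Suc k"] alt_bounded_flip[of t k \<sigma>]
    by (cases "s = t") (simp_all add: neq_flip_iff)
  then have "alt_bounded Minus (Suc k) (quant Minus (FImp (FDNeg \<sigma>) \<sigma>))"
    by (simp add: alt_bounded_quant alt_bounded_Imp alt_bounded_def[of _ _ FBot] del: quant.simps)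
  then show ?thesis using deg_le_if_alt_bounded by simp
qed

lemma init_sign_Alt_FAll: "p \<in> Alt (FAll \<phi>) \<Longrightarrow> init_sign p = Some Minus"
  using init_sign_Alt_quant[of p Minus] by simp

lemma deg_FAll_pos: "deg (FAll \<phi>) \<noteq> 0"
proof -
  obtain p where p: "p \<in> Alt (FAll \<phi>)" using Alt_nonempty by blast
  then have "p \<noteq> []" using init_sign_Alt_FAll[OF p] by (cases p) auto
  then show ?thesis using length_le_deg[OF p] by (cases p) auto
qed

lemma deg_FNeg: "deg (FNeg \<phi>) = deg \<phi>"
  by (simp add: deg_def image_image)

lemma FAll_U_cl: "FAll \<phi> \<in> U_cl (deg (FAll \<phi>))"
  using deg_FAll_pos[of \<phi>] init_sign_Alt_FAll[of _ \<phi>]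
  by (cases "deg (FAll \<phi>)") (auto simp: F_cl_def simp del: Alt.simps)

lemma FNeg_FAll_E_cl: "FNeg (FAll \<phi>) \<in> E_cl (deg (FAll \<phi>))"
proof -
  have "init_sign p = Some Plus" if "p \<in> Alt (FNeg (FAll \<phi>))" for p
    using that init_sign_Alt_FAll[of _ \<phi>] by (auto simp del: Alt.simps(6))
  then show ?thesis using deg_FAll_pos[of \<phi>] deg_FNeg[of "FAll \<phi>"]
    by (cases "deg (FAll \<phi>)") (auto simp: F_cl_def simp del: Alt.simps)
qed

lemma nneg_FAll_or_free_part:
  assumes "or_free \<phi>"
  shows "FDNeg (FAll \<phi>) \<in> or_free_part (neg (E_cl (deg (FAll \<phi>))))"
    and "FDNeg (FAll \<phi>) \<in> or_free_part (nneg (U_cl (deg (FAll \<phi>))))"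
  using assms FNeg_FAll_E_cl[of \<phi>] FAll_U_cl[of \<phi>]
  by (auto simp: or_free_part_def neg_def nneg_def)

definition nneg_FAll_prenex :: "fm set \<Rightarrow> nat \<Rightarrow> bool" where
  "nneg_FAll_prenex T k \<longleftrightarrow> (\<forall>\<phi>. or_free \<phi> \<longrightarrow> deg (FAll \<phi>) \<le> k \<longrightarrow>
     (\<exists>\<pi>. prenex Minus k \<pi> \<and> eqv T (FDNeg (FAll \<phi>)) (FDNeg \<pi>)))"

lemma nneg_FAll_prenexE:
  assumes "nneg_FAll_prenex T k" "or_free \<phi>" "deg (FAll \<phi>) \<le> k"
  obtains \<pi> where "prenex Minus k \<pi>" "eqv T (FDNeg (FAll \<phi>)) (FDNeg \<pi>)"
  using assms unfolding nneg_FAll_prenex_def by blast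

lemma nneg_FAll_prenexI:
  assumes "\<forall>k'\<le>k. PNFT T (or_free_part (neg (E_cl k'))) (nneg (Pi_cl k')) \<or>
      PNFT T (or_free_part (nneg (U_cl k'))) (nneg (Pi_cl k'))"
    and "j \<le> k"
  shows "nneg_FAll_prenex T j"
  unfolding nneg_FAll_prenex_def
proof (intro allI impI)
  fix \<phi> assume \<phi>: "or_free \<phi>" "deg (FAll \<phi>) \<le> j"
  then have "deg (FAll \<phi>) \<le> k" using assms(2) by simp
  then obtain \<pi> where "prenex Minus (deg (FAll \<phi>)) \<pi>"
    "eqv T (FDNeg (FAll \<phi>)) (FDNeg \<pi>)"
    using assms(1) nneg_FAll_or_free_part[OF \<phi>(1)]
    unfolding PNFT_def nneg_def[of "Pi_cl _"] theorems_def eqv_def Pi_cl_iff by blast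
  then show "\<exists>\<pi>. prenex Minus j \<pi> \<and> eqv T (FDNeg (FAll \<phi>)) (FDNeg \<pi>)"
    using prenex_le[OF _ \<phi>(2)] by blast
qed

context HA_extension
begin

lemma nneg_PA_conservative:
  assumes "proves S (nneg (DNE (Sigma_cl n)))" "proves S (nneg (LEM (Pi_cl n)))"
    and "prenex Minus (Suc (Suc n)) \<pi>" "prv PA {} \<pi>"
  shows "prv S {} (FDNeg \<pi>)"
proof -
  let ?D = "DNE (Sigma_cl n) \<union> LEM (Pi_cl n)"
  interpret ext: HA_extension "S \<union> ?D" by (rule extension)
  interpret ext: DNE_theory "S \<union> ?D" n
    by (rule ext.DNE_theory_if_DNE_Sigma[OF proves_axioms]) blast
  interpret ext: LEM_theory "S \<union> ?D" n
    by (rule ext.LEM_theory_if_LEM_Pi[OF proves_axioms]) blast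
  have "prv (S \<union> ?D) {} \<pi>" by (rule ext.PA_conservative[OF assms(3,4)])
  then show ?thesis
    by (rule prv_nneg_sentences) (use assms(1,2) FV_DNE FV_LEM in \<open>auto simp: proves_nneg_iff\<close>)
qed

lemma nneg_DNE_Suc:
  assumes sound: "\<And>\<phi>. prv S {} \<phi> \<Longrightarrow> prv PA {} \<phi>"
    and DNE: "proves S (nneg (DNE (Sigma_cl n)))" and LEM: "proves S (nneg (LEM (Pi_cl n)))"
    and prenex: "nneg_FAll_prenex S (Suc (Suc n))"
  shows "proves S (nneg (DNE (Sigma_cl (Suc n))))"
  unfolding proves_nneg_iff
proof
  fix \<chi> assume "\<chi> \<in> DNE (Sigma_cl (Suc n))"
  then obtain \<phi> where \<phi>: "prenex Plus (Suc n) \<phi>" "\<chi> = FAll (FImp (FDNeg \<phi>) \<phi>)"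
    by (auto simp: DNE_def Sigma_cl_iff)
  obtain \<sigma> where \<sigma>: "prenex Plus (Suc n) \<sigma>" "or_free \<sigma>" "eqv HA \<phi> \<sigma>"
    using prenex_or_free[OF \<phi>(1)] by blast
  let ?\<theta> = "FAll (FImp (FDNeg \<sigma>) \<sigma>)"
  have \<theta>: "eqv S \<chi> ?\<theta>"
    unfolding \<phi>(2) using HA_eqv[OF \<sigma>(3)] by (intro eqv_All eqv_Imp eqv_Neg)
  obtain \<pi> where \<pi>: "prenex Minus (Suc (Suc n)) \<pi>" "eqv S (FDNeg ?\<theta>) (FDNeg \<pi>)"
    by (rule nneg_FAll_prenexE[OF prenex _ deg_DNE_instance[OF \<sigma>(1)]]) (simp add: \<sigma>(2))
  have "eqv PA (FDNeg ?\<theta>) (FDNeg \<pi>)"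
    using sound \<pi>(2) unfolding eqv_def by blast
  moreover have "prv PA {} (FDNeg ?\<theta>)"
    by (rule prv_DNegI) (simp add: prv_FAll_iff PA_DNE)
  ultimately have "prv PA {} \<pi>" by (metis eqvD1 PA_DNeg)
  then have "prv S {} (FDNeg \<pi>)" by (rule nneg_PA_conservative[OF DNE LEM \<pi>(1)])
  then have "prv S {} (FDNeg ?\<theta>)" by (rule eqvD2[OF \<pi>(2)])
  then show "prv S {} (FDNeg \<chi>)" by (rule eqvD2[OF eqv_DNeg[OF \<theta>]])
qed

theorem nneg_DNE_if_nneg_FAll_prenex:
  assumes "\<And>\<phi>. prv S {} \<phi> \<Longrightarrow> prv PA {} \<phi>"
    and "\<forall>m. Suc (Suc m) \<le> k \<longrightarrow> proves S (nneg (LEM (Pi_cl m)))"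
    and "\<And>j. j \<le> k \<Longrightarrow> nneg_FAll_prenex S j"
  shows "m < k \<Longrightarrow> proves S (nneg (DNE (Sigma_cl m)))"
proof (induction m)
  case 0
  show ?case by (rule nneg_DNE_Sigma_0)
next
  case (Suc m)
  then show ?case by (intro nneg_DNE_Suc assms) (use assms(2) in simp_all)
qed

end

subsection \<open>The equivalence\<close>

lemma proves_nneg_subset: "P \<subseteq> Q \<Longrightarrow> proves T (nneg Q) \<Longrightarrow> proves T (nneg P)"
  by (auto simp: proves_nneg_iff)

lemma DNE_mono: "\<Gamma> \<subseteq> \<Delta> \<Longrightarrow> DNE \<Gamma> \<subseteq> DNE \<Delta>"
  by (auto simp: DNE_def)

lemma LEM_mono: "\<Gamma> \<subseteq> \<Delta> \<Longrightarrow> LEM \<Gamma> \<subseteq> LEM \<Delta>"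
  by (auto simp: LEM_def)

lemma proves_nneg_DNE_Sigma_iff:
  "proves T (nneg (DNE_Sigma (int k - 1))) \<longleftrightarrow> (\<forall>m<k. proves T (nneg (DNE (Sigma_cl m))))"
proof (cases k)
  case 0
  then show ?thesis by (simp add: DNE_Sigma_def proves_nneg_iff)
next
  case (Suc l)
  have "proves T (nneg (DNE (Sigma_cl m)))" if "proves T (nneg (DNE (Sigma_cl l)))" "m \<le> l" for m
    using prenex_le[OF _ that(2)]
    by (intro proves_nneg_subset[OF DNE_mono that(1)]) (auto simp: Sigma_cl_iff)
  then show ?thesis using Suc by (auto simp: DNE_Sigma_def less_Suc_eq_le)
qed

lemma proves_nneg_LEM_Pi_iff:
  "proves T (nneg (LEM_Pi (int k - 2))) \<longleftrightarrow>
    (\<forall>m. Suc (Suc m) \<le> k \<longrightarrow> proves T (nneg (LEM (Pi_cl m))))"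
proof (cases "k < 2")
  case True
  then show ?thesis by (simp add: LEM_Pi_def proves_nneg_iff)
next
  case False
  then obtain l where l: "k = Suc (Suc l)" using add_2_eq_Suc le_Suc_ex not_less by metis
  have "proves T (nneg (LEM (Pi_cl m)))" if "proves T (nneg (LEM (Pi_cl l)))" "m \<le> l" for m
    using prenex_le[OF _ that(2)]
    by (intro proves_nneg_subset[OF LEM_mono that(1)]) (auto simp: Pi_cl_iff)
  then show ?thesis using l by (auto simp: LEM_Pi_def)
qed

theorem theorem7p19:
  fixes k :: nat and T :: "fm set"
  assumes "in_between (HA \<union> nneg (LEM_Pi (int k - 2))) PA T"
  defines "stmt1 \<equiv> \<forall>k'\<le>k. PNFT T (or_free_part (neg (E_cl k'))) (nneg (Pi_cl k'))"
    and "stmt2 \<equiv> \<forall>k'\<le>k. PNFT T (or_free_part (nneg (U_cl k'))) (nneg (Pi_cl k'))"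
    and "stmt3 \<equiv> proves T (nneg (DNE_Sigma (int k - 1)))"
  shows "(stmt1 \<longleftrightarrow> stmt2) \<and> (stmt2 \<longleftrightarrow> stmt3) \<and> (stmt1 \<longleftrightarrow> stmt3)"
proof -
  have axioms: "prv T {} \<chi>" if "\<chi> \<in> HA \<union> nneg (LEM_Pi (int k - 2))" for \<chi>
    using assms(1) Ax[OF that] by (auto simp: in_between_def theorems_def)
  interpret HA_extension T by unfold_locales (use axioms in blast)
  have sound: "prv PA {} \<phi>" if "prv T {} \<phi>" for \<phi>
    using assms(1) that by (auto simp: in_between_def theorems_def)
  have LEM: "\<forall>m. Suc (Suc m) \<le> k \<longrightarrow> proves T (nneg (LEM (Pi_cl m)))"
    unfolding proves_nneg_LEM_Pi_iff[symmetric] using axioms by (auto simp: proves_def theorems_def)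
  have "PNFT T (or_free_neg_U k') (nneg (Pi_cl k'))" if stmt3 "k' \<le> k" for k'
    using that unfolding stmt3_def proves_nneg_DNE_Sigma_iff by (rule PNFT_if_nneg_DNE_below)
  then have "stmt1" "stmt2" if stmt3
    using that PNFT_subset[OF or_free_neg_E_cl_subset] PNFT_subset[OF or_free_nneg_U_cl_subset]
    unfolding stmt1_def stmt2_def by blast+
  moreover have "nneg_FAll_prenex T j" if "stmt1 \<or> stmt2" "j \<le> k" for j
    using that unfolding stmt1_def stmt2_def by (intro nneg_FAll_prenexI) blast
  then have stmt3 if "stmt1 \<or> stmt2"
    unfolding stmt3_def proves_nneg_DNE_Sigma_iff
    using nneg_DNE_if_nneg_FAll_prenex[OF sound LEM] that by blast
  ultimately show ?thesis by blast
qed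

end
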